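(* Let $A\in\mathbb{R}^{n\times n}$ be a symmetric HSS matrix of HSS rank $r$ associated with a cluster tree $\mathcal{T}$ of depth $L$, let $f$ be a function that is analytic on an interval $[\lambda_{\min},\lambda_{\max}]$ containing the eigenvalues of $A$, and let $\boldsymbol{\xi}_k=(\xi_0,\dots,\xi_{k-1})$, $\xi_j\in\mathbb{C}\cup\{\infty\}$, be a list of poles closed under complex conjugation. Let $\{U_\tau,D_\tau\}_{\tau\in\mathcal{T}}$ be a standard symmetric telescopic decomposition of $A$ of telescopic rank $r$, and let $F$ be the matrix returned (in telescopic form) by the algorithm $\mathsf{Alg}$ described in the context, applied to $\{U_\tau,D_\tau\}_{\tau\in\mathcal{T}}$, $f$ and $\boldsymbol{\xi}_k$. Then $E(f):=f(A)-F$ satisfies $$\|E(f)\|_2\le 4L\min_{\rho\in \mathbb{P}_k/q_k}\|f-\rho\|_\infty ,$$ where $q_k(x)=\prod_{\xi\in\boldsymbol{\xi}_k,\ \xi\ne\infty}(x-\xi)$, $\mathbb{P}_k$ denotes the set of polynomials of degree at most $k-1$, $\mathbb{P}_k/q_k=\{p/q_k: p\in\mathbb{P}_k\}$, and $\|\cdot\|_\infty$ denotes the supremum norm on $[\lambda_{\min},\lambda_{\max}]$.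
   Context: **Matrix functions.** For symmetric $M=V\,\mathrm{diag}(\lambda_i)V^T$ with $V$ orthogonal, $f(M)=V\,\mathrm{diag}(f(\lambda_i))V^T$. **Cluster trees.** A cluster tree $\mathcal{T}$ of depth $L$ for $I=[1,\dots,n]$ is a perfect binary tree of depth $L$ whose root $\gamma$ is associated with $I$, and such that each non-leaf node $\tau$ with index vector $I_\tau$ has two children $\alpha,\beta$ (in this order) associated with vectors of consecutive indices $I_\alpha,I_\beta$ whose concatenation is $I_\tau$. The depth of a node is its distance from the root; $|\tau|$ is the length of $I_\tau$. $A_{\tau,\tau'}$ is the submatrix of $A$ with row indices $I_\tau$ and column indices $I_{\tau'}$. Siblings are distinct children of the same node. For integers $m,\ell$, $\mathcal{T}_m^{(\ell)}$ is the balanced cluster tree of depth $\ell$ for $[1,\dots,2^\ell m]$ with leaves associated with $[(i-1)m+1,\dots,im]$, $i=1,\dots,2^\ell$; for $\ell<L$ its nodes are identified with the nodes of $\mathcal{T}$ of depth at most $\ell$. For matrices $C_\tau$ indexed by nodes, $\boldsymbol{C}^{(\ell)}$ denotes the block diagonal matrix whose diagonal blocks are the $C_\tau$ with $\mathrm{depth}(\tau)=\ell$, in natural (left-to-right) order. **HSS matrices.** $A\in\mathbb{R}^{n\times n}$ is an HSS matrix of HSS rank $r$ associated with $\mathcal{T}$ if: (1) for each pair of siblings $\tau,\tau'$ there are $U_\tau^{(\mathrm{big})}\in\mathbb{R}^{|\tau|\times r}$, $V_{\tau'}^{(\mathrm{big})}\in\mathbb{R}^{|\tau'|\times r}$ with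 orthonormal columns (one such pair $U^{(\mathrm{big})}_\tau,V^{(\mathrm{big})}_\tau$ for each non-root node $\tau$) and $\tilde A_{\tau,\tau'}\in\mathbb{R}^{r\times r}$ with $A_{\tau,\tau'}=U_\tau^{(\mathrm{big})}\tilde A_{\tau,\tau'}(V_{\tau'}^{(\mathrm{big})})^T$; (2) for each non-leaf, non-root node $\tau$ with children $\alpha,\beta$ there are $U_\tau,V_\tau\in\mathbb{R}^{2r\times r}$ with orthonormal columns such that $U_\tau^{(\mathrm{big})}=\mathrm{blkdiag}(U_\alpha^{(\mathrm{big})},U_\beta^{(\mathrm{big})})U_\tau$ and $V_\tau^{(\mathrm{big})}=\mathrm{blkdiag}(V_\alpha^{(\mathrm{big})},V_\beta^{(\mathrm{big})})V_\tau$. (At the root such factors play no role.) **Symmetric telescopic decompositions.** A symmetric telescopic decomposition $\{U_\tau,D_\tau\}_{\tau\in\mathcal{T}}$ of telescopic rank $r$ of $A$ consists of real matrices $U_\tau$ (for $\mathrm{depth}(\tau)\ge1$) and symmetric real $D_\tau$ (all $\tau$) such that: $D_\tau$ is $|\tau|\times|\tau|$ if $\mathrm{depth}(\tau)=L$ and $2r\times 2r$ otherwise; $U_\tau$ has orthonormal columns and is $|\tau|\times r$ if $\mathrm{depth}(\tau)=L$ and $2r\times r$ otherwise; and, defining $A^{(0)}:=D_\gamma$ and $A^{(\ell)}:=\boldsymbol{D}^{(\ell)}+\boldsymbol{U}^{(\ell)}A^{(\ell-1)}(\boldsymbol{U}^{(\ell)})^T$ for $\ell=1,\dots,L$, one has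 $A=A^{(L)}$. It is called standard if for every $1\le\ell\le L$ and every node $\tau$ of depth $\ell$ the diagonal block $(A^{(\ell)})_{\tau,\tau}$ of $A^{(\ell)}$ corresponding to $\tau$ (with respect to $\mathcal{T}_{2r}^{(\ell)}$ if $\ell<L$, and $\mathcal{T}$ if $\ell=L$) equals $D_\tau$. **Rational Krylov subspaces.** For $M\in\mathbb{R}^{p\times p}$, $B\in\mathbb{R}^{p\times b}$ and a list of poles $\boldsymbol{\xi}_k$, none of which is an eigenvalue of $M$, let $\mathcal{Q}(M,B,\boldsymbol{\xi}_k)=\{q_k(M)^{-1}\sum_{j=0}^{k-1}M^jBC_j:\ C_j\in\mathbb{R}^{b\times b}\}$. An orthonormal basis of it is a matrix with orthonormal columns whose columns form a basis of the span of all columns of all elements of $\mathcal{Q}(M,B,\boldsymbol{\xi}_k)$ (a real matrix when $\boldsymbol{\xi}_k$ is closed under complex conjugation). **Algorithm $\mathsf{Alg}$.** Input: a standard symmetric telescopic decomposition $\{U_\tau,D_\tau\}_{\tau\in\mathcal{T}}$ of $A$, the function $f$, the list $\boldsymbol{\xi}_k$ closed under complex conjugation. For $\ell=L,L-1,\dots,0$ and each node $\tau$ of depth $\ell$: - If $\ell=L$: $Z_\tau:=U_\tau$ (omitted when $L=0$) and $\tilde D_\tau:=D_\tau$. - If $\ell<L$ and $\tau$ has children $\alpha,\beta$: put $S_\tau:=\mathrm{blkdiag}(W_\alpha^TZ_\alpha,W_\beta^TZ_\beta)$, $Z_\tau:=S_\tau U_\tau$ (only needed for $\ell\ge1$), and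 $\tilde D_\tau:=\mathrm{blkdiag}(W_\alpha^T\tilde D_\alpha W_\alpha,\,W_\beta^T\tilde D_\beta W_\beta)+S_\tau D_\tau S_\tau^T$. - If $\ell=0$: $C_\tau:=f(\tilde D_\tau)$. If $\ell\ge1$: let $W_\tau$ be an orthonormal basis of $\mathcal{Q}(\tilde D_\tau,Z_\tau,\boldsymbol{\xi}_k)$ and $C_\tau:=f(\tilde D_\tau)-W_\tau f(W_\tau^T\tilde D_\tau W_\tau)W_\tau^T$. It is assumed that no pole is an eigenvalue of any matrix $\tilde D_\tau$ ($\mathrm{depth}(\tau)\ge1$) arising in the algorithm, so that the Krylov subspaces are defined. The output is $\{W_\tau,C_\tau\}_{\tau\in\mathcal{T}}$, which represents the matrix $F:=F^{(L)}$, where $F^{(0)}:=C_\gamma$ and $F^{(\ell)}:=\boldsymbol{C}^{(\ell)}+\boldsymbol{W}^{(\ell)}F^{(\ell-1)}(\boldsymbol{W}^{(\ell)})^T$ for $\ell=1,\dots,L$. *)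

theory Defs
  imports
    "HOL-Analysis.Complex_Analysis_Basics"
    "HOL-Library.Extended_Nonnegative_Real"
    "Jordan_Normal_Form.Gauss_Jordan_Elimination"
    "Jordan_Normal_Form.DL_Submatrix"
    "Jordan_Normal_Form.Char_Poly"
    "Jordan_Normal_Form.VS_Connect"
begin

section \<open>Matrix functions, rational functions and norms\<close>

definition orthonormal_cols :: "real mat \<Rightarrow> bool" where
  "orthonormal_cols M \<longleftrightarrow> transpose_mat M * M = 1\<^sub>m (dim_col M)"

text \<open>Meaningful for symmetric \<open>M\<close>; the matrix does not depend on the diagonalization.\<close>

definition mat_fun :: "(real \<Rightarrow> real) \<Rightarrow> real mat \<Rightarrow> real mat" where
  "mat_fun f M = (THE X. \<exists>V ds. V \<in> carrier_mat (dim_row M) (dim_row M) \<and> orthonormal_cols V \<and>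
     length ds = dim_row M \<and>
     M = V * mk_diagonal ds * transpose_mat V \<and>
     X = V * mk_diagonal (map f ds) * transpose_mat V)"

definition spectral_norm :: "real mat \<Rightarrow> real" where
  "spectral_norm M =
     (SUP x \<in> {x \<in> carrier_vec (dim_col M). scalar_prod x x \<le> 1}.
        sqrt (scalar_prod (M *\<^sub>v x) (M *\<^sub>v x)))"

definition sup_norm_on :: "real set \<Rightarrow> (real \<Rightarrow> real) \<Rightarrow> ennreal" where
  "sup_norm_on S g = (SUP x \<in> S. ennreal \<bar>g x\<bar>)"

definition analytic_on_interval :: "(real \<Rightarrow> real) \<Rightarrow> real \<Rightarrow> real \<Rightarrow> bool" where
  "analytic_on_interval f a b \<longleftrightarrow>
     (\<exists>g. g analytic_on (complex_of_real ` {a..b}) \<and>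
          (\<forall>x\<in>{a..b}. g (complex_of_real x) = complex_of_real (f x)))"

text \<open>A pole list has entries in \<open>\<complex> \<union> {\<infinity>}\<close>; \<open>None\<close> stands for \<open>\<infinity>\<close>, and \<open>k\<close> is the length of
  the list. Closedness under conjugation respects multiplicities.\<close>

definition conj_closed :: "complex option list \<Rightarrow> bool" where
  "conj_closed \<xi>s \<longleftrightarrow> mset (map (map_option cnj) \<xi>s) = mset \<xi>s"

text \<open>The polynomial \<open>q\<^sub>k\<close>. For lists closed under conjugation the complex product has real
  coefficients, so that \<open>Re\<close> only changes the type.\<close>

definition pole_poly :: "complex option list \<Rightarrow> real poly" where
  "pole_poly \<xi>s =
     map_poly Re (\<Prod>\<xi>\<leftarrow>\<xi>s. case \<xi> of None \<Rightarrow> 1 | Some z \<Rightarrow> [:- z, 1:])"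

text \<open>Real polynomials of degree at most \<open>k - 1\<close> over \<open>q\<^sub>k\<close>; only \<open>0\<close> if \<open>k = 0\<close>.\<close>

definition rational_space :: "complex option list \<Rightarrow> (real \<Rightarrow> real) set" where
  "rational_space \<xi>s =
     {\<lambda>x. poly p x / poly (pole_poly \<xi>s) x | p. p = 0 \<or> degree p < length \<xi>s}"

text \<open>The points of \<open>[a,b]\<close> at which the quotients in \<^const>\<open>rational_space\<close> are defined. The supremum
  over them is infinite if a pole in \<open>[a,b]\<close> is not cancelled by the numerator, and if \<open>a < b\<close> it is
  the supremum norm of the continuous extension if all poles in \<open>[a,b]\<close> are cancelled.\<close>

definition interval_off_poles :: "complex option list \<Rightarrow> real \<Rightarrow> real \<Rightarrow> real set" where
  "interval_off_poles \<xi>s a b = {x \<in> {a..b}. poly (pole_poly \<xi>s) x \<noteq> 0}"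

section \<open>Rational Krylov subspaces\<close>

definition mat_sum :: "nat \<Rightarrow> nat \<Rightarrow> (nat \<Rightarrow> real mat) \<Rightarrow> nat set \<Rightarrow> real mat" where
  "mat_sum nr nc X J = Matrix.mat nr nc (\<lambda>(a, b). \<Sum>j\<in>J. X j $$ (a, b))"

definition poly_at_mat :: "real poly \<Rightarrow> real mat \<Rightarrow> real mat" where
  "poly_at_mat p M =
     mat_sum (dim_row M) (dim_row M) (\<lambda>i. coeff p i \<cdot>\<^sub>m (M ^\<^sub>m i)) {..degree p}"

definition no_pole_eigenvalue :: "complex option list \<Rightarrow> real mat \<Rightarrow> bool" where
  "no_pole_eigenvalue \<xi>s M \<longleftrightarrow>
     (\<forall>z. Some z \<in> set \<xi>s \<longrightarrow> \<not> eigenvalue (map_mat complex_of_real M) z)"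

definition rational_krylov :: "real mat \<Rightarrow> real mat \<Rightarrow> complex option list \<Rightarrow> real mat set" where
  "rational_krylov M B \<xi>s =
     {the (mat_inverse (poly_at_mat (pole_poly \<xi>s) M)) *
        mat_sum (dim_row B) (dim_col B) (\<lambda>j. (M ^\<^sub>m j) * B * G j) {..<length \<xi>s} | G.
      \<forall>j<length \<xi>s. G j \<in> carrier_mat (dim_col B) (dim_col B)}"

text \<open>Orthonormal columns are linearly independent, so the columns of \<open>W\<close> form a basis of the span
  as soon as they generate it.\<close>

definition krylov_basis :: "real mat \<Rightarrow> real mat \<Rightarrow> complex option list \<Rightarrow> real mat \<Rightarrow> bool" where
  "krylov_basis M B \<xi>s W \<longleftrightarrow>
     dim_row W = dim_row M \<and> orthonormal_cols W \<and>
     LinearCombinations.module.span class_ring (module_vec TYPE(real) (dim_row M)) (set (cols W)) =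
     LinearCombinations.module.span class_ring (module_vec TYPE(real) (dim_row M))
       (\<Union>X \<in> rational_krylov M B \<xi>s. set (cols X))"

section \<open>Cluster trees and HSS matrices\<close>

text \<open>The node \<open>(l, i)\<close>, \<open>i < 2 ^ l\<close>, is the \<open>i\<close>-th node from the left at depth \<open>l\<close>;
  the root is \<open>(0, 0)\<close>.\<close>

type_synonym node = "nat \<times> nat"

definition lchild :: "node \<Rightarrow> node" where
  "lchild \<tau> = (Suc (fst \<tau>), 2 * snd \<tau>)"

definition rchild :: "node \<Rightarrow> node" where
  "rchild \<tau> = (Suc (fst \<tau>), 2 * snd \<tau> + 1)"

definition nodes_at :: "nat \<Rightarrow> node set" where
  "nodes_at l = {(l, i) | i. i < 2 ^ l}"

definition siblings :: "nat \<Rightarrow> node \<Rightarrow> node \<Rightarrow> bool" where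
  "siblings L \<tau> \<tau>' \<longleftrightarrow> (\<exists>l<L. \<exists>\<sigma>\<in>nodes_at l.
     (\<tau> = lchild \<sigma> \<and> \<tau>' = rchild \<sigma>) \<or> (\<tau> = rchild \<sigma> \<and> \<tau>' = lchild \<sigma>))"

text \<open>\<open>T \<tau>\<close> is the index vector of \<open>\<tau>\<close>, with indices counted from \<open>0\<close>. All index vectors consist of
  consecutive indices because the one of the root does.\<close>

definition cluster_tree :: "nat \<Rightarrow> nat \<Rightarrow> (node \<Rightarrow> nat list) \<Rightarrow> bool" where
  "cluster_tree n L T \<longleftrightarrow> T (0, 0) = [0..<n] \<and>
     (\<forall>l<L. \<forall>\<tau>\<in>nodes_at l. T \<tau> = T (lchild \<tau>) @ T (rchild \<tau>))"

definition balanced_tree :: "nat \<Rightarrow> nat \<Rightarrow> node \<Rightarrow> nat list" where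
  "balanced_tree m l \<tau> =
     [snd \<tau> * 2 ^ (l - fst \<tau>) * m ..< (snd \<tau> + 1) * 2 ^ (l - fst \<tau>) * m]"

abbreviation blkdiag :: "real mat \<Rightarrow> real mat \<Rightarrow> real mat" where
  "blkdiag X Y \<equiv> diag_block_mat [X, Y]"

definition level_mat :: "(node \<Rightarrow> real mat) \<Rightarrow> nat \<Rightarrow> real mat" where
  "level_mat X l = diag_block_mat (map (\<lambda>i. X (l, i)) [0..<2 ^ l])"

definition hss_matrix :: "nat \<Rightarrow> nat \<Rightarrow> (node \<Rightarrow> nat list) \<Rightarrow> nat \<Rightarrow> real mat \<Rightarrow> bool" where
  "hss_matrix n L T r A \<longleftrightarrow> A \<in> carrier_mat n n \<and>
     (\<exists>Ubig Vbig U V :: node \<Rightarrow> real mat. \<exists>At :: node \<Rightarrow> node \<Rightarrow> real mat.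
        (\<forall>l\<in>{1..L}. \<forall>\<tau>\<in>nodes_at l.
           Ubig \<tau> \<in> carrier_mat (length (T \<tau>)) r \<and> orthonormal_cols (Ubig \<tau>) \<and>
           Vbig \<tau> \<in> carrier_mat (length (T \<tau>)) r \<and> orthonormal_cols (Vbig \<tau>)) \<and>
        (\<forall>\<tau> \<tau>'. siblings L \<tau> \<tau>' \<longrightarrow>
           At \<tau> \<tau>' \<in> carrier_mat r r \<and>
           submatrix A (set (T \<tau>)) (set (T \<tau>')) =
             Ubig \<tau> * At \<tau> \<tau>' * transpose_mat (Vbig \<tau>')) \<and>
        (\<forall>l\<in>{1..<L}. \<forall>\<tau>\<in>nodes_at l.
           U \<tau> \<in> carrier_mat (2 * r) r \<and> orthonormal_cols (U \<tau>) \<and>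
           V \<tau> \<in> carrier_mat (2 * r) r \<and> orthonormal_cols (V \<tau>) \<and>
           Ubig \<tau> = blkdiag (Ubig (lchild \<tau>)) (Ubig (rchild \<tau>)) * U \<tau> \<and>
           Vbig \<tau> = blkdiag (Vbig (lchild \<tau>)) (Vbig (rchild \<tau>)) * V \<tau>))"

section \<open>Telescopic decompositions\<close>

primrec telescopic :: "(node \<Rightarrow> real mat) \<Rightarrow> (node \<Rightarrow> real mat) \<Rightarrow> nat \<Rightarrow> real mat" where
  "telescopic D U 0 = D (0, 0)"
| "telescopic D U (Suc l) =
     level_mat D (Suc l) +
     level_mat U (Suc l) * telescopic D U l * transpose_mat (level_mat U (Suc l))"

definition sym_telescopic_decomp ::
    "nat \<Rightarrow> (node \<Rightarrow> nat list) \<Rightarrow> nat \<Rightarrow> real mat \<Rightarrow>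
     (node \<Rightarrow> real mat) \<Rightarrow> (node \<Rightarrow> real mat) \<Rightarrow> bool" where
  "sym_telescopic_decomp L T r A U D \<longleftrightarrow>
     (\<forall>l\<le>L. \<forall>\<tau>\<in>nodes_at l. let s = (if l = L then length (T \<tau>) else 2 * r) in
        D \<tau> \<in> carrier_mat s s \<and> transpose_mat (D \<tau>) = D \<tau> \<and>
        (1 \<le> l \<longrightarrow> U \<tau> \<in> carrier_mat s r \<and> orthonormal_cols (U \<tau>))) \<and>
     A = telescopic D U L"

definition standard_decomp ::
    "nat \<Rightarrow> (node \<Rightarrow> nat list) \<Rightarrow> nat \<Rightarrow> (node \<Rightarrow> real mat) \<Rightarrow> (node \<Rightarrow> real mat) \<Rightarrow> bool" where
  "standard_decomp L T r U D \<longleftrightarrow>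
     (\<forall>l\<in>{1..L}. \<forall>\<tau>\<in>nodes_at l.
        let J = set (if l < L then balanced_tree (2 * r) l \<tau> else T \<tau>) in
        submatrix (telescopic D U l) J J = D \<tau>)"

section \<open>The algorithm\<close>

definition S_mat :: "(node \<Rightarrow> real mat) \<Rightarrow> (node \<Rightarrow> real mat) \<Rightarrow> node \<Rightarrow> real mat" where
  "S_mat W Z \<tau> =
     blkdiag (transpose_mat (W (lchild \<tau>)) * Z (lchild \<tau>))
             (transpose_mat (W (rchild \<tau>)) * Z (rchild \<tau>))"

text \<open>The orthonormal bases \<open>W\<close> are not determined by the input, so a run of the algorithm is a
  relation between the input \<open>f, \<xi>s, U, D\<close>, the auxiliary matrices \<open>Z\<close> and \<open>Dt\<close> (the
  \<open>\<tau>\<close>-indexed matrices written with a tilde over \<open>D\<close>) and the output \<open>W, C\<close>.\<close>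

definition alg_run ::
    "nat \<Rightarrow> (real \<Rightarrow> real) \<Rightarrow> complex option list \<Rightarrow>
     (node \<Rightarrow> real mat) \<Rightarrow> (node \<Rightarrow> real mat) \<Rightarrow>
     (node \<Rightarrow> real mat) \<Rightarrow> (node \<Rightarrow> real mat) \<Rightarrow>
     (node \<Rightarrow> real mat) \<Rightarrow> (node \<Rightarrow> real mat) \<Rightarrow> bool" where
  "alg_run L f \<xi>s U D Z Dt W C \<longleftrightarrow>
     (\<forall>\<tau>\<in>nodes_at L. (1 \<le> L \<longrightarrow> Z \<tau> = U \<tau>) \<and> Dt \<tau> = D \<tau>) \<and>
     (\<forall>l<L. \<forall>\<tau>\<in>nodes_at l.
        (1 \<le> l \<longrightarrow> Z \<tau> = S_mat W Z \<tau> * U \<tau>) \<and>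
        Dt \<tau> =
          blkdiag (transpose_mat (W (lchild \<tau>)) * Dt (lchild \<tau>) * W (lchild \<tau>))
                  (transpose_mat (W (rchild \<tau>)) * Dt (rchild \<tau>) * W (rchild \<tau>)) +
          S_mat W Z \<tau> * D \<tau> * transpose_mat (S_mat W Z \<tau>)) \<and>
     C (0, 0) = mat_fun f (Dt (0, 0)) \<and>
     (\<forall>l\<in>{1..L}. \<forall>\<tau>\<in>nodes_at l.
        krylov_basis (Dt \<tau>) (Z \<tau>) \<xi>s (W \<tau>) \<and>
        C \<tau> = mat_fun f (Dt \<tau>) -
          W \<tau> * mat_fun f (transpose_mat (W \<tau>) * Dt \<tau> * W \<tau>) * transpose_mat (W \<tau>))"

end

theory Submission
  imports Defs "Jordan_Normal_Form.Spectral_Radius" "HOL-Complex_Analysis.Great_Picard"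
begin

text \<open>
  Let \<open>W\<^sub>l\<close>, \<open>Z\<^sub>l\<close>, \<open>D\<^sub>l\<close> be the block diagonal matrices of the \<open>W\<close>, \<open>Z\<close> and \<open>Dt\<close> of depth \<open>l\<close>, and
  let \<open>X\<^sub>l\<close> be the telescopic decomposition of \<open>A\<close> cut off at level \<open>l\<close>. The algorithm repeatedly
  compresses the whole matrix: with \<open>A\<^sub>L = A\<close> and \<open>A\<^sub>l\<^sub>-\<^sub>1 = W\<^sub>l\<^sup>T A\<^sub>l W\<^sub>l\<close> one has
  \<open>A\<^sub>l = D\<^sub>l + Z\<^sub>l X\<^sub>l\<^sub>-\<^sub>1 Z\<^sub>l\<^sup>T\<close> (\<open>AL_compress\<close>). The output replaces \<open>f(A\<^sub>l)\<close> by
  \<open>f(D\<^sub>l) - W\<^sub>l f(W\<^sub>l\<^sup>T D\<^sub>l W\<^sub>l) W\<^sub>l\<^sup>T + W\<^sub>l F\<^sub>l\<^sub>-\<^sub>1 W\<^sub>l\<^sup>T\<close>, where \<open>F\<^sub>l\<^sub>-\<^sub>1\<close> stands for \<open>f(A\<^sub>l\<^sub>-\<^sub>1)\<close>. Since the \<open>W\<^sub>l\<close> have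
  orthonormal columns, errors of coarser levels are passed on without growth, and the total error is at
  most the sum of the \<open>L\<close> level errors (\<open>output_error\<close>)
    \<open>f(A\<^sub>l) - f(D\<^sub>l) + W\<^sub>l f(W\<^sub>l\<^sup>T D\<^sub>l W\<^sub>l) W\<^sub>l\<^sup>T - W\<^sub>l f(W\<^sub>l\<^sup>T A\<^sub>l W\<^sub>l) W\<^sub>l\<^sup>T\<close>.

  A level error is linear in \<open>f\<close> and vanishes for \<open>\<rho>\<close> in \<open>\<P>\<^sub>k/q\<^sub>k\<close> without poles on the
  interval (\<open>rational_update_exact\<close>), so \<open>f\<close> may be replaced by \<open>f - \<rho>\<close>. All four matrices have their
  spectra in \<open>[lmin, lmax]\<close>: the compressions of \<open>A\<close> by the minimax principle, and \<open>D\<^sub>l\<close> because its blocks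
  are diagonal blocks of \<open>A\<^sub>l\<close> (\<open>Dt_diag_block\<close>); this is where the decomposition has to be standard. Each of the four terms
  therefore has norm at most \<open>sup |f - \<rho>|\<close>, which gives the constant \<open>4 L\<close> (\<open>level_error\<close>).

  The exactness for rational functions is proved without partial fractions, which would have to
  distinguish multiple, complex and infinite poles. With \<open>M\<^sub>u = (u/q)(M)\<close> the identity
  \<open>\<rho>(A) - \<rho>(D) = D\<^sub>q A\<^sub>p - D\<^sub>p A\<^sub>q\<close> for \<open>\<rho> = p/q\<close> expresses the update by an antisymmetrized bilinear
  form. On monomials, moving one factor \<open>x\<close> from the right to the left argument produces a term
  \<open>D\<^sub>u Z X Z\<^sup>T A\<^sub>v\<close> with \<open>u\<close>, \<open>v\<close> of degree less than \<open>k\<close>, and such terms can be computed in the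
  compression because the Krylov space contains the columns of \<open>D\<^sub>u Z\<close> and \<open>A\<^sub>v Z\<close>.

  Poles may lie in \<open>[lmin, lmax]\<close>, even at eigenvalues of \<open>A\<close>. A minimizer has finite error, since \<open>f\<close> is
  bounded and \<open>0\<close> is a competitor; hence all factors of \<open>q\<^sub>k\<close> with zeros in the interval are cancelled
  by its numerator (\<open>finite_error_cancels_poles\<close>), and the argument applies to the reduced fraction. That the minimum
  is attained follows by compactness in a space of finite dimension (\<open>best_rational_exists\<close>).
\<close>

section \<open>Matrix algebra with dimension side conditions\<close>

text \<open>The algebraic laws of matrices hold under conditions on dimensions. Stated with \<^const>\<open>dim_row\<close> and
  \<^const>\<open>dim_col\<close> instead of a common carrier these conditions have no variables that are absent from the
  left-hand side, so that the laws can be used as conditional rewrite rules.\<close>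

lemma mult_assoc_dim:
  fixes A B C :: "'a::semiring_0 mat"
  assumes "dim_col A = dim_row B" "dim_col B = dim_row C"
  shows "(A * B) * C = A * (B * C)"
  by (rule assoc_mult_mat[of A "dim_row A" "dim_row B" B "dim_row C" C "dim_col C"]) (use assms in auto)

lemma add_mult_dim:
  fixes A B C :: "'a::semiring_0 mat"
  assumes "dim_row A = dim_row B" "dim_col A = dim_col B" "dim_col B = dim_row C"
  shows "(A + B) * C = A * C + B * C"
  by (rule add_mult_distrib_mat[of A "dim_row A" "dim_row C" _ _ "dim_col C"]) (use assms in auto)

lemma mult_add_dim:
  fixes A B C :: "'a::semiring_0 mat"
  assumes "dim_row B = dim_row C" "dim_col B = dim_col C" "dim_col A = dim_row C"
  shows "A * (B + C) = A * B + A * C"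
  by (rule mult_add_distrib_mat[of A "dim_row A" "dim_row C" _ "dim_col C"]) (use assms in auto)

lemma minus_mult_dim:
  fixes A B C :: "'a::ring mat"
  assumes "dim_row A = dim_row B" "dim_col A = dim_col B" "dim_col B = dim_row C"
  shows "(A - B) * C = A * C - B * C"
  by (rule minus_mult_distrib_mat[of A "dim_row A" "dim_row C" _ _ "dim_col C"]) (use assms in auto)

lemma mult_minus_dim:
  fixes A B C :: "'a::ring mat"
  assumes "dim_row B = dim_row C" "dim_col B = dim_col C" "dim_col A = dim_row C"
  shows "A * (B - C) = A * B - A * C"
  by (rule mult_minus_distrib_mat[of A "dim_row A" "dim_row C" _ "dim_col C"]) (use assms in auto)

lemma transpose_mult_dim:
  fixes A B :: "'a::comm_semiring_0 mat"
  assumes "dim_col A = dim_row B"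
  shows "transpose_mat (A * B) = transpose_mat B * transpose_mat A"
  by (rule transpose_mult[of A "dim_row A" "dim_row B" B "dim_col B"]) (use assms in auto)

lemma transpose_add_dim:
  fixes A B :: "'a::monoid_add mat"
  assumes "dim_row A = dim_row B" "dim_col A = dim_col B"
  shows "transpose_mat (A + B) = transpose_mat A + transpose_mat B"
  by (rule transpose_add[of A "dim_row A" "dim_col A"]) (use assms in auto)

lemma mult_one_dim [simp]:
  fixes A :: "'a::semiring_1 mat"
  shows "dim_col A = n \<Longrightarrow> A * 1\<^sub>m n = A" "dim_row A = n \<Longrightarrow> 1\<^sub>m n * A = A"
  by auto

lemmas mat_dim_simps =
  mult_assoc_dim add_mult_dim mult_add_dim minus_mult_dim mult_minus_dim
  transpose_mult_dim transpose_add_dim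

lemma mult_index:
  fixes A B :: "'a::semiring_0 mat"
  assumes "i < dim_row A" "j < dim_col B" "dim_col A = dim_row B"
  shows "(A * B) $$ (i, j) = (\<Sum>k<dim_row B. A $$ (i, k) * B $$ (k, j))"
  using assms by (simp add: scalar_prod_def atLeast0LessThan)

lemma dim_mat_diag [simp]: "dim_row (mat_diag n f) = n" "dim_col (mat_diag n f) = n"
  by (auto simp: mat_diag_def)

lemma scalar_prod_self_nonneg: "(v :: real vec) \<bullet> v \<ge> 0"
  unfolding scalar_prod_def by (intro sum_nonneg) auto

lemma scalar_prod_self_eq_0:
  fixes v :: "real vec"
  assumes "v \<in> carrier_vec n" "v \<bullet> v = 0"
  shows "v = 0\<^sub>v n"
proof -
  have "\<And>i. i < n \<Longrightarrow> v $ i = 0"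
    using assms unfolding scalar_prod_def by (subst (asm) sum_nonneg_eq_0_iff) auto
  then show ?thesis using assms(1) by auto
qed

section \<open>The spectral theorem\<close>

text \<open>The eigenvalues are indexed by a function, of which only the values below \<open>n\<close> matter: this form is
  closed under applying a scalar function and under direct sums.\<close>

definition eigendecomp :: "nat \<Rightarrow> real mat \<Rightarrow> real mat \<Rightarrow> (nat \<Rightarrow> real) \<Rightarrow> bool" where
  "eigendecomp n M V d \<longleftrightarrow> V \<in> carrier_mat n n \<and> transpose_mat V * V = 1\<^sub>m n \<and>
     V * transpose_mat V = 1\<^sub>m n \<and> M = V * mat_diag n d * transpose_mat V"

text \<open>A complex eigenvalue exists, and it is the quotient of the two real numbers \<open>w\<^sup>* M w\<close> and
  \<open>w\<^sup>* w\<close> for an eigenvector \<open>w\<close>. Being a real root of the characteristic polynomial, it also has a real eigenvector.\<close>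

lemma real_eigenvalue_of_symmetric:
  fixes M :: "real mat"
  assumes M: "M \<in> carrier_mat n n" and sym: "transpose_mat M = M" and n: "n > 0"
  shows "\<exists>x. eigenvalue M x"
proof -
  define Mc where "Mc = map_mat complex_of_real M"
  have Mc: "Mc \<in> carrier_mat n n" using M by (simp add: Mc_def)
  obtain z where z: "eigenvalue Mc z"
    using spectrum_non_empty[OF Mc n] by (auto simp: spectrum_def)
  then obtain w where w: "w \<in> carrier_vec n" "w \<noteq> 0\<^sub>v n" and ev: "Mc *\<^sub>v w = z \<cdot>\<^sub>v w"
    using Mc by (auto simp: eigenvalue_def eigenvector_def)
  have msym: "M $$ (i, j) = M $$ (j, i)" if "i < n" "j < n" for i j
    using sym that M by (metis carrier_matD index_transpose_mat(1))
  define s where "s = (\<Sum>i<n. (cmod (w $ i))\<^sup>2)"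
  have row: "(\<Sum>j<n. of_real (M $$ (i, j)) * w $ j) = z * w $ i" if i: "i < n" for i
  proof -
    have "(Mc *\<^sub>v w) $ i = (\<Sum>j<n. of_real (M $$ (i, j)) * w $ j)"
      using i w M by (simp add: Mc_def scalar_prod_def atLeast0LessThan)
    then show ?thesis using ev i w by simp
  qed
  define t where "t = (\<Sum>i<n. \<Sum>j<n. cnj (w $ i) * of_real (M $$ (i, j)) * w $ j)"
  have "t = (\<Sum>i<n. cnj (w $ i) * (z * w $ i))"
    unfolding t_def by (intro sum.cong refl) (simp add: row[symmetric] sum_distrib_left mult.assoc)
  also have "\<dots> = z * of_real s"
    unfolding s_def of_real_sum sum_distrib_left
    by (intro sum.cong refl) (simp add: complex_norm_square[unfolded of_real_power] algebra_simps)
  finally have t: "t = z * of_real s" .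
  have "cnj t = (\<Sum>i<n. \<Sum>j<n. w $ i * of_real (M $$ (i, j)) * cnj (w $ j))"
    by (simp add: t_def)
  also have "\<dots> = (\<Sum>j<n. \<Sum>i<n. w $ i * of_real (M $$ (i, j)) * cnj (w $ j))"
    by (rule sum.swap)
  also have "\<dots> = t"
    unfolding t_def by (intro sum.cong refl) (simp add: msym algebra_simps)
  finally have "cnj t = t" .
  then have "cnj z * of_real s = z * of_real s" using t by simp
  moreover have "s \<noteq> 0"
  proof
    assume "s = 0"
    then have "\<And>i. i < n \<Longrightarrow> w $ i = 0"
      by (auto simp: s_def sum_nonneg_eq_0_iff)
    then have "w = 0\<^sub>v n" using w by auto
    then show False using w by simp
  qed
  ultimately have "cnj z = z" by simp
  then obtain x where x: "z = of_real x" by (metis Reals_cnj_iff Reals_cases)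
  have "poly (char_poly Mc) z = 0" using eigenvalue_root_char_poly[OF Mc] z by simp
  moreover have "char_poly Mc = map_poly of_real (char_poly M)"
    unfolding Mc_def by (rule of_real_hom.char_poly_hom[OF M])
  ultimately have "poly (char_poly M) x = 0" by (simp add: x)
  then show ?thesis using eigenvalue_root_char_poly[OF M] by blast
qed

text \<open>The reflection that exchanges \<open>v\<close> with the first unit vector \<open>e\<close>, along \<open>u = v - e\<close>. It supplies an
  orthonormal basis that starts with \<open>v\<close> without any orthogonalization process.\<close>

lemma householder:
  fixes v :: "real vec"
  assumes v: "v \<in> carrier_vec (Suc m)" and unit: "v \<bullet> v = 1"
  obtains H where "H \<in> carrier_mat (Suc m) (Suc m)" "transpose_mat H = H"
    "H * H = 1\<^sub>m (Suc m)" "col H 0 = v"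
proof (cases "v = unit_vec (Suc m) 0")
  case True
  then show ?thesis by (intro that[of "1\<^sub>m (Suc m)"]) auto
next
  case False
  let ?n = "Suc m"
  define e :: "nat \<Rightarrow> nat \<Rightarrow> real" where "e = (\<lambda>i j. if i = j then 1 else 0)"
  define u where "u = (\<lambda>i. v $ i - e i 0)"
  define s where "s = (\<Sum>i<?n. u i * u i)"
  have vv: "(\<Sum>i<?n. v $ i * v $ i) = 1"
    using unit v by (simp add: scalar_prod_def atLeast0LessThan)
  have "s = (\<Sum>i<?n. v $ i * v $ i) - 2 * (\<Sum>i<?n. v $ i * e i 0) + (\<Sum>i<?n. e i 0 * e i 0)"
    by (simp add: s_def u_def algebra_simps sum.distrib sum_subtractf sum_distrib_left del: sum.lessThan_Suc)
  also have "\<dots> = 1 - 2 * v $ 0 + 1"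
    unfolding vv by (simp add: e_def if_distrib[of "\<lambda>x. _ * x"] sum.delta cong: if_cong del: sum.lessThan_Suc)
  \<comment> \<open>This value of \<open>u \<bullet> u\<close> makes the first column of the reflection equal to \<open>v\<close>.\<close>
  finally have s: "s = - 2 * u 0" by (simp add: u_def e_def)
  have "s \<noteq> 0"
  proof
    assume "s = 0"
    then have "\<And>i. i < ?n \<Longrightarrow> u i = 0"
      unfolding s_def by (subst (asm) sum_nonneg_eq_0_iff) auto
    then have "v = unit_vec ?n 0" using v by (intro eq_vecI) (auto simp: u_def e_def split: if_splits)
    then show False using False by simp
  qed
  define H where "H = Matrix.mat ?n ?n (\<lambda>(i, j). e i j - 2 / s * (u i * u j))"
  have HH: "H * H = 1\<^sub>m ?n"
  proof (rule eq_matI)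
    fix i j assume "i < dim_row (1\<^sub>m ?n :: real mat)" "j < dim_col (1\<^sub>m ?n :: real mat)"
    then have ij: "i < ?n" "j < ?n" by auto
    have "(H * H) $$ (i, j) = (\<Sum>k<?n. (e i k - 2 / s * (u i * u k)) * (e k j - 2 / s * (u k * u j)))"
      using ij by (subst mult_index) (auto simp: H_def)
    also have "\<dots> = (\<Sum>k<?n. e i k * e k j) - 2 / s * u j * (\<Sum>k<?n. e i k * u k)
        - 2 / s * u i * (\<Sum>k<?n. u k * e k j) + (2 / s)\<^sup>2 * u i * u j * s"
      unfolding s_def sum_distrib_left sum.distrib[symmetric] sum_subtractf[symmetric]
      by (intro sum.cong refl) (simp add: algebra_simps power2_eq_square)
    also have "(\<Sum>k<?n. e i k * e k j) = e i j"
      using ij by (simp add: e_def if_distrib[of "\<lambda>x. _ * x"] sum.delta cong: if_cong del: sum.lessThan_Suc)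
    also have "(\<Sum>k<?n. e i k * u k) = u i"
      using ij by (simp add: e_def if_distrib[of "\<lambda>x. x * _"] sum.delta cong: if_cong del: sum.lessThan_Suc)
    also have "(\<Sum>k<?n. u k * e k j) = u j"
      using ij by (simp add: e_def if_distrib[of "\<lambda>x. _ * x"] sum.delta cong: if_cong del: sum.lessThan_Suc)
    also have "e i j - 2 / s * u j * u i - 2 / s * u i * u j + (2 / s)\<^sup>2 * u i * u j * s = e i j"
      using \<open>s \<noteq> 0\<close> by (simp add: field_simps power2_eq_square)
    finally show "(H * H) $$ (i, j) = 1\<^sub>m ?n $$ (i, j)" using ij by (simp add: e_def)
  qed (auto simp: H_def)
  have colH: "col H 0 = v"
  proof (rule eq_vecI)
    fix i assume "i < dim_vec v"
    then have i: "i < ?n" using v by simp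
    have "2 / s * (u i * u 0) = - u i" using \<open>s \<noteq> 0\<close> s by (simp add: field_simps)
    then show "col H 0 $ i = v $ i" using i by (simp add: H_def u_def)
  qed (use v in \<open>auto simp: H_def\<close>)
  show ?thesis
    by (rule that[of H]) (use HH colH in \<open>auto simp: H_def e_def algebra_simps\<close>)
qed

text \<open>Deflation: in a basis that starts with a unit eigenvector the first column, hence by symmetry also the
  first row, vanishes off the diagonal, and the remaining block is a smaller symmetric matrix.\<close>

theorem spectral_theorem:
  fixes M :: "real mat"
  assumes "M \<in> carrier_mat n n" and "transpose_mat M = M"
  shows "\<exists>V d. eigendecomp n M V d"
  using assms
proof (induction n arbitrary: M)
  case 0
  show ?case
    by (rule exI[of _ "1\<^sub>m 0"], rule exI[of _ "\<lambda>_. 0"])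
       (use 0 in \<open>auto simp: eigendecomp_def mat_diag_def intro!: eq_matI\<close>)
next
  case (Suc m)
  let ?n = "Suc m"
  note M = Suc.prems(1) and sym = Suc.prems(2)
  note [simp] = carrier_matD[OF M]
  obtain l where "eigenvalue M l" using real_eigenvalue_of_symmetric[OF M sym] by auto
  then obtain w where w: "w \<in> carrier_vec ?n" "w \<noteq> 0\<^sub>v ?n" and ev: "M *\<^sub>v w = l \<cdot>\<^sub>v w"
    using M by (auto simp: eigenvalue_def eigenvector_def)
  have wpos: "w \<bullet> w > 0"
  proof -
    have "w \<bullet> w \<noteq> 0" using scalar_prod_self_eq_0[OF w(1)] w(2) by blast
    then show ?thesis using scalar_prod_self_nonneg[of w] by simp
  qed
  define v where "v = (1 / sqrt (w \<bullet> w)) \<cdot>\<^sub>v w"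
  have v: "v \<in> carrier_vec ?n" using w by (simp add: v_def)
  have unit: "v \<bullet> v = 1" using wpos w by (simp add: v_def real_div_sqrt field_simps)
  have Mv: "M *\<^sub>v v = l \<cdot>\<^sub>v v"
    using w M ev by (simp add: v_def mult_mat_vec[OF M] smult_smult_assoc mult.commute)
  obtain H where H: "H \<in> carrier_mat ?n ?n" "transpose_mat H = H" "H * H = 1\<^sub>m ?n" "col H 0 = v"
    by (rule householder[OF v unit])
  note [simp] = carrier_matD[OF H(1)]
  have HHX: "H * (H * X) = X" if "dim_row X = ?n" for X
    using that by (simp add: mult_assoc_dim[symmetric] H(3))
  define N where "N = H * M * H"
  have N: "N \<in> carrier_mat ?n ?n" using H M by (auto simp: N_def)
  note [simp] = carrier_matD[OF N]
  have Nsym: "transpose_mat N = N"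
    by (simp add: N_def mat_dim_simps H(2) sym)
  have Nswap: "N $$ (i, j) = N $$ (j, i)" if "i < ?n" "j < ?n" for i j
    using Nsym that N by (metis carrier_matD index_transpose_mat(1))
  have "col N 0 = H *\<^sub>v (M *\<^sub>v col H 0)"
    unfolding N_def using H(1) M by (simp add: mult_assoc_dim col_mult2[of H ?n ?n _ ?n] col_mult2[of M ?n ?n _ ?n])
  also have "\<dots> = l \<cdot>\<^sub>v (H *\<^sub>v col H 0)"
    using H v by (simp add: Mv mult_mat_vec[OF H(1)])
  also have "H *\<^sub>v col H 0 = col (H * H) 0"
    using col_mult2[OF H(1) H(1), of 0] by simp
  also have "\<dots> = unit_vec ?n 0" unfolding H(3) by simp
  finally have colN: "col N 0 = l \<cdot>\<^sub>v unit_vec ?n 0" .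
  have N0: "N $$ (i, 0) = (if i = 0 then l else 0)" if "i < ?n" for i
    using arg_cong[OF colN, of "\<lambda>x. x $ i"] that by (simp split: if_splits)
  define N' where "N' = Matrix.mat m m (\<lambda>(i, j). N $$ (Suc i, Suc j))"
  have "N' \<in> carrier_mat m m" "transpose_mat N' = N'" by (auto simp: N'_def Nswap)
  from Suc.IH[OF this] obtain V' d' where V': "eigendecomp m N' V' d'" by blast
  then have V'c: "V' \<in> carrier_mat m m" and V'o: "transpose_mat V' * V' = 1\<^sub>m m" "V' * transpose_mat V' = 1\<^sub>m m"
    and N'eq: "N' = V' * mat_diag m d' * transpose_mat V'" by (auto simp: eigendecomp_def)
  define B where "B = four_block_mat (1\<^sub>m 1) (0\<^sub>m 1 m) (0\<^sub>m m 1) V'"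
  define d where "d = case_nat l d'"
  have Bc: "B \<in> carrier_mat ?n ?n" using V'c by (auto simp: B_def)
  note [simp] = carrier_matD[OF Bc]
  have Bt: "transpose_mat B = four_block_mat (1\<^sub>m 1) (0\<^sub>m 1 m) (0\<^sub>m m 1) (transpose_mat V')"
    unfolding B_def using V'c by (subst transpose_four_block_mat[of _ 1 1 _ m _ m]) auto
  have diag: "mat_diag ?n d = four_block_mat (mat_diag 1 (\<lambda>_. l)) (0\<^sub>m 1 m) (0\<^sub>m m 1) (mat_diag m d')"
    by (rule eq_matI) (auto simp: mat_diag_def d_def split: nat.splits)
  have Nblock: "N = four_block_mat (mat_diag 1 (\<lambda>_. l)) (0\<^sub>m 1 m) (0\<^sub>m m 1) N'"
    by (rule eq_matI) (auto simp: mat_diag_def N'_def N0 Nswap[of 0])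
  have BtB: "transpose_mat B * B = 1\<^sub>m ?n"
    unfolding Bt unfolding B_def
    by (subst mult_four_block_mat[of _ 1 1 _ m _ m _ _ 1 _ m]) (use V'c V'o in auto)
  have BBt: "B * transpose_mat B = 1\<^sub>m ?n"
    unfolding Bt unfolding B_def
    by (subst mult_four_block_mat[of _ 1 1 _ m _ m _ _ 1 _ m]) (use V'c V'o in auto)
  have "B * mat_diag ?n d = four_block_mat (mat_diag 1 (\<lambda>_. l)) (0\<^sub>m 1 m) (0\<^sub>m m 1) (V' * mat_diag m d')"
    unfolding diag unfolding B_def
    by (subst mult_four_block_mat[of _ 1 1 _ m _ m _ _ 1 _ m]) (use V'c in auto)
  then have "B * mat_diag ?n d * transpose_mat B = N"
    unfolding Nblock Bt
    by (simp only:, subst mult_four_block_mat[of _ 1 1 _ m _ m _ _ 1 _ m]) (use V'c in \<open>auto simp: N'eq\<close>)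
  note NB = this
  have HNH: "H * N * H = M" by (simp add: N_def mat_dim_simps HHX H(3))
  have BtBX: "transpose_mat B * (B * X) = X" if "dim_row X = ?n" for X
    using that by (simp add: mult_assoc_dim[symmetric] BtB)
  have BBtX: "B * (transpose_mat B * X) = X" if "dim_row X = ?n" for X
    using that by (simp add: mult_assoc_dim[symmetric] BBt)
  have "eigendecomp ?n M (H * B) d"
    unfolding eigendecomp_def
  proof (intro conjI)
    show "H * B \<in> carrier_mat ?n ?n" using H Bc by auto
    show "transpose_mat (H * B) * (H * B) = 1\<^sub>m ?n"
      by (simp add: mat_dim_simps H(2) HHX BtB)
    show "H * B * transpose_mat (H * B) = 1\<^sub>m ?n"
      by (simp add: mat_dim_simps H(2,3) BBtX)
    show "M = H * B * mat_diag ?n d * transpose_mat (H * B)"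
      unfolding HNH[symmetric] NB[symmetric] by (simp add: mat_dim_simps H(2))
  qed
  then show ?case by blast
qed

section \<open>Functions of symmetric matrices\<close>

definition symm :: "nat \<Rightarrow> real mat \<Rightarrow> bool" where
  "symm n M \<longleftrightarrow> M \<in> carrier_mat n n \<and> transpose_mat M = M"

lemma symmD:
  assumes "symm n M"
  shows "M \<in> carrier_mat n n" "dim_row M = n" "dim_col M = n" "transpose_mat M = M"
  using assms by (auto simp: symm_def)

lemma symm_add: "symm n A \<Longrightarrow> symm n B \<Longrightarrow> symm n (A + B)"
  unfolding symm_def using transpose_add[of A n n B] by auto

lemma eigendecompD:
  assumes "eigendecomp n M V d"
  shows "V \<in> carrier_mat n n" "dim_row V = n" "dim_col V = n" "transpose_mat V * V = 1\<^sub>m n"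
    "V * transpose_mat V = 1\<^sub>m n" "M = V * mat_diag n d * transpose_mat V"
    "dim_row X = n \<Longrightarrow> V * (transpose_mat V * X) = X"
    "dim_row X = n \<Longrightarrow> transpose_mat V * (V * X) = X"
proof -
  show V: "V \<in> carrier_mat n n" "dim_row V = n" "dim_col V = n"
    and o: "transpose_mat V * V = 1\<^sub>m n" "V * transpose_mat V = 1\<^sub>m n"
    and "M = V * mat_diag n d * transpose_mat V"
    using assms by (auto simp: eigendecomp_def)
  show "dim_row X = n \<Longrightarrow> V * (transpose_mat V * X) = X"
    using V o by (simp add: mult_assoc_dim[symmetric])
  show "dim_row X = n \<Longrightarrow> transpose_mat V * (V * X) = X"
    using V o by (simp add: mult_assoc_dim[symmetric])
qed

lemma transpose_mat_diag [simp]: "transpose_mat (mat_diag n f) = mat_diag n f"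
  by (rule eq_matI) (auto simp: mat_diag_def)

lemma eigendecomp_symm: "eigendecomp n M V d \<Longrightarrow> symm n M"
  by (auto simp: eigendecomp_def symm_def mat_dim_simps)

lemma eigendecomp_exists:
  assumes "symm n M"
  obtains V d where "eigendecomp n M V d"
  using assms spectral_theorem unfolding symm_def by blast

text \<open>Both diagonalizations are intertwined by \<open>transpose_mat V * V'\<close>, whose entry \<open>(i, j)\<close> vanishes
  unless \<open>d i = d' j\<close>; so it also intertwines the two diagonal matrices after applying \<open>f\<close>.\<close>

lemma eigendecomp_fun_unique:
  assumes 1: "eigendecomp n M V d" and 2: "eigendecomp n M V' d'"
  shows "V * mat_diag n (\<lambda>i. f (d i)) * transpose_mat V = V' * mat_diag n (\<lambda>i. f (d' i)) * transpose_mat V'"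
proof -
  note [simp] = eigendecompD(2-5,7-8)[OF 1] eigendecompD(2-5,7-8)[OF 2]
  define Q where "Q = transpose_mat V * V'"
  have Q: "Q \<in> carrier_mat n n" by (rule carrier_matI) (auto simp: Q_def)
  have "mat_diag n d * Q = transpose_mat V * M * V'"
    unfolding eigendecompD(6)[OF 1] Q_def by (simp add: mat_dim_simps)
  also have "\<dots> = Q * mat_diag n d'"
    unfolding eigendecompD(6)[OF 2] Q_def by (simp add: mat_dim_simps)
  finally have eq: "mat_diag n d * Q = Q * mat_diag n d'" .
  have entry: "d i * Q $$ (i, j) = Q $$ (i, j) * d' j" if "i < n" "j < n" for i j
    using arg_cong[OF eq, of "\<lambda>X. X $$ (i, j)"] that
    by (simp add: mat_diag_mult_left[OF Q] mat_diag_mult_right[OF Q])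
  have "f (d i) * Q $$ (i, j) = Q $$ (i, j) * f (d' j)" if "i < n" "j < n" for i j
    using entry[OF that] by (cases "Q $$ (i, j) = 0") auto
  then have feq: "mat_diag n (\<lambda>i. f (d i)) * Q = Q * mat_diag n (\<lambda>i. f (d' i))"
    unfolding mat_diag_mult_left[OF Q] mat_diag_mult_right[OF Q] by (intro eq_matI) auto
  have "V * mat_diag n (\<lambda>i. f (d i)) * transpose_mat V
      = V * (mat_diag n (\<lambda>i. f (d i)) * Q) * transpose_mat V'"
    unfolding Q_def by (simp add: mat_dim_simps)
  also have "\<dots> = V' * mat_diag n (\<lambda>i. f (d' i)) * transpose_mat V'"
    unfolding feq unfolding Q_def by (simp add: mat_dim_simps)
  finally show ?thesis .
qed

lemma mk_diagonal_conv_mat_diag: "mk_diagonal ds = mat_diag (length ds) (\<lambda>i. ds ! i)"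
proof (induction ds)
  case Nil
  show ?case by (rule eq_matI) (auto simp: mk_diagonal_def)
next
  case (Cons a ds)
  have "mk_diagonal (a # ds) = four_block_mat (Matrix.mat (Suc 0) (Suc 0) (\<lambda>_. a))
      (0\<^sub>m (Suc 0) (length ds)) (0\<^sub>m (length ds) (Suc 0)) (mk_diagonal ds)"
    by (simp add: mk_diagonal_def Let_def mk_diagonal_dim[unfolded mk_diagonal_def])
  also have "\<dots> = mat_diag (length (a # ds)) (\<lambda>i. (a # ds) ! i)"
    unfolding Cons by (rule eq_matI) (auto simp: mat_diag_def nth_Cons')
  finally show ?case .
qed

text \<open>The definite description in \<^const>\<open>mat_fun\<close> may thus be evaluated on any diagonalization.\<close>

lemma mat_fun_eigendecomp:
  assumes ed: "eigendecomp n M V d"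
  shows "mat_fun f M = V * mat_diag n (\<lambda>i. f (d i)) * transpose_mat V"
proof -
  have nM: "dim_row M = n" by (rule symmD(2)[OF eigendecomp_symm[OF ed]])
  show ?thesis
    unfolding mat_fun_def nM
  proof (rule the_equality)
    let ?ds = "map d [0..<n]"
    have "mk_diagonal ?ds = mat_diag n d"
      unfolding mk_diagonal_conv_mat_diag by (rule eq_matI) (auto simp: mat_diag_def)
    moreover have "mk_diagonal (map f ?ds) = mat_diag n (\<lambda>i. f (d i))"
      unfolding mk_diagonal_conv_mat_diag by (rule eq_matI) (auto simp: mat_diag_def)
    ultimately show "\<exists>W ds. W \<in> carrier_mat n n \<and> orthonormal_cols W \<and> length ds = n \<and>
        M = W * mk_diagonal ds * transpose_mat W \<and>
        V * mat_diag n (\<lambda>i. f (d i)) * transpose_mat V = W * mk_diagonal (map f ds) * transpose_mat W"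
      using eigendecompD[OF ed]
      by (intro exI[of _ V] exI[of _ ?ds]) (auto simp: orthonormal_cols_def)
  next
    fix X
    assume "\<exists>W ds. W \<in> carrier_mat n n \<and> orthonormal_cols W \<and> length ds = n \<and>
        M = W * mk_diagonal ds * transpose_mat W \<and> X = W * mk_diagonal (map f ds) * transpose_mat W"
    then obtain W ds where W: "W \<in> carrier_mat n n" "orthonormal_cols W" and ds: "length ds = n"
      and M: "M = W * mk_diagonal ds * transpose_mat W"
      and X: "X = W * mk_diagonal (map f ds) * transpose_mat W" by blast
    have WW: "transpose_mat W * W = 1\<^sub>m n" using W by (simp add: orthonormal_cols_def)
    then have "W * transpose_mat W = 1\<^sub>m n"
      by (rule mat_mult_left_right_inverse[rotated 2]) (use W in auto)
    then have "eigendecomp n M W (\<lambda>i. ds ! i)"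
      using W WW M ds by (simp add: eigendecomp_def mk_diagonal_conv_mat_diag)
    from eigendecomp_fun_unique[OF this ed]
    have "W * mat_diag n (\<lambda>i. f (ds ! i)) * transpose_mat W
      = V * mat_diag n (\<lambda>i. f (d i)) * transpose_mat V" .
    moreover have "mk_diagonal (map f ds) = mat_diag n (\<lambda>i. f (ds ! i))"
      unfolding mk_diagonal_conv_mat_diag using ds by (intro eq_matI) (auto simp: mat_diag_def)
    ultimately show "X = V * mat_diag n (\<lambda>i. f (d i)) * transpose_mat V" using X by simp
  qed
qed

lemma mat_fun_symm: "symm n M \<Longrightarrow> symm n (mat_fun f M)"
  by (elim eigendecomp_exists, frule eigendecompD(1), simp add: mat_fun_eigendecomp)
     (auto simp: symm_def mat_dim_simps)

lemma mat_fun_dim [simp]: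
  assumes "symm n M"
  shows "dim_row (mat_fun f M) = n" "dim_col (mat_fun f M) = n"
    "transpose_mat (mat_fun f M) = mat_fun f M"
  using mat_fun_symm[OF assms, of f] by (auto simp: symm_def)

lemma eigendecomp_entry:
  assumes ed: "eigendecomp n M V d" and ab: "a < n" "b < n"
  shows "mat_fun f M $$ (a, b) = (\<Sum>c<n. V $$ (a, c) * f (d c) * V $$ (b, c))"
proof -
  note V = eigendecompD(1)[OF ed]
  note [simp] = carrier_matD[OF V]
  show ?thesis
    unfolding mat_fun_eigendecomp[OF ed] mat_diag_mult_right[OF V]
    using ab by (subst mult_index) auto
qed

lemma mat_fun_mult:
  assumes "symm n M"
  shows "mat_fun f M * mat_fun g M = mat_fun (\<lambda>x. f x * g x) M"
proof -
  obtain V d where ed: "eigendecomp n M V d" using eigendecomp_exists[OF assms] .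
  note [simp] = eigendecompD(2-5,7-8)[OF ed]
  have "V * mat_diag n (\<lambda>i. f (d i)) * transpose_mat V * (V * mat_diag n (\<lambda>i. g (d i)) * transpose_mat V)
    = V * (mat_diag n (\<lambda>i. f (d i)) * mat_diag n (\<lambda>i. g (d i))) * transpose_mat V"
    by (simp add: mat_dim_simps del: mat_diag_diag)
  then show ?thesis by (simp add: mat_fun_eigendecomp[OF ed])
qed

lemma mat_fun_add:
  assumes "symm n M"
  shows "mat_fun (\<lambda>x. f x + g x) M = mat_fun f M + mat_fun g M"
proof -
  obtain V d where ed: "eigendecomp n M V d" using eigendecomp_exists[OF assms] .
  show ?thesis
    using assms
    by (intro eq_matI) (simp_all add: eigendecomp_entry[OF ed] sum.distrib distrib_left distrib_right)
qed

lemma mat_fun_smult: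
  assumes "symm n M"
  shows "mat_fun (\<lambda>x. c * f x) M = c \<cdot>\<^sub>m mat_fun f M"
proof -
  obtain V d where ed: "eigendecomp n M V d" using eigendecomp_exists[OF assms] .
  show ?thesis
    using assms
    by (intro eq_matI) (simp_all add: eigendecomp_entry[OF ed] sum_distrib_left mult_ac)
qed

lemma mat_fun_one:
  assumes "symm n M"
  shows "mat_fun (\<lambda>x. 1) M = 1\<^sub>m n"
proof -
  obtain V d where ed: "eigendecomp n M V d" using eigendecomp_exists[OF assms] .
  show ?thesis by (simp add: mat_fun_eigendecomp[OF ed] eigendecompD(3,5)[OF ed])
qed

lemma mat_fun_zero:
  assumes "symm n M"
  shows "mat_fun (\<lambda>x. 0) M = 0\<^sub>m n n"
proof -
  obtain V d where ed: "eigendecomp n M V d" using eigendecomp_exists[OF assms] .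
  show ?thesis using assms by (intro eq_matI) (simp_all add: eigendecomp_entry[OF ed])
qed

lemma mat_fun_id:
  assumes "symm n M"
  shows "mat_fun (\<lambda>x. x) M = M"
proof -
  obtain V d where ed: "eigendecomp n M V d" using eigendecomp_exists[OF assms] .
  show ?thesis by (simp add: mat_fun_eigendecomp[OF ed] eigendecompD(6)[OF ed, symmetric])
qed

lemma eigendecomp_eigenvalue:
  assumes ed: "eigendecomp n M V d" and i: "i < n"
  shows "eigenvalue M (d i)"
proof -
  note V = eigendecompD(1)[OF ed]
  note [simp] = eigendecompD(2-5,7-8)[OF ed]
  have MV: "M * V = V * mat_diag n d"
    unfolding eigendecompD(6)[OF ed] by (simp add: mat_dim_simps)
  have M: "M \<in> carrier_mat n n" using eigendecomp_symm[OF ed] by (simp add: symm_def)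
  have "M *\<^sub>v col V i = col (V * mat_diag n d) i"
    using col_mult2[OF M V i] MV by simp
  also have "\<dots> = d i \<cdot>\<^sub>v col V i"
    unfolding mat_diag_mult_right[OF V] using i by (intro eq_vecI) auto
  finally have ev: "M *\<^sub>v col V i = d i \<cdot>\<^sub>v col V i" .
  have "col V i \<noteq> 0\<^sub>v n"
  proof
    assume z: "col V i = 0\<^sub>v n"
    have "col V i \<bullet> col V i = (transpose_mat V * V) $$ (i, i)"
      using i by (simp del: eigendecompD(4)[OF ed])
    then show False using i unfolding z by simp
  qed
  then show ?thesis
    using ev V M i unfolding eigenvalue_def eigenvector_def by (intro exI[of _ "col V i"]) auto
qed

lemma mat_fun_cong:
  assumes "symm n M" and eq: "\<And>x. eigenvalue M x \<Longrightarrow> f x = g x"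
  shows "mat_fun f M = mat_fun g M"
proof -
  obtain V d where ed: "eigendecomp n M V d" using eigendecomp_exists[OF assms(1)] .
  show ?thesis
    using assms(1)
    by (intro eq_matI) (simp_all add: eigendecomp_entry[OF ed] eq[OF eigendecomp_eigenvalue[OF ed]])
qed

lemma pow_mat_eq_mat_fun:
  assumes "symm n M"
  shows "M ^\<^sub>m i = mat_fun (\<lambda>x. x ^ i) M"
proof (induction i)
  case 0
  show ?case using assms by (simp add: mat_fun_one symmD)
next
  case (Suc i)
  have "mat_fun (\<lambda>x. x ^ i) M * mat_fun (\<lambda>x. x) M = mat_fun (\<lambda>x. x ^ Suc i) M"
    by (simp add: mat_fun_mult[OF assms] mult.commute)
  then show ?case by (simp add: Suc mat_fun_id[OF assms])
qed

lemma poly_at_mat_eq_mat_fun: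
  assumes "symm n M"
  shows "poly_at_mat p M = mat_fun (poly p) M"
proof -
  obtain V d where ed: "eigendecomp n M V d" using eigendecomp_exists[OF assms] .
  show ?thesis
  proof (rule eq_matI)
    fix a b assume "a < dim_row (mat_fun (poly p) M)" "b < dim_col (mat_fun (poly p) M)"
    then have ab: "a < n" "b < n" using assms by auto
    have "poly_at_mat p M $$ (a, b) = (\<Sum>i\<le>degree p. coeff p i * (\<Sum>c<n. V $$ (a, c) * d c ^ i * V $$ (b, c)))"
      using ab assms
      by (simp add: poly_at_mat_def mat_sum_def symmD pow_mat_eq_mat_fun[OF assms] eigendecomp_entry[OF ed])
    also have "\<dots> = (\<Sum>c<n. \<Sum>i\<le>degree p. coeff p i * (V $$ (a, c) * d c ^ i * V $$ (b, c)))"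
      unfolding sum_distrib_left by (rule sum.swap)
    also have "\<dots> = (\<Sum>c<n. V $$ (a, c) * poly p (d c) * V $$ (b, c))"
      by (intro sum.cong refl) (simp add: poly_altdef sum_distrib_left sum_distrib_right algebra_simps)
    finally show "poly_at_mat p M $$ (a, b) = mat_fun (poly p) M $$ (a, b)"
      by (simp add: eigendecomp_entry[OF ed] ab)
  qed (use assms in \<open>simp_all add: poly_at_mat_def mat_sum_def symmD\<close>)
qed

section \<open>Norms\<close>

definition vnorm :: "real vec \<Rightarrow> real" where
  "vnorm v = sqrt (v \<bullet> v)"

lemma vnorm_L2_set: "v \<in> carrier_vec n \<Longrightarrow> vnorm v = L2_set (\<lambda>i. v $ i) {0..<n}"
  by (simp add: vnorm_def L2_set_def scalar_prod_def power2_eq_square)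

lemma vnorm_nonneg [simp]: "vnorm v \<ge> 0"
  by (simp add: vnorm_def scalar_prod_self_nonneg)

lemma vnorm_sq: "(vnorm v)\<^sup>2 = v \<bullet> v"
  by (simp add: vnorm_def scalar_prod_self_nonneg)

lemma vnorm_triangle:
  assumes "u \<in> carrier_vec n" "v \<in> carrier_vec n"
  shows "vnorm (u + v) \<le> vnorm u + vnorm v"
proof -
  have "vnorm (u + v) = L2_set (\<lambda>i. u $ i + v $ i) {0..<n}"
    unfolding vnorm_L2_set[OF add_carrier_vec[OF assms]] using assms by (intro L2_set_cong) auto
  then show ?thesis using L2_set_triangle_ineq[of "\<lambda>i. u $ i" "\<lambda>i. v $ i"] assms by (simp add: vnorm_L2_set)
qed

lemma vnorm_uminus: "vnorm (- v) = vnorm v"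
  by (simp add: vnorm_def)

lemma scalar_prod_le_vnorm:
  assumes "u \<in> carrier_vec n" "v \<in> carrier_vec n"
  shows "u \<bullet> v \<le> vnorm u * vnorm v"
proof -
  have "u \<bullet> v \<le> (\<Sum>i\<in>{0..<n}. \<bar>u $ i\<bar> * \<bar>v $ i\<bar>)"
    using assms by (auto simp: scalar_prod_def abs_mult[symmetric] intro!: sum_mono)
  also have "\<dots> \<le> vnorm u * vnorm v"
    unfolding vnorm_L2_set[OF assms(1)] vnorm_L2_set[OF assms(2)] by (rule L2_set_mult_ineq)
  finally show ?thesis .
qed

text \<open>Bounds on the operator norm instead of its value: they combine without any boundedness argument for the
  supremum in \<^const>\<open>spectral_norm\<close>.\<close>

definition opnorm_le :: "real mat \<Rightarrow> real \<Rightarrow> bool" where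
  "opnorm_le M c \<longleftrightarrow> (\<forall>v\<in>carrier_vec (dim_col M). vnorm (M *\<^sub>v v) \<le> c * vnorm v)"

lemma opnorm_le_add:
  assumes M: "M \<in> carrier_mat m n" and N: "N \<in> carrier_mat m n" and "opnorm_le M a" "opnorm_le N b"
  shows "opnorm_le (M + N) (a + b)"
  unfolding opnorm_le_def
proof
  fix v :: "real vec" assume "v \<in> carrier_vec (dim_col (M + N))"
  then have v: "v \<in> carrier_vec n" using N by simp
  have "vnorm ((M + N) *\<^sub>v v) \<le> vnorm (M *\<^sub>v v) + vnorm (N *\<^sub>v v)"
    unfolding add_mult_distrib_mat_vec[OF M N v] using M N v by (intro vnorm_triangle[of _ m]) auto
  then show "vnorm ((M + N) *\<^sub>v v) \<le> (a + b) * vnorm v"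
    using assms(3)[unfolded opnorm_le_def, rule_format, of v] assms(4)[unfolded opnorm_le_def, rule_format, of v] v M N
    by (simp add: distrib_right)
qed

lemma opnorm_le_uminus:
  assumes "opnorm_le M a"
  shows "opnorm_le (- M) a"
  unfolding opnorm_le_def
proof
  fix v :: "real vec" assume "v \<in> carrier_vec (dim_col (- M))"
  then have v: "v \<in> carrier_vec (dim_col M)" by simp
  have "(- M) *\<^sub>v v = - (M *\<^sub>v v)" using v by (intro eq_vecI) (auto simp: scalar_prod_def sum_negf)
  then show "vnorm ((- M) *\<^sub>v v) \<le> a * vnorm v" using assms v by (simp add: opnorm_le_def vnorm_uminus)
qed

lemma opnorm_le_minus:
  assumes M: "M \<in> carrier_mat m n" and N: "N \<in> carrier_mat m n" and "opnorm_le M a" "opnorm_le N b"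
  shows "opnorm_le (M - N) (a + b)"
proof -
  have "M - N = M + (- N)" using M N by (intro eq_matI) auto
  then show ?thesis using opnorm_le_add[OF M _ assms(3) opnorm_le_uminus[OF assms(4)]] N by simp
qed

lemma opnorm_le_mult:
  assumes "dim_col M = dim_row N" and "opnorm_le M a" "opnorm_le N b" and "a \<ge> 0"
  shows "opnorm_le (M * N) (a * b)"
  unfolding opnorm_le_def
proof
  fix v :: "real vec" assume "v \<in> carrier_vec (dim_col (M * N))"
  then have v: "v \<in> carrier_vec (dim_col N)" by simp
  have "(M * N) *\<^sub>v v = M *\<^sub>v (N *\<^sub>v v)"
    using assms(1) v by (intro assoc_mult_mat_vec[of _ "dim_row M" "dim_row N" _ "dim_col N"]) auto
  also have "vnorm \<dots> \<le> a * vnorm (N *\<^sub>v v)"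
    using assms(1) by (intro assms(2)[unfolded opnorm_le_def, rule_format] carrier_vecI) simp
  also have "\<dots> \<le> a * (b * vnorm v)"
    by (intro mult_left_mono assms(3)[unfolded opnorm_le_def, rule_format] v assms(4))
  finally show "vnorm ((M * N) *\<^sub>v v) \<le> a * b * vnorm v" by simp
qed

text \<open>A matrix with orthonormal columns is an isometry; its transpose is a contraction by duality, that is by
  the Cauchy-Schwarz inequality applied to \<open>(W\<^sup>T v) \<bullet> (W\<^sup>T v) = v \<bullet> (W W\<^sup>T v)\<close>.\<close>

lemma opnorm_le_orthonormal:
  assumes W: "W \<in> carrier_mat n w" and o: "transpose_mat W * W = 1\<^sub>m w"
  shows "opnorm_le W 1" "opnorm_le (transpose_mat W) 1"
proof -
  have iso: "vnorm (W *\<^sub>v v) = vnorm v" if v: "v \<in> carrier_vec w" for v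
  proof -
    have "(W *\<^sub>v v) \<bullet> (W *\<^sub>v v) = (transpose_mat W *\<^sub>v (W *\<^sub>v v)) \<bullet> v"
      using transpose_vec_mult_scalar[OF W v, of "W *\<^sub>v v"] W v by simp
    also have "transpose_mat W *\<^sub>v (W *\<^sub>v v) = v"
      using assoc_mult_mat_vec[of "transpose_mat W" w n W w v] W v o by simp
    finally show ?thesis by (simp add: vnorm_def)
  qed
  then show "opnorm_le W 1" using W by (auto simp: opnorm_le_def)
  show "opnorm_le (transpose_mat W) 1"
    unfolding opnorm_le_def
  proof
    fix v :: "real vec" assume "v \<in> carrier_vec (dim_col (transpose_mat W))"
    then have v: "v \<in> carrier_vec n" using W by simp
    let ?u = "transpose_mat W *\<^sub>v v"
    have u: "?u \<in> carrier_vec w" using W v by simp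
    have "?u \<bullet> ?u = v \<bullet> (W *\<^sub>v ?u)"
      using transpose_vec_mult_scalar[OF W u v] .
    also have "\<dots> \<le> vnorm v * vnorm (W *\<^sub>v ?u)"
      by (rule scalar_prod_le_vnorm[of _ n]) (use W u v in auto)
    finally have "vnorm ?u * vnorm ?u \<le> vnorm v * vnorm ?u"
      using iso[OF u] vnorm_sq[of ?u] by (simp add: power2_eq_square)
    then have "vnorm ?u \<le> vnorm v"
      by (cases "vnorm ?u = 0") (auto simp: mult_le_cancel_right less_le)
    then show "vnorm ?u \<le> 1 * vnorm v" by simp
  qed
qed

lemma mat_diag_mult_vec:
  fixes v :: "real vec"
  assumes "v \<in> carrier_vec n" "i < n"
  shows "(mat_diag n d *\<^sub>v v) $ i = d i * v $ i"
proof -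
  have "(mat_diag n d *\<^sub>v v) $ i = (\<Sum>j=0..<n. (if i = j then d j else 0) * v $ j)"
    using assms by (simp add: mat_diag_def scalar_prod_def)
  also have "\<dots> = d i * v $ i"
    using assms(2) by (simp add: if_distrib[of "\<lambda>x. x * _"] sum.delta cong: if_cong)
  finally show ?thesis .
qed

lemma opnorm_le_mat_diag:
  assumes "\<And>i. i < n \<Longrightarrow> \<bar>d i\<bar> \<le> c"
  shows "opnorm_le (mat_diag n d) c"
  unfolding opnorm_le_def
proof
  fix v :: "real vec" assume "v \<in> carrier_vec (dim_col (mat_diag n d))"
  then have v: "v \<in> carrier_vec n" by simp
  show "vnorm (mat_diag n d *\<^sub>v v) \<le> c * vnorm v"
  proof (cases "n = 0")
    case True
    then show ?thesis using v by (simp add: vnorm_def scalar_prod_def)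
  next
    case False
    then have c: "c \<ge> 0" using assms[of 0] by simp
    have "vnorm (mat_diag n d *\<^sub>v v) = L2_set (\<lambda>i. d i * v $ i) {0..<n}"
      unfolding vnorm_L2_set[OF mult_mat_vec_carrier[OF mat_diag_dim v]]
      by (rule L2_set_cong) (simp_all add: mat_diag_mult_vec[OF v] del: index_mult_mat_vec)
    also have "\<dots> = L2_set (\<lambda>i. \<bar>d i * v $ i\<bar>) {0..<n}" by (simp add: L2_set_def)
    also have "\<dots> \<le> L2_set (\<lambda>i. c * \<bar>v $ i\<bar>) {0..<n}"
      by (rule L2_set_mono) (auto simp: abs_mult intro!: mult_right_mono assms)
    also have "\<dots> = c * L2_set (\<lambda>i. \<bar>v $ i\<bar>) {0..<n}" using c by (simp add: L2_set_right_distrib)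
    also have "L2_set (\<lambda>i. \<bar>v $ i\<bar>) {0..<n} = vnorm v" unfolding vnorm_L2_set[OF v] by (simp add: L2_set_def)
    finally show ?thesis .
  qed
qed

lemma opnorm_le_mat_fun:
  assumes M: "symm n M" and le: "\<And>x. eigenvalue M x \<Longrightarrow> \<bar>g x\<bar> \<le> c" and c: "c \<ge> 0"
  shows "opnorm_le (mat_fun g M) c"
proof -
  obtain V d where ed: "eigendecomp n M V d" using eigendecomp_exists[OF M] .
  note V = eigendecompD(1)[OF ed]
  have "opnorm_le (mat_diag n (\<lambda>i. g (d i))) c"
    by (rule opnorm_le_mat_diag) (rule le[OF eigendecomp_eigenvalue[OF ed]])
  then have "opnorm_le (V * mat_diag n (\<lambda>i. g (d i)) * transpose_mat V) (1 * c * 1)"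
    by (intro opnorm_le_mult opnorm_le_orthonormal[OF V eigendecompD(4)[OF ed]])
       (use V c in auto)
  then show ?thesis by (simp add: mat_fun_eigendecomp[OF ed])
qed

lemma opnorm_le_congruence:
  assumes W: "W \<in> carrier_mat n w" and o: "transpose_mat W * W = 1\<^sub>m w"
    and M: "M \<in> carrier_mat w w" and le: "opnorm_le M c" and c: "c \<ge> 0"
  shows "opnorm_le (W * M * transpose_mat W) c"
proof -
  have "opnorm_le (W * M * transpose_mat W) (1 * c * 1)"
    by (intro opnorm_le_mult opnorm_le_orthonormal[OF W o] le) (use W M c in auto)
  then show ?thesis by simp
qed

lemma spectral_norm_le:
  assumes "opnorm_le M c" and "c \<ge> 0"
  shows "spectral_norm M \<le> c"
  unfolding spectral_norm_def
proof (rule cSUP_least)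
  have "0\<^sub>v (dim_col M) \<in> {x \<in> carrier_vec (dim_col M). (x :: real vec) \<bullet> x \<le> 1}" by simp
  then show "{x \<in> carrier_vec (dim_col M). (x :: real vec) \<bullet> x \<le> 1} \<noteq> {}" by blast
next
  fix x :: "real vec" assume x: "x \<in> {x \<in> carrier_vec (dim_col M). x \<bullet> x \<le> 1}"
  then have "vnorm x \<le> 1" by (simp add: vnorm_def)
  then have "c * vnorm x \<le> c" using assms(2) by (simp add: mult_left_le)
  then show "sqrt ((M *\<^sub>v x) \<bullet> (M *\<^sub>v x)) \<le> c"
    using assms(1) x unfolding opnorm_le_def vnorm_def[symmetric] by force
qed

section \<open>Spectra of compressions\<close>

definition spec_in :: "real mat \<Rightarrow> real \<Rightarrow> real \<Rightarrow> bool" where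
  "spec_in M a b \<longleftrightarrow> (\<forall>x. eigenvalue M x \<longrightarrow> x \<in> {a..b})"

lemma spec_in_quadratic_form:
  assumes M: "symm n M" and spec: "spec_in M a b" and v: "v \<in> carrier_vec n"
  shows "a * (v \<bullet> v) \<le> v \<bullet> (M *\<^sub>v v)" "v \<bullet> (M *\<^sub>v v) \<le> b * (v \<bullet> v)"
proof -
  obtain V d where ed: "eigendecomp n M V d" using eigendecomp_exists[OF M] .
  note V = eigendecompD(1)[OF ed]
  define y where "y = transpose_mat V *\<^sub>v v"
  have y: "y \<in> carrier_vec n" using V v by (simp add: y_def)
  have yy: "y \<bullet> y = v \<bullet> v"
  proof -
    have "y \<bullet> y = v \<bullet> (V *\<^sub>v y)" using transpose_vec_mult_scalar[OF V y v] by (simp add: y_def)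
    also have "V *\<^sub>v y = (V * transpose_mat V) *\<^sub>v v" unfolding y_def using V v by simp
    finally show ?thesis using v by (simp add: eigendecompD[OF ed])
  qed
  have "M *\<^sub>v v = V *\<^sub>v (mat_diag n d *\<^sub>v y)"
    unfolding eigendecompD(6)[OF ed] y_def using V v by (simp add: assoc_mult_mat_vec[of _ n n _ n])
  then have "v \<bullet> (M *\<^sub>v v) = y \<bullet> (mat_diag n d *\<^sub>v y)"
    using transpose_vec_mult_scalar[OF V mult_mat_vec_carrier[OF mat_diag_dim y] v, of d] by (simp add: y_def)
  also have "\<dots> = (\<Sum>i=0..<n. d i * (y $ i * y $ i))"
  proof -
    note mat_diag_mult_vec[OF y]
    then show ?thesis by (subst scalar_prod_def) (auto simp: algebra_simps intro!: sum.cong simp del: index_mult_mat_vec)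
  qed
  finally have form: "v \<bullet> (M *\<^sub>v v) = (\<Sum>i=0..<n. d i * (y $ i * y $ i))" .
  have yysum: "v \<bullet> v = (\<Sum>i=0..<n. y $ i * y $ i)"
    unfolding yy[symmetric] using y by (simp add: scalar_prod_def)
  have d: "a \<le> d i" "d i \<le> b" if "i < n" for i
    using spec eigendecomp_eigenvalue[OF ed that] by (auto simp: spec_in_def)
  show "a * (v \<bullet> v) \<le> v \<bullet> (M *\<^sub>v v)" "v \<bullet> (M *\<^sub>v v) \<le> b * (v \<bullet> v)"
    unfolding form yysum sum_distrib_left by (auto intro!: sum_mono mult_right_mono d)
qed

lemma compression_symm:
  assumes "symm n M" "W \<in> carrier_mat n w"
  shows "symm w (transpose_mat W * M * W)"
  using assms by (auto simp: symm_def mat_dim_simps)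

text \<open>The minimax principle at the ends of the spectrum: an eigenvalue of the compression is a Rayleigh quotient
  of \<open>M\<close>.\<close>

lemma compression_spec_in:
  assumes M: "symm n M" and spec: "spec_in M a b"
    and W: "W \<in> carrier_mat n w" and o: "transpose_mat W * W = 1\<^sub>m w"
  shows "spec_in (transpose_mat W * M * W) a b"
  unfolding spec_in_def
proof (intro allI impI)
  fix x assume "eigenvalue (transpose_mat W * M * W) x"
  then obtain v where v: "v \<in> carrier_vec w" "v \<noteq> 0\<^sub>v w" and ev: "(transpose_mat W * M * W) *\<^sub>v v = x \<cdot>\<^sub>v v"
    using W by (auto simp: eigenvalue_def eigenvector_def)
  have Mc: "M \<in> carrier_mat n n" using M by (simp add: symm_def)
  let ?u = "W *\<^sub>v v"
  have u: "?u \<in> carrier_vec n" using W v by simp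
  have uu: "?u \<bullet> ?u = v \<bullet> v"
  proof -
    have "?u \<bullet> ?u = (transpose_mat W *\<^sub>v ?u) \<bullet> v" using transpose_vec_mult_scalar[OF W v(1) u] by simp
    also have "transpose_mat W *\<^sub>v ?u = v"
      using assoc_mult_mat_vec[of "transpose_mat W" w n W w v] W v o by simp
    finally show ?thesis .
  qed
  have "?u \<bullet> (M *\<^sub>v ?u) = v \<bullet> (transpose_mat W *\<^sub>v (M *\<^sub>v ?u))"
    using transpose_vec_mult_scalar[OF W v(1), of "M *\<^sub>v ?u"] Mc u v W
    by (simp add: comm_scalar_prod[of v w] comm_scalar_prod[of _ n])
  also have "transpose_mat W *\<^sub>v (M *\<^sub>v ?u) = (transpose_mat W * M * W) *\<^sub>v v"
    using W Mc v by (simp add: assoc_mult_mat_vec[of _ w n _ w] assoc_mult_mat_vec[of _ w n _ n])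
  also have "v \<bullet> \<dots> = x * (v \<bullet> v)" unfolding ev using v by simp
  finally have eq: "?u \<bullet> (M *\<^sub>v ?u) = x * (v \<bullet> v)" .
  have "v \<bullet> v \<noteq> 0" using scalar_prod_self_eq_0[OF v(1)] v(2) by blast
  then have "v \<bullet> v > 0" using scalar_prod_self_nonneg[of v] by simp
  then show "x \<in> {a..b}"
    using spec_in_quadratic_form[OF M spec u] unfolding uu eq by simp
qed

section \<open>Exactness of rational Krylov projections\<close>

lemma poly_degree_induct [consumes 1, case_names zero add smult monom]:
  fixes u :: "real poly"
  assumes "degree u \<le> k"
    and "P 0" and "\<And>u v. P u \<Longrightarrow> P v \<Longrightarrow> P (u + v)" and "\<And>c u. P u \<Longrightarrow> P (smult c u)"
    and "\<And>i. i \<le> k \<Longrightarrow> P (monom 1 i)"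
  shows "P u"
proof -
  have "P (\<Sum>i\<in>I. monom (coeff u i) i)" if "finite I" "I \<subseteq> {..k}" for I
    using that
  proof (induction I rule: finite_induct)
    case (insert i I)
    have "P (smult (coeff u i) (monom 1 i))" using insert.prems assms(4,5) by auto
    then have "P (monom (coeff u i) i)" by (simp add: smult_monom)
    then show ?case using insert assms(3) by simp
  qed (use assms(2) in auto)
  from this[of "{..degree u}"] show ?thesis using assms(1) by (auto simp: poly_as_sum_of_monoms)
qed

text \<open>If a bilinear form on polynomials does not change when a factor \<open>x\<close> is moved from one argument to the
  other, its matrix in the monomial basis has Hankel form and so is symmetric. The shift is only available below
  the degree \<open>k\<close>, but symmetry still holds up to degree \<open>k\<close>: to turn \<open>(x\<^sup>i, x\<^sup>j)\<close> into
  \<open>(x\<^sup>j, x\<^sup>i)\<close> no exponent has to exceed the larger one. This step takes the place of the Bezout identity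
  for \<open>q(x) p(y) - p(x) q(y)\<close>.\<close>

lemma bilinear_hankel_symmetric:
  fixes \<beta> :: "real poly \<Rightarrow> real poly \<Rightarrow> real"
  assumes add: "\<And>u v w. \<beta> (u + v) w = \<beta> u w + \<beta> v w" "\<And>u v w. \<beta> w (u + v) = \<beta> w u + \<beta> w v"
    and smult: "\<And>c u v. \<beta> (smult c u) v = c * \<beta> u v" "\<And>c u v. \<beta> u (smult c v) = c * \<beta> u v"
    and shift: "\<And>a b. a < k \<Longrightarrow> b < k \<Longrightarrow> \<beta> (monom 1 (Suc a)) (monom 1 b) = \<beta> (monom 1 a) (monom 1 (Suc b))"
    and deg: "degree u \<le> k" "degree v \<le> k"
  shows "\<beta> u v = \<beta> v u"
proof -
  have zero: "\<beta> 0 w = 0" "\<beta> w 0 = 0" for w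
    using smult(1)[of 0 0 w] smult(2)[of w 0 0] by simp_all
  have move: "\<beta> (monom 1 (i + t)) (monom 1 c) = \<beta> (monom 1 i) (monom 1 (c + t))"
    if "i + t \<le> k" "c + t \<le> k" for i c t
    using that
  proof (induction t arbitrary: c)
    case (Suc t)
    have "\<beta> (monom 1 (i + Suc t)) (monom 1 c) = \<beta> (monom 1 (i + t)) (monom 1 (Suc c))"
      using shift[of "i + t" c] Suc.prems by simp
    also have "\<dots> = \<beta> (monom 1 i) (monom 1 (Suc c + t))" by (rule Suc.IH) (use Suc.prems in auto)
    finally show ?case by simp
  qed simp
  have mono: "\<beta> (monom 1 i) (monom 1 j) = \<beta> (monom 1 j) (monom 1 i)" if "i \<le> k" "j \<le> k" for i j
  proof (cases "i \<le> j")
    case True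
    then show ?thesis using move[of i "j - i" i] that by simp
  next
    case False
    then show ?thesis using move[of j "i - j" j] that by simp
  qed
  have left: "\<beta> (monom 1 i) v = \<beta> v (monom 1 i)" if "i \<le> k" for i
    using deg(2) by (induction v rule: poly_degree_induct) (simp_all add: add smult zero mono that)
  show ?thesis
    using deg(1) by (induction u rule: poly_degree_induct) (simp_all add: add smult zero left)
qed

text \<open>The rational function \<open>u/q\<close> of \<open>M\<close>. The denominator stays fixed, which makes this linear in \<open>u\<close> even
  where \<open>q\<close> vanishes.\<close>

definition rat_fun :: "real poly \<Rightarrow> real poly \<Rightarrow> real mat \<Rightarrow> real mat" where
  "rat_fun u q M = mat_fun (\<lambda>x. poly u x / poly q x) M"

lemma rat_fun_dim [simp]:
  assumes "symm n M"
  shows "dim_row (rat_fun u q M) = n" "dim_col (rat_fun u q M) = n"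
    "transpose_mat (rat_fun u q M) = rat_fun u q M"
  using assms by (auto simp: rat_fun_def)

lemma rat_fun_add: "symm n M \<Longrightarrow> rat_fun (u + v) q M = rat_fun u q M + rat_fun v q M"
  unfolding rat_fun_def by (subst mat_fun_add[symmetric]) (auto simp: add_divide_distrib)

lemma rat_fun_smult: "symm n M \<Longrightarrow> rat_fun (smult c u) q M = c \<cdot>\<^sub>m rat_fun u q M"
  unfolding rat_fun_def by (subst mat_fun_smult[symmetric]) auto

lemma rat_fun_zero: "symm n M \<Longrightarrow> rat_fun 0 q M = 0\<^sub>m n n"
  by (simp add: rat_fun_def mat_fun_zero)

lemma rat_fun_self:
  assumes "symm n M" "\<And>x. eigenvalue M x \<Longrightarrow> poly q x \<noteq> 0"
  shows "rat_fun q q M = 1\<^sub>m n"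
proof -
  have "rat_fun q q M = mat_fun (\<lambda>x. 1) M"
    unfolding rat_fun_def by (rule mat_fun_cong[OF assms(1)]) (simp add: assms(2))
  then show ?thesis using mat_fun_one[OF assms(1)] by simp
qed

lemma rat_fun_Suc:
  assumes "symm n M"
  shows "rat_fun (monom 1 (Suc a)) q M = M * rat_fun (monom 1 a) q M"
    and "rat_fun (monom 1 (Suc a)) q M = rat_fun (monom 1 a) q M * M"
proof -
  let ?r = "\<lambda>x. poly (monom 1 a) x / poly q x"
  have "M * rat_fun (monom 1 a) q M = mat_fun (\<lambda>x. x * ?r x) M"
    unfolding rat_fun_def using mat_fun_mult[OF assms, of "\<lambda>x. x" ?r] by (simp only: mat_fun_id[OF assms])
  moreover have "rat_fun (monom 1 a) q M * M = mat_fun (\<lambda>x. ?r x * x) M"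
    unfolding rat_fun_def using mat_fun_mult[OF assms, of ?r "\<lambda>x. x"] by (simp only: mat_fun_id[OF assms])
  ultimately show "rat_fun (monom 1 (Suc a)) q M = M * rat_fun (monom 1 a) q M"
    and "rat_fun (monom 1 (Suc a)) q M = rat_fun (monom 1 a) q M * M"
    by (simp_all add: rat_fun_def poly_monom mult_ac)
qed

lemma smult_mult_dim:
  fixes A B :: "real mat"
  assumes "dim_col A = dim_row B"
  shows "(c \<cdot>\<^sub>m A) * B = c \<cdot>\<^sub>m (A * B)" "A * (c \<cdot>\<^sub>m B) = c \<cdot>\<^sub>m (A * B)"
proof -
  have AB: "A \<in> carrier_mat (dim_row A) (dim_row B)" "B \<in> carrier_mat (dim_row B) (dim_col B)"
    using assms by auto
  show "(c \<cdot>\<^sub>m A) * B = c \<cdot>\<^sub>m (A * B)" by (rule mult_smult_assoc_mat[OF AB])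
  show "A * (c \<cdot>\<^sub>m B) = c \<cdot>\<^sub>m (A * B)" by (rule mult_smult_distrib[OF AB])
qed

text \<open>Put \<open>Y = W\<^sup>T q(M)\<inverse> Z\<close> and let \<open>N\<close> be the compression of \<open>M\<close>. Polynomial Krylov exactness gives
  \<open>W\<^sup>T u(M) q(M)\<inverse> Z = u(N) Y\<close> up to degree \<open>k\<close>, one degree more than what the space contains,
  since the last factor \<open>M\<close> meets \<open>W\<^sup>T\<close> on its left. That degree is needed for \<open>u = q\<close>, which identifies \<open>Y\<close> as \<open>q(N)\<inverse> W\<^sup>T Z\<close>.\<close>

lemma krylov_projection_exact:
  assumes M: "symm n M" and Z: "Z \<in> carrier_mat n s"
    and W: "W \<in> carrier_mat n w" and o: "transpose_mat W * W = 1\<^sub>m w"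
    and q: "degree q \<le> k" "\<And>x. eigenvalue M x \<Longrightarrow> poly q x \<noteq> 0"
      "\<And>x. eigenvalue (transpose_mat W * M * W) x \<Longrightarrow> poly q x \<noteq> 0"
    and krylov: "\<And>a. a < k \<Longrightarrow> W * (transpose_mat W * (rat_fun (monom 1 a) q M * Z)) = rat_fun (monom 1 a) q M * Z"
    and a: "a < k"
  shows "rat_fun (monom 1 a) q M * Z = W * (rat_fun (monom 1 a) q (transpose_mat W * M * W) * (transpose_mat W * Z))"
proof -
  define N where "N = transpose_mat W * M * W"
  have N: "symm w N" unfolding N_def by (rule compression_symm[OF M W])
  note [simp] = symmD(2,3)[OF M] symmD(2,3)[OF N] carrier_matD[OF Z] carrier_matD[OF W]
    rat_fun_dim[OF M] rat_fun_dim[OF N] mat_fun_dim[OF M] mat_fun_dim[OF N]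
  define R where "R u = rat_fun u q M * Z" for u
  have R [simp]: "dim_row (R u) = n" "dim_col (R u) = s" for u by (auto simp: R_def)
  define Y where "Y = transpose_mat W * R (monom 1 0)"
  have Y [simp]: "dim_row Y = w" "dim_col Y = s" by (auto simp: Y_def)
  have mono: "transpose_mat W * R (monom 1 i) = mat_fun (poly (monom 1 i)) N * Y" if "i \<le> k" for i
    using that
  proof (induction i)
    case 0
    have "poly (monom (1::real) 0) = (\<lambda>x. 1)" by (auto simp: fun_eq_iff)
    then have "mat_fun (poly (monom 1 0)) N * Y = Y"
      by (simp only: mat_fun_one[OF N]) simp
    then show ?case by (simp only: Y_def)
  next
    case (Suc i)
    have "R (monom 1 (Suc i)) = M * R (monom 1 i)"
      unfolding R_def rat_fun_Suc(1)[OF M] by (simp add: mult_assoc_dim)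
    also have "\<dots> = M * (W * (transpose_mat W * R (monom 1 i)))"
      unfolding R_def using krylov[of i] Suc.prems by simp
    finally have "transpose_mat W * R (monom 1 (Suc i)) = N * (transpose_mat W * R (monom 1 i))"
      by (simp add: N_def mat_dim_simps)
    also have "\<dots> = N * (mat_fun (poly (monom 1 i)) N * Y)" using Suc by simp
    also have "\<dots> = mat_fun (\<lambda>x. x) N * mat_fun (poly (monom 1 i)) N * Y"
      by (simp add: mult_assoc_dim mat_fun_id[OF N])
    also have "mat_fun (\<lambda>x. x) N * mat_fun (poly (monom 1 i)) N = mat_fun (poly (monom 1 (Suc i))) N"
      unfolding mat_fun_mult[OF N] by (rule arg_cong[of _ _ "\<lambda>f. mat_fun f N"]) (auto simp: poly_monom)
    finally show ?case .
  qed
  have lin: "transpose_mat W * R u = mat_fun (poly u) N * Y" if "degree u \<le> k" for u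
    using that
  proof (induction u rule: poly_degree_induct)
    case zero
    have "poly (0::real poly) = (\<lambda>x. 0)" by (auto simp: fun_eq_iff)
    then have "mat_fun (poly 0) N = 0\<^sub>m w w" by (simp only: mat_fun_zero[OF N])
    moreover have "R 0 = 0\<^sub>m n s" using Z by (simp add: R_def rat_fun_zero[OF M])
    moreover have "transpose_mat W * 0\<^sub>m n s = 0\<^sub>m w s" "0\<^sub>m w w * Y = 0\<^sub>m w s"
      by (intro right_mult_zero_mat left_mult_zero_mat carrier_matI; simp)+
    ultimately show ?case by (simp only:)
  next
    case (add u v)
    have "mat_fun (poly (u + v)) N = mat_fun (poly u) N + mat_fun (poly v) N"
      unfolding mat_fun_add[OF N, symmetric] by (rule arg_cong[of _ _ "\<lambda>f. mat_fun f N"]) auto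
    moreover have "R (u + v) = R u + R v" by (simp add: R_def rat_fun_add[OF M] mat_dim_simps)
    ultimately show ?case using add by (simp add: mat_dim_simps del: poly_add)
  next
    case (smult c u)
    have "mat_fun (poly (smult c u)) N = c \<cdot>\<^sub>m mat_fun (poly u) N"
      unfolding mat_fun_smult[OF N, symmetric] by (rule arg_cong[of _ _ "\<lambda>f. mat_fun f N"]) auto
    moreover have "R (smult c u) = c \<cdot>\<^sub>m R u" by (simp add: R_def rat_fun_smult[OF M] smult_mult_dim)
    ultimately show ?case using smult by (simp add: smult_mult_dim del: poly_smult)
  next
    case (monom i)
    then show ?case by (rule mono)
  qed
  have "R q = Z" using rat_fun_self[OF M q(2)] by (simp add: R_def)
  then have WZ: "transpose_mat W * Z = mat_fun (poly q) N * Y" using lin[OF q(1)] by simp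
  have "rat_fun (monom 1 a) q N * mat_fun (poly q) N = mat_fun (poly (monom 1 a)) N"
    unfolding rat_fun_def mat_fun_mult[OF N] using q(3) by (intro mat_fun_cong[OF N]) (auto simp: N_def)
  then have "rat_fun (monom 1 a) q N * (transpose_mat W * Z) = mat_fun (poly (monom 1 a)) N * Y"
    unfolding WZ by (simp add: mult_assoc_dim[symmetric])
  also have "\<dots> = transpose_mat W * R (monom 1 a)" using mono a by simp
  finally show ?thesis using krylov[OF a] by (simp add: N_def R_def)
qed

text \<open>The matrix \<open>A\<close> arises from \<open>D\<close> by an update whose range lies in that of \<open>Z\<close>, and \<open>W\<close> contains the rational
  Krylov space of \<open>D\<close>, \<open>Z\<close> with denominator \<open>q\<close>; \<open>q\<close> has no zeros in any of the four spectra involved.\<close>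

locale krylov_update =
  fixes n w s k :: nat and D A W Z X :: "real mat" and q :: "real poly"
  assumes D: "symm n D" and X: "symm s X" and Z: "Z \<in> carrier_mat n s"
    and W: "W \<in> carrier_mat n w" and o: "transpose_mat W * W = 1\<^sub>m w"
    and A: "A = D + Z * X * transpose_mat Z"
    and degq: "degree q \<le> k"
    and qD: "\<And>x. eigenvalue D x \<Longrightarrow> poly q x \<noteq> 0"
    and qA: "\<And>x. eigenvalue A x \<Longrightarrow> poly q x \<noteq> 0"
    and qDW: "\<And>x. eigenvalue (transpose_mat W * D * W) x \<Longrightarrow> poly q x \<noteq> 0"
    and qAW: "\<And>x. eigenvalue (transpose_mat W * A * W) x \<Longrightarrow> poly q x \<noteq> 0"
    and krylov: "\<And>a. a < k \<Longrightarrow>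
      W * (transpose_mat W * (rat_fun (monom 1 a) q D * Z)) = rat_fun (monom 1 a) q D * Z"
begin

lemma symm_A: "symm n A"
  unfolding A using D X Z by (auto simp: symm_def mat_dim_simps)

lemmas dims [simp] = symmD(2,3)[OF D] symmD(2,3)[OF symm_A] symmD(2,3)[OF X] carrier_matD[OF Z] carrier_matD[OF W]
    rat_fun_dim[OF D] rat_fun_dim[OF symm_A]

text \<open>Moving one factor \<open>x\<close> between the two arguments of \<open>(u, v) \<mapsto> D\<^sub>u A\<^sub>v\<close> costs a term that factors
  through \<open>Z\<close>, because \<open>A - D = Z X Z\<^sup>T\<close>.\<close>

lemma resolvent_shift:
  "rat_fun (monom 1 (Suc a)) q D * rat_fun (monom 1 b) q A
   = rat_fun (monom 1 a) q D * rat_fun (monom 1 (Suc b)) q A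
     - rat_fun (monom 1 a) q D * Z * X * transpose_mat Z * rat_fun (monom 1 b) q A"
proof -
  have "rat_fun (monom 1 a) q D * rat_fun (monom 1 (Suc b)) q A
      = rat_fun (monom 1 a) q D * ((D + Z * X * transpose_mat Z) * rat_fun (monom 1 b) q A)"
    by (simp only: rat_fun_Suc(1)[OF symm_A] A[symmetric])
  also have "\<dots> = rat_fun (monom 1 (Suc a)) q D * rat_fun (monom 1 b) q A
     + rat_fun (monom 1 a) q D * Z * X * transpose_mat Z * rat_fun (monom 1 b) q A"
    unfolding rat_fun_Suc(2)[OF D] by (simp add: mat_dim_simps)
  finally show ?thesis by (simp, intro eq_matI) auto
qed

text \<open>The space also contains the rational Krylov space of \<open>A\<close>. The projection \<open>P\<close> onto the orthogonal complement of
  the range of \<open>W\<close> kills the shift term, so the entries of \<open>P D\<^sub>u A\<^sub>v\<close> are symmetric in \<open>u\<close>, \<open>v\<close>; the pair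
  \<open>(q, v)\<close> yields \<open>P A\<^sub>v = P D\<^sub>v\<close>.\<close>

lemma krylov_perturbed:
  assumes a: "a < k"
  shows "W * (transpose_mat W * (rat_fun (monom 1 a) q A * Z)) = rat_fun (monom 1 a) q A * Z"
proof -
  define P where "P = 1\<^sub>m n - W * transpose_mat W"
  have P [simp]: "dim_row P = n" "dim_col P = n" by (auto simp: P_def)
  have P0: "P * (rat_fun (monom 1 a) q D * Z) = 0\<^sub>m n s" if "a < k" for a
    using krylov[OF that] by (simp add: P_def mat_dim_simps minus_r_inv_mat[of _ n s] carrier_matI)
  have eq: "P * rat_fun v q A = P * rat_fun v q D" if v: "degree v \<le> k" for v
  proof (rule eq_matI)
    fix i j assume "i < dim_row (P * rat_fun v q D)" "j < dim_col (P * rat_fun v q D)"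
    then have ij: "i < n" "j < n" by auto
    define \<beta> where "\<beta> u v = (P * (rat_fun u q D * rat_fun v q A)) $$ (i, j)" for u v
    have "\<beta> q v = \<beta> v q"
    proof (rule bilinear_hankel_symmetric[of \<beta>, OF _ _ _ _ _ degq v])
      fix a b assume ab: "a < k" "b < k"
      have "P * (rat_fun (monom 1 a) q D * Z * X * transpose_mat Z * rat_fun (monom 1 b) q A)
        = P * (rat_fun (monom 1 a) q D * Z) * (X * transpose_mat Z * rat_fun (monom 1 b) q A)"
        by (simp add: mult_assoc_dim)
      also have "\<dots> = 0\<^sub>m n n"
        unfolding P0[OF ab(1)] by (intro left_mult_zero_mat carrier_matI) auto
      finally have z: "P * (rat_fun (monom 1 a) q D * Z * X * transpose_mat Z * rat_fun (monom 1 b) q A) = 0\<^sub>m n n" .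
      have "P * (rat_fun (monom 1 (Suc a)) q D * rat_fun (monom 1 b) q A)
        = P * (rat_fun (monom 1 a) q D * rat_fun (monom 1 (Suc b)) q A) - 0\<^sub>m n n"
        unfolding resolvent_shift z[symmetric] by (rule mult_minus_dim) auto
      then show "\<beta> (monom 1 (Suc a)) (monom 1 b) = \<beta> (monom 1 a) (monom 1 (Suc b))"
        using ij unfolding \<beta>_def by (simp del: index_mult_mat(1))
    qed (use ij in \<open>simp_all add: \<beta>_def rat_fun_add[OF D] rat_fun_add[OF symm_A] rat_fun_smult[OF D]
        rat_fun_smult[OF symm_A] mat_dim_simps smult_mult_dim del: index_mult_mat(1)\<close>)
    then show "(P * rat_fun v q A) $$ (i, j) = (P * rat_fun v q D) $$ (i, j)"
      by (simp add: \<beta>_def rat_fun_self[OF D qD] rat_fun_self[OF symm_A qA] del: index_mult_mat(1))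
  qed auto
  have "P * (rat_fun (monom 1 a) q A * Z) = (P * rat_fun (monom 1 a) q A) * Z"
    by (simp add: mult_assoc_dim)
  also have "\<dots> = 0\<^sub>m n s"
    using eq[of "monom 1 a"] P0[OF a] a by (simp add: degree_monom_eq mult_assoc_dim)
  finally have z: "P * (rat_fun (monom 1 a) q A * Z) = 0\<^sub>m n s" .
  have "P * (rat_fun (monom 1 a) q A * Z)
      = rat_fun (monom 1 a) q A * Z - W * (transpose_mat W * (rat_fun (monom 1 a) q A * Z))"
    by (simp add: P_def mat_dim_simps)
  then have e: "rat_fun (monom 1 a) q A * Z - W * (transpose_mat W * (rat_fun (monom 1 a) q A * Z)) = 0\<^sub>m n s"
    using z by simp
  show ?thesis
  proof (rule eq_matI)
    fix i j assume ij: "i < dim_row (rat_fun (monom 1 a) q A * Z)" "j < dim_col (rat_fun (monom 1 a) q A * Z)"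
    then show "(W * (transpose_mat W * (rat_fun (monom 1 a) q A * Z))) $$ (i, j) = (rat_fun (monom 1 a) q A * Z) $$ (i, j)"
      using arg_cong[OF e, of "\<lambda>Y. Y $$ (i, j)"] by (simp del: index_mult_mat(1))
  qed auto
qed

text \<open>The same form, from which its compressed counterpart is subtracted, has the shift property: the two shift terms agree
  since \<open>D\<^sub>u Z\<close> and \<open>A\<^sub>v Z\<close> can be computed in the compression. Symmetry in the pair \<open>(q, p)\<close> is the
  claim.\<close>

theorem rational_update_exact:
  assumes p: "degree p < k"
  shows "rat_fun p q A - rat_fun p q D
    = W * rat_fun p q (transpose_mat W * A * W) * transpose_mat W
      - W * rat_fun p q (transpose_mat W * D * W) * transpose_mat W"
proof -
  define N where "N = transpose_mat W * D * W"
  define K where "K = transpose_mat W * A * W"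
  have N: "symm w N" unfolding N_def by (rule compression_symm[OF D W])
  have K: "symm w K" unfolding K_def by (rule compression_symm[OF symm_A W])
  note [simp] = symmD(2,3)[OF N] symmD(2,3)[OF K] rat_fun_dim[OF N] rat_fun_dim[OF K]
  have WW: "transpose_mat W * (W * Y) = Y" if "dim_row Y = w" for Y
    using that by (simp add: mult_assoc_dim[symmetric] o)
  have K_eq: "K = N + transpose_mat W * Z * X * transpose_mat (transpose_mat W * Z)"
    unfolding K_def N_def A by (simp add: mat_dim_simps)
  have left: "rat_fun (monom 1 a) q D * Z = W * (rat_fun (monom 1 a) q N * (transpose_mat W * Z))" if "a < k" for a
    unfolding N_def by (rule krylov_projection_exact[OF D Z W o degq qD qDW krylov that])
  have "rat_fun (monom 1 a) q A * Z = W * (rat_fun (monom 1 a) q K * (transpose_mat W * Z))" if "a < k" for a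
    unfolding K_def by (rule krylov_projection_exact[OF symm_A Z W o degq qA qAW krylov_perturbed that])
  from arg_cong[OF this, of _ transpose_mat]
  have right: "transpose_mat Z * rat_fun (monom 1 a) q A
      = transpose_mat Z * W * rat_fun (monom 1 a) q K * transpose_mat W" if "a < k" for a
    using that by (simp add: mat_dim_simps)
  have shift: "rat_fun (monom 1 (Suc a)) q N * rat_fun (monom 1 b) q K
     = rat_fun (monom 1 a) q N * rat_fun (monom 1 (Suc b)) q K
       - rat_fun (monom 1 a) q N * (transpose_mat W * Z) * X * (transpose_mat Z * W) * rat_fun (monom 1 b) q K" for a b
  proof -
    have "rat_fun (monom 1 a) q N * rat_fun (monom 1 (Suc b)) q K
        = rat_fun (monom 1 a) q N * ((N + transpose_mat W * Z * X * transpose_mat (transpose_mat W * Z)) * rat_fun (monom 1 b) q K)"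
      by (simp only: rat_fun_Suc(1)[OF K] K_eq[symmetric])
    also have "\<dots> = rat_fun (monom 1 (Suc a)) q N * rat_fun (monom 1 b) q K
       + rat_fun (monom 1 a) q N * (transpose_mat W * Z) * X * (transpose_mat Z * W) * rat_fun (monom 1 b) q K"
      unfolding rat_fun_Suc(2)[OF N] by (simp add: mat_dim_simps)
    finally show ?thesis by (simp, intro eq_matI) auto
  qed
  show ?thesis
    unfolding N_def[symmetric] K_def[symmetric]
  proof (rule eq_matI)
    fix i j
    assume "i < dim_row (W * rat_fun p q K * transpose_mat W - W * rat_fun p q N * transpose_mat W)"
      "j < dim_col (W * rat_fun p q K * transpose_mat W - W * rat_fun p q N * transpose_mat W)"
    then have ij: "i < n" "j < n" by auto
    define \<beta> where "\<beta> u v = (rat_fun u q D * rat_fun v q A) $$ (i, j)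
      - (W * (rat_fun u q N * rat_fun v q K) * transpose_mat W) $$ (i, j)" for u v
    have "\<beta> q p = \<beta> p q"
    proof (rule bilinear_hankel_symmetric[of \<beta>, OF _ _ _ _ _ degq])
      fix a b assume ab: "a < k" "b < k"
      define Q where "Q = rat_fun (monom 1 a) q N * (transpose_mat W * Z) * X * (transpose_mat Z * W) * rat_fun (monom 1 b) q K"
      have Q [simp]: "dim_row Q = w" "dim_col Q = w" by (auto simp: Q_def)
      have "rat_fun (monom 1 a) q D * Z * X * transpose_mat Z * rat_fun (monom 1 b) q A
        = (rat_fun (monom 1 a) q D * Z) * X * (transpose_mat Z * rat_fun (monom 1 b) q A)"
        by (simp add: mult_assoc_dim)
      also have "\<dots> = W * Q * transpose_mat W"
        unfolding left[OF ab(1)] right[OF ab(2)] Q_def by (simp add: mult_assoc_dim)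
      finally have e1: "rat_fun (monom 1 (Suc a)) q D * rat_fun (monom 1 b) q A
        = rat_fun (monom 1 a) q D * rat_fun (monom 1 (Suc b)) q A - W * Q * transpose_mat W"
        using resolvent_shift[of a b] by simp
      have e2: "W * (rat_fun (monom 1 (Suc a)) q N * rat_fun (monom 1 b) q K) * transpose_mat W
        = W * (rat_fun (monom 1 a) q N * rat_fun (monom 1 (Suc b)) q K) * transpose_mat W
          - W * Q * transpose_mat W"
        unfolding shift[of a b] Q_def[symmetric] by (simp add: mat_dim_simps)
      show "\<beta> (monom 1 (Suc a)) (monom 1 b) = \<beta> (monom 1 a) (monom 1 (Suc b))"
        unfolding \<beta>_def e1 e2 using ij by (simp del: index_mult_mat(1))
    qed (use ij p in \<open>simp_all add: \<beta>_def rat_fun_add[OF D] rat_fun_add[OF symm_A] rat_fun_smult[OF D]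
        rat_fun_smult[OF symm_A] rat_fun_add[OF N] rat_fun_add[OF K] rat_fun_smult[OF N] rat_fun_smult[OF K]
        mat_dim_simps smult_mult_dim right_diff_distrib del: index_mult_mat(1)\<close>)
    moreover have "rat_fun q q D = 1\<^sub>m n" "rat_fun q q A = 1\<^sub>m n" "rat_fun q q N = 1\<^sub>m w" "rat_fun q q K = 1\<^sub>m w"
      using rat_fun_self[OF D qD] rat_fun_self[OF symm_A qA] rat_fun_self[OF N] rat_fun_self[OF K] qDW qAW
      by (auto simp: N_def K_def)
    ultimately show "(rat_fun p q A - rat_fun p q D) $$ (i, j)
      = (W * rat_fun p q K * transpose_mat W - W * rat_fun p q N * transpose_mat W) $$ (i, j)"
      using ij by (simp add: \<beta>_def del: index_mult_mat(1))
  qed auto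
qed

end

section \<open>Best rational approximation on an interval\<close>

lemma sup_norm_on_le_iff:
  assumes "c \<ge> 0"
  shows "sup_norm_on S g \<le> ennreal c \<longleftrightarrow> (\<forall>x\<in>S. \<bar>g x\<bar> \<le> c)"
  using assms by (simp add: sup_norm_on_def SUP_le_iff)

text \<open>The Lagrange basis makes the coordinates of a polynomial of small degree its values at the nodes, so that
  pointwise convergence at the nodes implies convergence everywhere.\<close>

lemma lagrange_basis:
  fixes X :: "real set"
  assumes X: "finite X"
  obtains l where "\<And>x. x \<in> X \<Longrightarrow> degree (l x) < card X"
    and "\<And>x y. x \<in> X \<Longrightarrow> y \<in> X \<Longrightarrow> poly (l x) y = (if x = y then 1 else 0)"
proof
  define l :: "real \<Rightarrow> real poly" where "l = (\<lambda>x. \<Prod>y\<in>X - {x}. Polynomial.smult (1 / (x - y)) [:- y, 1:])"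
  show "degree (l x) < card X" if "x \<in> X" for x
  proof -
    have "degree (l x) \<le> (\<Sum>y\<in>X - {x}. degree (Polynomial.smult (1 / (x - y)) [:- y, 1:]))"
      unfolding l_def by (rule order.trans[OF degree_prod_sum_le]) (use X in \<open>simp_all only: o_def finite_Diff\<close>)
    also have "\<dots> \<le> (\<Sum>y\<in>X - {x}. 1)"
      by (intro sum_mono order.trans[OF degree_smult_le]) simp
    also have "\<dots> < card X" using X that card_Diff1_less[of X x] by simp
    finally show ?thesis .
  qed
  show "poly (l x) y = (if x = y then 1 else 0)" if "x \<in> X" "y \<in> X" for x y
  proof (cases "x = y")
    case True
    have "(\<Prod>z\<in>X - {x}. (x - z) / (x - z)) = 1" by (intro prod.neutral) auto
    then show ?thesis using True by (simp add: l_def poly_prod divide_simps)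
  next
    case False
    then show ?thesis using X that by (auto simp: l_def poly_prod intro!: prod_zero bexI[of _ y])
  qed
qed

text \<open>On at most \<open>k\<close> points interpolation gives error \<open>0\<close>. Otherwise a minimizing sequence is bounded at
  \<open>k\<close> nodes in \<open>S\<close>; along a subsequence its numerators converge there, hence everywhere, and the
  pointwise limit does not increase the supremum. No norm on the rational functions is needed, which matters because
  their suprema over \<open>S\<close> may be infinite.\<close>

lemma best_rational_exists:
  fixes f :: "real \<Rightarrow> real"
  assumes q: "\<And>x. x \<in> S \<Longrightarrow> poly (pole_poly \<xi>s) x \<noteq> 0" and f: "\<And>x. x \<in> S \<Longrightarrow> \<bar>f x\<bar> \<le> B"
  shows "\<exists>\<rho>. is_arg_min (\<lambda>\<rho>. sup_norm_on S (\<lambda>x. f x - \<rho> x)) (\<lambda>\<rho>. \<rho> \<in> rational_space \<xi>s) \<rho>"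
proof -
  define N where "N \<rho> = sup_norm_on S (\<lambda>x. f x - \<rho> x)" for \<rho>
  define Q where "Q = pole_poly \<xi>s"
  define k where "k = length \<xi>s"
  have Q: "poly Q x \<noteq> 0" if "x \<in> S" for x using q that by (simp add: Q_def)
  have V: "\<rho> \<in> rational_space \<xi>s \<longleftrightarrow> (\<exists>p. (p = 0 \<or> degree p < k) \<and> \<rho> = (\<lambda>x. poly p x / poly Q x))" for \<rho>
    by (auto simp: rational_space_def Q_def k_def)
  have zero: "(\<lambda>x. 0) \<in> rational_space \<xi>s" unfolding V by (intro exI[of _ 0]) auto
  obtain \<rho> where "\<rho> \<in> rational_space \<xi>s" and "\<And>\<sigma>. \<sigma> \<in> rational_space \<xi>s \<Longrightarrow> N \<rho> \<le> N \<sigma>"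
  proof (cases "finite S \<and> card S \<le> k")
    case True
    obtain l where l: "\<And>x. x \<in> S \<Longrightarrow> degree (l x) < card S"
      "\<And>x y. x \<in> S \<Longrightarrow> y \<in> S \<Longrightarrow> poly (l x) y = (if x = y then 1 else 0)"
      using lagrange_basis True by blast
    define p where "p = (\<Sum>x\<in>S. Polynomial.smult (f x * poly Q x) (l x))"
    have deg: "p = 0 \<or> degree p < k"
    proof (cases "S = {}")
      case False
      then have k: "k > 0" using True by (metis card_0_eq le_zero_eq neq0_conv)
      have "degree p \<le> k - 1"
        unfolding p_def
        by (rule degree_sum_le) (use True l(1) in \<open>fastforce intro: order.trans[OF degree_smult_le]\<close>)+
      then show ?thesis using k by linarith
    qed (simp add: p_def)
    have val: "poly p y = f y * poly Q y" if "y \<in> S" for y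
    proof -
      have "poly p y = (\<Sum>x\<in>S. if x = y then f x * poly Q x else 0)"
        unfolding p_def poly_sum by (intro sum.cong refl) (simp add: l(2) that)
      then show ?thesis using True that by (simp add: sum.delta)
    qed
    have "N (\<lambda>x. poly p x / poly Q x) \<le> ennreal 0"
      unfolding N_def by (subst sup_norm_on_le_iff) (auto simp: val Q)
    then have "N (\<lambda>x. poly p x / poly Q x) = 0" by simp
    then show ?thesis by (intro that[of "\<lambda>x. poly p x / poly Q x"]) (use deg in \<open>auto simp: V\<close>)
  next
    case False
    obtain X where X: "X \<subseteq> S" "finite X" "card X = k"
      using False by (metis infinite_arbitrarily_large obtain_subset_with_card_n nat_le_linear)
    obtain l where l: "\<And>x. x \<in> X \<Longrightarrow> degree (l x) < card X"
      "\<And>x y. x \<in> X \<Longrightarrow> y \<in> X \<Longrightarrow> poly (l x) y = (if x = y then 1 else 0)"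
      using lagrange_basis[OF X(2)] by blast
    have interp: "p = (\<Sum>x\<in>X. Polynomial.smult (poly p x) (l x))" if "p = 0 \<or> degree p < k" for p
    proof (cases "X = {}")
      case True
      then show ?thesis using that X by auto
    next
      case False
      then have k: "k > 0" using X by (metis card_gt_0_iff)
      show ?thesis
      proof (rule poly_eqI_degree[of X])
        fix y assume y: "y \<in> X"
        have "poly (\<Sum>x\<in>X. Polynomial.smult (poly p x) (l x)) y = (\<Sum>x\<in>X. if x = y then poly p x else 0)"
          unfolding poly_sum by (intro sum.cong refl) (simp add: l(2) y)
        then show "poly p y = poly (\<Sum>x\<in>X. Polynomial.smult (poly p x) (l x)) y" using X y by (simp add: sum.delta)
      next
        show "degree p < card X" using that k X by auto
        have "degree (\<Sum>x\<in>X. Polynomial.smult (poly p x) (l x)) \<le> k - 1"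
          by (rule degree_sum_le) (use X l(1) in \<open>fastforce intro: order.trans[OF degree_smult_le]\<close>)+
        then show "degree (\<Sum>x\<in>X. Polynomial.smult (poly p x) (l x)) < card X" using k X by linarith
      qed
    qed
    define m where "m = (INF \<rho>\<in>rational_space \<xi>s. N \<rho>)"
    have "N (\<lambda>x. 0) \<le> ennreal (max B 0)"
      unfolding N_def by (subst sup_norm_on_le_iff) (auto dest: f)
    then have "m \<le> ennreal (max B 0)" unfolding m_def by (intro INF_lower2[OF zero])
    then obtain m' where m': "m' \<ge> 0" "m = ennreal m'"
      by (metis ennreal_cases ennreal_neq_top neq_top_trans)
    have "\<exists>p. (p = 0 \<or> degree p < k) \<and> (\<forall>x\<in>S. \<bar>f x - poly p x / poly Q x\<bar> \<le> m' + 1 / (real n + 1))" for n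
    proof -
      have "m < ennreal (m' + 1 / (real n + 1))"
        using m' by (auto simp: ennreal_less_iff)
      then obtain \<rho> where \<rho>: "\<rho> \<in> rational_space \<xi>s" "N \<rho> < ennreal (m' + 1 / (real n + 1))"
        unfolding m_def INF_less_iff by blast
      then have "\<forall>x\<in>S. \<bar>f x - \<rho> x\<bar> \<le> m' + 1 / (real n + 1)"
        using sup_norm_on_le_iff[of "m' + 1 / (real n + 1)" S "\<lambda>x. f x - \<rho> x"] m'
        by (simp add: N_def less_imp_le)
      then show ?thesis using \<rho>(1) unfolding V by auto
    qed
    then obtain p where p: "\<And>n. p n = 0 \<or> degree (p n) < k"
      and pS: "\<And>n x. x \<in> S \<Longrightarrow> \<bar>f x - poly (p n) x / poly Q x\<bar> \<le> m' + 1 / (real n + 1)"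
      by metis
    \<comment> \<open>A bound for the numerators at the nodes; \<open>0\<close> is inserted in case there are none.\<close>
    define C where "C = Max (insert 0 ((\<lambda>x. \<bar>poly Q x\<bar>) ` X)) * (B + m' + 1)"
    have "norm (poly (p n) x) \<le> C" if x: "x \<in> X" for n x
    proof -
      have xS: "x \<in> S" using x X by auto
      have "1 / (real n + 1) \<le> 1" by simp
      then have "\<bar>poly (p n) x / poly Q x\<bar> \<le> B + m' + 1"
        using pS[OF xS, of n] f[OF xS] by linarith
      moreover have "\<bar>poly Q x\<bar> \<le> Max (insert 0 ((\<lambda>x. \<bar>poly Q x\<bar>) ` X))"
        by (rule Max_ge) (use X x in auto)
      ultimately have "\<bar>poly Q x\<bar> * \<bar>poly (p n) x / poly Q x\<bar> \<le> C"
        unfolding C_def by (intro mult_mono) auto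
      then show ?thesis using Q[OF xS] by simp
    qed
    then obtain r where r: "strict_mono (r :: nat \<Rightarrow> nat)"
      and conv: "\<And>x. x \<in> X \<Longrightarrow> \<exists>c. (\<lambda>n. poly (p (r n)) x) \<longlonglongrightarrow> c"
      using function_convergent_subsequence[of X "\<lambda>n. poly (p n)" C] countable_finite[OF X(2)] by blast
    obtain c where c: "\<And>x. x \<in> X \<Longrightarrow> (\<lambda>n. poly (p (r n)) x) \<longlonglongrightarrow> c x"
      using conv by metis
    define u where "u = (\<Sum>x\<in>X. Polynomial.smult (c x) (l x))"
    have deg: "u = 0 \<or> degree u < k"
    proof (cases "X = {}")
      case False
      then have k: "k > 0" using X by (metis card_gt_0_iff)
      have "degree u \<le> k - 1"
        unfolding u_def
        by (rule degree_sum_le) (use X l(1) in \<open>fastforce intro: order.trans[OF degree_smult_le]\<close>)+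
      then show ?thesis using k by linarith
    qed (simp add: u_def)
    have lim: "(\<lambda>n. poly (p (r n)) y) \<longlonglongrightarrow> poly u y" for y
    proof -
      have "poly (p (r n)) y = (\<Sum>x\<in>X. poly (p (r n)) x * poly (l x) y)" for n
        by (subst interp[OF p]) (simp add: poly_sum)
      moreover have "(\<lambda>n. \<Sum>x\<in>X. poly (p (r n)) x * poly (l x) y) \<longlonglongrightarrow> poly u y"
        unfolding u_def poly_sum poly_smult by (intro tendsto_intros c)
      ultimately show ?thesis by simp
    qed
    have "\<bar>f y - poly u y / poly Q y\<bar> \<le> m'" if y: "y \<in> S" for y
    proof (rule tendsto_le)
      show "(\<lambda>n. \<bar>f y - poly (p (r n)) y / poly Q y\<bar>) \<longlonglongrightarrow> \<bar>f y - poly u y / poly Q y\<bar>"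
        by (intro tendsto_intros lim Q y)
      have "(\<lambda>n. m' + 1 / (real n + 1)) \<longlonglongrightarrow> m' + 0"
        using LIMSEQ_inverse_real_of_nat by (intro tendsto_intros) (simp add: inverse_eq_divide add.commute)
      then show "(\<lambda>n. m' + 1 / (real (r n) + 1)) \<longlonglongrightarrow> m'"
        using LIMSEQ_subseq_LIMSEQ[OF _ r] by (force simp: o_def)
    qed (use pS[OF y] in auto)
    then have "N (\<lambda>x. poly u x / poly Q x) \<le> m"
      unfolding N_def m'(2) by (subst sup_norm_on_le_iff) (use m' in auto)
    moreover have "m \<le> N \<sigma>" if "\<sigma> \<in> rational_space \<xi>s" for \<sigma>
      unfolding m_def by (rule INF_lower[OF that])
    moreover have "(\<lambda>x. poly u x / poly Q x) \<in> rational_space \<xi>s" using deg V by blast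
    ultimately show ?thesis using that order.trans by blast
  qed
  then show ?thesis by (intro exI[of _ \<rho>]) (auto simp: is_arg_min_def N_def not_less)
qed

section \<open>Cancellation of poles\<close>

lemma cancel_common_roots:
  fixes p q :: "real poly"
  assumes "q \<noteq> 0"
  shows "\<exists>h p' q'. p = h * p' \<and> q = h * q' \<and> \<not> (\<exists>x. poly p' x = 0 \<and> poly q' x = 0)"
  using assms
proof (induction "degree q" arbitrary: p q rule: less_induct)
  case less
  show ?case
  proof (cases "\<exists>x. poly p x = 0 \<and> poly q x = 0")
    case False
    then show ?thesis by (intro exI[of _ 1] exI[of _ p] exI[of _ q]) simp
  next
    case True
    then obtain x where "[:- x, 1:] dvd p" "[:- x, 1:] dvd q" by (auto simp: poly_eq_0_iff_dvd)
    then obtain p1 q1 where p1: "p = [:- x, 1:] * p1" and q1: "q = [:- x, 1:] * q1" by (auto simp: dvd_def)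
    have "q1 \<noteq> 0" using less.prems q1 by auto
    then have "degree q = Suc (degree q1)" unfolding q1 by (subst degree_mult_eq) auto
    then obtain h p' q' where "p1 = h * p'" "q1 = h * q'" "\<not> (\<exists>x. poly p' x = 0 \<and> poly q' x = 0)"
      using less.hyps[of q1 p1] \<open>q1 \<noteq> 0\<close> by auto
    then show ?thesis unfolding p1 q1
      by (intro exI[of _ "[:- x, 1:] * h"] exI[of _ p'] exI[of _ q']) (simp add: mult.assoc del: mult_pCons_left)
  qed
qed

text \<open>Multiplied by the reduced denominator the estimate reads \<open>|f q' - p'| \<le> m |q'|\<close>. It extends by continuity
  to the finitely many zeros of \<open>q\<close> in the interval, where a zero of \<open>q'\<close> would also be a zero of \<open>p'\<close>. If
  the interval is a single point, the assumption that \<open>q\<close> does not vanish identically on it leaves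
  nothing to cancel.\<close>

lemma finite_error_cancels_poles:
  fixes p q :: "real poly" and f :: "real \<Rightarrow> real"
  assumes cont: "continuous_on {a..b} f" and q: "q \<noteq> 0"
    and ne: "\<exists>x\<in>{a..b}. poly q x \<noteq> 0"
    and le: "\<And>x. x \<in> {a..b} \<Longrightarrow> poly q x \<noteq> 0 \<Longrightarrow> \<bar>f x - poly p x / poly q x\<bar> \<le> m"
  shows "\<exists>h p' q'. p = h * p' \<and> q = h * q' \<and>
    (\<forall>x\<in>{a..b}. poly q' x \<noteq> 0 \<and> \<bar>f x - poly p' x / poly q' x\<bar> \<le> m)"
proof (cases "a < b")
  case False
  then have "b = a" using ne by force
  then have "poly q a \<noteq> 0" using ne by auto
  then have "\<forall>x\<in>{a..b}. poly q x \<noteq> 0 \<and> \<bar>f x - poly p x / poly q x\<bar> \<le> m"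
    using le[of a] \<open>b = a\<close> by simp
  then show ?thesis by (intro exI[of _ 1] exI[of _ p] exI[of _ q] conjI) simp_all
next
  case True
  obtain h p' q' where pq: "p = h * p'" "q = h * q'" and nc: "\<not> (\<exists>x. poly p' x = 0 \<and> poly q' x = 0)"
    using cancel_common_roots[OF q, of p] by blast
  define S where "S = {x \<in> {a..b}. poly q x \<noteq> 0}"
  have "x islimpt S" if "x \<in> {a..b}" for x
  proof -
    have fin: "finite {x. poly q x = 0}" using q by (rule poly_roots_finite)
    have "x islimpt {a..b}" using True that by simp
    then have "x islimpt ({x. poly q x = 0} \<union> S)" by (rule islimpt_subset) (auto simp: S_def)
    then show ?thesis by (simp only: islimpt_Un_finite[OF fin])
  qed
  then have "{a..b} \<subseteq> closure S" by (auto simp: closure_def)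
  moreover have "closure S \<subseteq> {a..b}" by (rule closure_minimal) (auto simp: S_def)
  ultimately have cl: "closure S = {a..b}" by auto
  have key: "\<bar>f x * poly q' x - poly p' x\<bar> \<le> m * \<bar>poly q' x\<bar>" if x: "x \<in> {a..b}" for x
  proof -
    have "0 \<le> m * \<bar>poly q' x\<bar> - \<bar>f x * poly q' x - poly p' x\<bar>"
    proof (rule continuous_ge_on_closure[of S "\<lambda>x. m * \<bar>poly q' x\<bar> - \<bar>f x * poly q' x - poly p' x\<bar>" x 0])
      show "continuous_on (closure S) (\<lambda>x. m * \<bar>poly q' x\<bar> - \<bar>f x * poly q' x - poly p' x\<bar>)"
        unfolding cl by (intro continuous_intros cont)
      show "x \<in> closure S" using x cl by simp
      fix y assume y: "y \<in> S"
      then have q0: "poly h y \<noteq> 0" "poly q' y \<noteq> 0" by (auto simp: S_def pq)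
      have "\<bar>f y - poly p' y / poly q' y\<bar> \<le> m" using le[of y] y q0 by (simp add: S_def pq)
      then have "\<bar>f y - poly p' y / poly q' y\<bar> * \<bar>poly q' y\<bar> \<le> m * \<bar>poly q' y\<bar>"
        by (rule mult_right_mono) simp
      also have "\<bar>f y - poly p' y / poly q' y\<bar> * \<bar>poly q' y\<bar> = \<bar>f y * poly q' y - poly p' y\<bar>"
        unfolding abs_mult[symmetric] using q0 by (simp add: left_diff_distrib)
      finally show "0 \<le> m * \<bar>poly q' y\<bar> - \<bar>f y * poly q' y - poly p' y\<bar>" by simp
    qed
    then show ?thesis by simp
  qed
  have "poly q' x \<noteq> 0 \<and> \<bar>f x - poly p' x / poly q' x\<bar> \<le> m" if x: "x \<in> {a..b}" for x
  proof -
    have q': "poly q' x \<noteq> 0" using key[OF x] nc by auto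
    have "\<bar>f x - poly p' x / poly q' x\<bar> * \<bar>poly q' x\<bar> = \<bar>f x * poly q' x - poly p' x\<bar>"
      unfolding abs_mult[symmetric] using q' by (simp add: left_diff_distrib)
    then have "\<bar>f x - poly p' x / poly q' x\<bar> * \<bar>poly q' x\<bar> \<le> m * \<bar>poly q' x\<bar>" using key[OF x] by simp
    then show ?thesis using q' by simp
  qed
  then show ?thesis using pq by blast
qed

lemma analytic_on_interval_continuous:
  assumes "analytic_on_interval f a b"
  shows "continuous_on {a..b} f"
proof -
  obtain g where g: "g analytic_on (complex_of_real ` {a..b})"
    and eq: "\<And>x. x \<in> {a..b} \<Longrightarrow> g (complex_of_real x) = complex_of_real (f x)"
    using assms by (auto simp: analytic_on_interval_def)
  have "continuous_on {a..b} (\<lambda>x. Re (g (complex_of_real x)))"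
    by (intro continuous_on_Re continuous_on_compose2[OF analytic_imp_holomorphic[OF g, THEN holomorphic_on_imp_continuous_on]]
        continuous_on_of_real continuous_on_id) auto
  then show ?thesis by (rule continuous_on_cong[THEN iffD1, rotated 2]) (auto simp: eq)
qed

section \<open>The pole polynomial and rational Krylov spaces\<close>

lemma poly_map_poly_Re: "poly (map_poly Re P) x = Re (poly P (complex_of_real x))"
  by (induction P) (simp_all add: map_poly_pCons)

text \<open>Taking real parts of the coefficients keeps the leading coefficient \<open>1\<close>.\<close>

lemma pole_poly_nonzero: "pole_poly \<xi>s \<noteq> 0"
  and degree_pole_poly: "degree (pole_poly \<xi>s) \<le> length \<xi>s"
proof -
  define P where "P = (\<Prod>\<xi>\<leftarrow>\<xi>s. case \<xi> of None \<Rightarrow> 1 | Some z \<Rightarrow> ([:- z, 1:] :: complex poly))"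
  have "lead_coeff P = 1 \<and> degree P \<le> length \<xi>s"
    unfolding P_def
  proof (induction \<xi>s)
    case (Cons \<xi> \<xi>s)
    then show ?case
      by (cases \<xi>) (auto simp del: mult_pCons_left simp: lead_coeff_mult intro: order.trans[OF degree_mult_le])
  qed simp
  then have P: "lead_coeff P = 1" "degree P \<le> length \<xi>s" by auto
  have "coeff (map_poly Re P) (degree P) = 1" using P by (simp add: coeff_map_poly)
  then show "pole_poly \<xi>s \<noteq> 0" unfolding pole_poly_def P_def[symmetric] by auto
  show "degree (pole_poly \<xi>s) \<le> length \<xi>s"
    unfolding pole_poly_def P_def[symmetric] using degree_map_poly_le[of Re P] P(2) by linarith
qed

text \<open>At a real point the product over a list closed under conjugation is real, so that it vanishes as soon as
  its real part does.\<close>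

lemma pole_poly_root_is_pole:
  assumes cc: "conj_closed \<xi>s" and root: "poly (pole_poly \<xi>s) x = 0"
  shows "Some (complex_of_real x) \<in> set \<xi>s"
proof -
  define F where "F \<xi> = (case \<xi> of None \<Rightarrow> 1 | Some z \<Rightarrow> complex_of_real x - z)" for \<xi>
  define P where "P = (\<Prod>\<xi>\<leftarrow>\<xi>s. case \<xi> of None \<Rightarrow> 1 | Some z \<Rightarrow> ([:- z, 1:] :: complex poly))"
  have ev: "poly P (complex_of_real x) = prod_list (map F \<xi>s)"
    unfolding P_def F_def by (induction \<xi>s) (auto split: option.splits)
  have "cnj (prod_list (map F \<xi>s)) = prod_list (map F (map (map_option cnj) \<xi>s))"
    by (induction \<xi>s) (auto simp: F_def split: option.splits)
  also have "\<dots> = prod_mset (image_mset F (mset (map (map_option cnj) \<xi>s)))"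
    by (simp only: prod_mset_prod_list[symmetric] mset_map)
  also have "\<dots> = prod_list (map F \<xi>s)"
    using cc unfolding conj_closed_def by (simp only: prod_mset_prod_list[symmetric] mset_map)
  finally have "Im (prod_list (map F \<xi>s)) = 0" by (metis Reals_cnj_iff complex_is_Real_iff)
  moreover have "Re (prod_list (map F \<xi>s)) = 0"
    using root unfolding pole_poly_def P_def[symmetric] poly_map_poly_Re ev .
  ultimately have "prod_list (map F \<xi>s) = 0" by (simp add: complex_eq_iff)
  then obtain \<xi> where "\<xi> \<in> set \<xi>s" "F \<xi> = 0" by (auto simp: prod_list_zero_iff)
  then have "\<xi> = Some (complex_of_real x)" by (auto simp: F_def split: option.splits)
  then show ?thesis using \<open>\<xi> \<in> set \<xi>s\<close> by simp
qed

lemma pole_poly_nonzero_at_eigenvalue: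
  assumes "conj_closed \<xi>s" "no_pole_eigenvalue \<xi>s M" "M \<in> carrier_mat n n" "eigenvalue M x"
  shows "poly (pole_poly \<xi>s) x \<noteq> 0"
  using pole_poly_root_is_pole[OF assms(1), of x] assms(2) of_real_hom.eigenvalue_hom[OF assms(3,4)]
  by (auto simp: no_pole_eigenvalue_def)

lemma the_mat_inverse:
  fixes A B :: "real mat"
  assumes A: "A \<in> carrier_mat n n" and B: "B \<in> carrier_mat n n" and AB: "A * B = 1\<^sub>m n" and BA: "B * A = 1\<^sub>m n"
  shows "the (mat_inverse A) = B"
proof (cases "mat_inverse A")
  case None
  from mat_inverse(1)[OF A None, where b = "()"] have "A \<notin> Units (ring_mat TYPE(real) n ())" .
  then show ?thesis using A B AB BA by (auto simp: Units_def ring_mat_simps)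
next
  case (Some C)
  from mat_inverse(2)[OF A Some] have C: "A * C = 1\<^sub>m n" "C * A = 1\<^sub>m n" "C \<in> carrier_mat n n" by auto
  have "C = C * (A * B)" using AB C by simp
  also have "\<dots> = (C * A) * B" by (rule assoc_mult_mat[symmetric]) (use A B C in auto)
  also have "\<dots> = B" using C B by simp
  finally show ?thesis using Some by simp
qed

text \<open>The vectors fixed by the projection \<open>W W\<^sup>T\<close> form a subspace that contains the columns of \<open>W\<close>.\<close>

lemma in_range_of_span:
  assumes W: "W \<in> carrier_mat n w" and o: "transpose_mat W * W = 1\<^sub>m w"
    and x: "x \<in> LinearCombinations.module.span class_ring (module_vec TYPE(real) n) (set (cols W))"
  shows "x \<in> carrier_vec n" "(W * transpose_mat W) *\<^sub>v x = x"
proof -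
  interpret vec_space "TYPE(real)" n .
  let ?P = "W * transpose_mat W"
  have P: "?P \<in> carrier_mat n n" using W by simp
  let ?N = "{x \<in> carrier_vec n. ?P *\<^sub>v x = x}"
  have sub: "submodule class_ring ?N V"
  proof (intro submodule.intro module_axioms)
    fix v u assume "v \<in> ?N" "u \<in> ?N"
    then show "v \<oplus>\<^bsub>V\<^esub> u \<in> ?N" by (simp add: mult_add_distrib_mat_vec[OF P])
  next
    fix c :: real and v assume "v \<in> ?N"
    then show "c \<odot>\<^bsub>V\<^esub> v \<in> ?N" by (simp add: mult_mat_vec[OF P])
  next
    have "Y *\<^sub>v 0\<^sub>v n = 0\<^sub>v n" if "Y \<in> carrier_mat n n" for Y :: "real mat"
      using that by (intro eq_vecI) auto
    from this[OF P] have "?P *\<^sub>v 0\<^sub>v n = 0\<^sub>v n" .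
    then show "\<zero>\<^bsub>V\<^esub> \<in> ?N" by simp
  qed (simp add: subset_eq)
  have "set (cols W) \<subseteq> ?N"
  proof
    fix y assume "y \<in> set (cols W)"
    then obtain j where j: "j < w" "y = col W j" using W by (auto simp: cols_def)
    have "?P *\<^sub>v col W j = col (?P * W) j" using col_mult2[OF P W j(1)] by simp
    also have "?P * W = W" using W o by (simp add: assoc_mult_mat[of W n w _ n _ w])
    finally show "y \<in> ?N" using j W by auto
  qed
  from span_is_subset[OF this sub] x show "x \<in> carrier_vec n" "?P *\<^sub>v x = x" by auto
qed

text \<open>The coefficients \<open>G j\<close> of an element of the rational Krylov space are matrices; multiples of the identity
  suffice to obtain all \<open>p(M) q(M)\<inverse> B\<close>.\<close>

lemma krylov_basis_contains:
  assumes M: "symm n M" and B: "B \<in> carrier_mat n s" and cc: "conj_closed \<xi>s"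
    and np: "no_pole_eigenvalue \<xi>s M" and kb: "krylov_basis M B \<xi>s W" and deg: "degree p < length \<xi>s"
  shows "W * (transpose_mat W * (rat_fun p (pole_poly \<xi>s) M * B)) = rat_fun p (pole_poly \<xi>s) M * B"
proof -
  define q where "q = pole_poly \<xi>s"
  define w where "w = dim_col W"
  define X where "X = rat_fun p q M * B"
  note [simp] = symmD(2,3)[OF M] carrier_matD[OF B] rat_fun_dim[OF M] mat_fun_dim[OF M]
  have X: "X \<in> carrier_mat n s" by (rule carrier_matI) (auto simp: X_def)
  have W: "W \<in> carrier_mat n w" and o: "transpose_mat W * W = 1\<^sub>m w"
    using kb by (auto simp: krylov_basis_def orthonormal_cols_def w_def)
  have q0: "poly q x \<noteq> 0" if "eigenvalue M x" for x
    unfolding q_def by (rule pole_poly_nonzero_at_eigenvalue[OF cc np symmD(1)[OF M] that])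
  have inv: "the (mat_inverse (poly_at_mat q M)) = mat_fun (\<lambda>x. 1 / poly q x) M"
    unfolding poly_at_mat_eq_mat_fun[OF M]
  proof (rule the_mat_inverse)
    have "mat_fun (\<lambda>x. poly q x * (1 / poly q x)) M = mat_fun (\<lambda>x. 1) M"
      "mat_fun (\<lambda>x. 1 / poly q x * poly q x) M = mat_fun (\<lambda>x. 1) M"
      by (rule mat_fun_cong[OF M]; simp add: q0)+
    then show "mat_fun (poly q) M * mat_fun (\<lambda>x. 1 / poly q x) M = 1\<^sub>m n"
      "mat_fun (\<lambda>x. 1 / poly q x) M * mat_fun (poly q) M = 1\<^sub>m n"
      unfolding mat_fun_mult[OF M] by (simp_all add: mat_fun_one[OF M])
  qed (rule symmD(1)[OF mat_fun_symm[OF M]])+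
  define G where "G j = coeff p j \<cdot>\<^sub>m 1\<^sub>m s" for j
  have "mat_sum n s (\<lambda>j. (M ^\<^sub>m j) * B * G j) {..<length \<xi>s} = poly_at_mat p M * B"
  proof (rule eq_matI)
    have pd: "dim_row (poly_at_mat p M) = n" "dim_col (poly_at_mat p M) = n"
      by (auto simp: poly_at_mat_def mat_sum_def)
    fix i j assume "i < dim_row (poly_at_mat p M * B)" "j < dim_col (poly_at_mat p M * B)"
    then have ij: "i < n" "j < s" by (auto simp: pd)
    have Mp: "M ^\<^sub>m t \<in> carrier_mat n n" for t using symmD(1)[OF M] by simp
    note [simp] = carrier_matD[OF Mp]
    have coef: "(\<Sum>t\<le>degree p. coeff p t * (M ^\<^sub>m t) $$ (i, c)) = (\<Sum>t<length \<xi>s. coeff p t * (M ^\<^sub>m t) $$ (i, c))" for c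
      by (rule sum.mono_neutral_left) (use deg in \<open>auto simp: coeff_eq_0 not_le\<close>)
    have "(poly_at_mat p M * B) $$ (i, j) = (\<Sum>c<n. (\<Sum>t<length \<xi>s. coeff p t * (M ^\<^sub>m t) $$ (i, c)) * B $$ (c, j))"
      using ij by (subst mult_index) (simp_all add: pd, simp add: poly_at_mat_def mat_sum_def coef)
    also have "\<dots> = (\<Sum>t<length \<xi>s. \<Sum>c<n. coeff p t * ((M ^\<^sub>m t) $$ (i, c) * B $$ (c, j)))"
      unfolding sum_distrib_right by (subst sum.swap) (simp add: mult.assoc)
    also have "\<dots> = (\<Sum>t<length \<xi>s. ((M ^\<^sub>m t) * B * G t) $$ (i, j))"
    proof (rule sum.cong[OF refl])
      fix t
      have "(M ^\<^sub>m t) * B * G t = coeff p t \<cdot>\<^sub>m ((M ^\<^sub>m t) * B)"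
        unfolding G_def by (subst smult_mult_dim) auto
      then show "(\<Sum>c<n. coeff p t * ((M ^\<^sub>m t) $$ (i, c) * B $$ (c, j))) = ((M ^\<^sub>m t) * B * G t) $$ (i, j)"
        using ij by (simp add: mult_index sum_distrib_left del: index_mult_mat(1))
    qed
    finally show "mat_sum n s (\<lambda>j. (M ^\<^sub>m j) * B * G j) {..<length \<xi>s} $$ (i, j) = (poly_at_mat p M * B) $$ (i, j)"
      using ij by (simp add: mat_sum_def)
  qed (simp_all add: mat_sum_def poly_at_mat_def)
  then have "the (mat_inverse (poly_at_mat q M)) * mat_sum n s (\<lambda>j. (M ^\<^sub>m j) * B * G j) {..<length \<xi>s}
    = mat_fun (\<lambda>x. 1 / poly q x) M * mat_fun (poly p) M * B"
    unfolding inv by (simp add: poly_at_mat_eq_mat_fun[OF M] mult_assoc_dim)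
  also have "\<dots> = X" unfolding mat_fun_mult[OF M] X_def rat_fun_def by simp
  finally have "X \<in> rational_krylov M B \<xi>s"
    unfolding rational_krylov_def q_def[symmetric]
    by (intro CollectI exI[of _ G]) (auto simp: G_def)
  moreover have "(\<Union>X \<in> rational_krylov M B \<xi>s. set (cols X)) \<subseteq> carrier_vec n"
  proof -
    have "dim_row Y = n" if "Y \<in> rational_krylov M B \<xi>s" for Y
      using that unfolding rational_krylov_def q_def[symmetric] inv by auto
    then show ?thesis by (fastforce simp: cols_def)
  qed
  ultimately have "set (cols X) \<subseteq> LinearCombinations.module.span class_ring (module_vec TYPE(real) n) (set (cols W))"
  proof -
    assume X: "X \<in> rational_krylov M B \<xi>s"
      and c: "(\<Union>X \<in> rational_krylov M B \<xi>s. set (cols X)) \<subseteq> carrier_vec n"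
    interpret vec_space "TYPE(real)" n .
    have "set (cols X) \<subseteq> span (\<Union>X \<in> rational_krylov M B \<xi>s. set (cols X))"
      using in_own_span[OF c] X by blast
    then show ?thesis using kb by (simp add: krylov_basis_def)
  qed
  then have cols: "(W * transpose_mat W) *\<^sub>v col X j = col X j" if "j < s" for j
    using that X by (intro in_range_of_span(2)[OF W o]) (erule subsetD, auto simp: cols_def)
  have "W * transpose_mat W * X = X"
  proof (rule eq_matI)
    fix i j assume "i < dim_row X" "j < dim_col X"
    then have ij: "i < n" "j < s" using X by auto
    have "(W * transpose_mat W * X) $$ (i, j) = col (W * transpose_mat W * X) j $ i" using ij W X by simp
    also have "col (W * transpose_mat W * X) j = (W * transpose_mat W) *\<^sub>v col X j"
      by (rule col_mult2[of _ n n _ s]) (use W X ij in auto)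
    finally show "(W * transpose_mat W * X) $$ (i, j) = X $$ (i, j)" using cols[OF ij(2)] ij X by simp
  qed (use W X in auto)
  then show ?thesis using W X by (simp add: mult_assoc_dim X_def q_def)
qed

section \<open>Block diagonal matrices\<close>

text \<open>Blocks indexed by an initial segment of the natural numbers admit induction from the right, where the last
  block is split off by a direct sum.\<close>

definition block_diag :: "(nat \<Rightarrow> real mat) \<Rightarrow> nat \<Rightarrow> real mat" where
  "block_diag X m = diag_block_mat (map X [0..<m])"

definition diag_pair :: "real mat \<Rightarrow> real mat \<Rightarrow> real mat" where
  "diag_pair A B = four_block_mat A (0\<^sub>m (dim_row A) (dim_col B)) (0\<^sub>m (dim_row B) (dim_col A)) B"

lemma level_mat_block_diag: "level_mat X l = block_diag (\<lambda>i. X (l, i)) (2 ^ l)"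
  by (simp add: level_mat_def block_diag_def)

lemma block_diag_0: "block_diag X 0 = 0\<^sub>m 0 0"
  by (simp add: block_diag_def)

lemma block_diag_Suc: "block_diag X (Suc m) = diag_pair (block_diag X m) (X m)"
  by (simp add: block_diag_def diag_block_mat_last Let_def diag_pair_def)

lemma block_diag_1: "block_diag X (Suc 0) = X 0"
  unfolding block_diag_def by (simp only: upt_rec[of 0 "Suc 0"] upt_rec[of "Suc 0" "Suc 0"], simp del: diag_block_mat.simps)

lemma dim_diag_pair [simp]:
  "dim_row (diag_pair A B) = dim_row A + dim_row B" "dim_col (diag_pair A B) = dim_col A + dim_col B"
  by (auto simp: diag_pair_def)

lemma dim_block_diag:
  "dim_row (block_diag X m) = (\<Sum>i<m. dim_row (X i))" "dim_col (block_diag X m) = (\<Sum>i<m. dim_col (X i))"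
  by (induction m) (auto simp: block_diag_0 block_diag_Suc)

lemma block_diag_cong: "(\<And>i. i < m \<Longrightarrow> X i = Y i) \<Longrightarrow> block_diag X m = block_diag Y m"
  unfolding block_diag_def by (intro arg_cong[of _ _ diag_block_mat] map_cong) auto

lemma diag_pair_index:
  "i < dim_row A + dim_row B \<Longrightarrow> j < dim_col A + dim_col B \<Longrightarrow> diag_pair A B $$ (i, j) =
    (if i < dim_row A then if j < dim_col A then A $$ (i, j) else 0
     else if j < dim_col A then 0 else B $$ (i - dim_row A, j - dim_col A))"
  by (auto simp: diag_pair_def)

lemma diag_pair_mult:
  assumes "dim_col A = dim_row A'" "dim_col B = dim_row B'"
  shows "diag_pair A B * diag_pair A' B' = diag_pair (A * A') (B * B')"
proof -
  have "diag_pair A B * diag_pair A' B' = four_block_mat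
      (A * A' + 0\<^sub>m (dim_row A) (dim_col B) * 0\<^sub>m (dim_row B') (dim_col A'))
      (A * 0\<^sub>m (dim_row A') (dim_col B') + 0\<^sub>m (dim_row A) (dim_col B) * B')
      (0\<^sub>m (dim_row B) (dim_col A) * A' + B * 0\<^sub>m (dim_row B') (dim_col A'))
      (0\<^sub>m (dim_row B) (dim_col A) * 0\<^sub>m (dim_row A') (dim_col B') + B * B')"
    unfolding diag_pair_def
    by (rule mult_four_block_mat[of _ "dim_row A" "dim_col A" _ "dim_col B" _ "dim_row B" _ _ "dim_col A'" _ "dim_col B'"])
      (use assms in \<open>auto intro!: carrier_matI\<close>)
  also have "\<dots> = diag_pair (A * A') (B * B')"
    unfolding diag_pair_def by (rule cong_four_block_mat; intro eq_matI; use assms in auto)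
  finally show ?thesis .
qed

lemma diag_pair_transpose: "transpose_mat (diag_pair A B) = diag_pair (transpose_mat A) (transpose_mat B)"
  by (rule eq_matI) (auto simp: diag_pair_index)

lemma diag_pair_add:
  assumes "dim_row A = dim_row A'" "dim_row B = dim_row B'" "dim_col A = dim_col A'" "dim_col B = dim_col B'"
  shows "diag_pair A B + diag_pair A' B' = diag_pair (A + A') (B + B')"
  by (rule eq_matI) (use assms in \<open>auto simp: diag_pair_index\<close>)

lemma diag_pair_minus:
  assumes "dim_row A = dim_row A'" "dim_row B = dim_row B'" "dim_col A = dim_col A'" "dim_col B = dim_col B'"
  shows "diag_pair A B - diag_pair A' B' = diag_pair (A - A') (B - B')"
  by (rule eq_matI) (use assms in \<open>auto simp: diag_pair_index\<close>)

lemma diag_pair_one: "diag_pair (1\<^sub>m a) (1\<^sub>m b) = 1\<^sub>m (a + b)"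
  by (simp add: diag_pair_def)

lemma diag_pair_symm: "symm a A \<Longrightarrow> symm b B \<Longrightarrow> symm (a + b) (diag_pair A B)"
  by (auto simp: symm_def diag_pair_transpose intro!: carrier_matI)

lemma diag_pair_eigendecomp:
  assumes A: "eigendecomp a A V d" and B: "eigendecomp b B W e"
  shows "eigendecomp (a + b) (diag_pair A B) (diag_pair V W) (\<lambda>i. if i < a then d i else e (i - a))"
proof -
  note [simp] = eigendecompD(2-5)[OF A] eigendecompD(2-5)[OF B]
  have diag: "mat_diag (a + b) (\<lambda>i. if i < a then d i else e (i - a)) = diag_pair (mat_diag a d) (mat_diag b e)"
    by (rule eq_matI) (auto simp: diag_pair_index mat_diag_def)
  show ?thesis
    unfolding eigendecomp_def diag eigendecompD(6)[OF A] eigendecompD(6)[OF B]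
    by (auto simp: diag_pair_transpose diag_pair_mult diag_pair_one intro!: carrier_matI)
qed

lemma diag_pair_mat_fun:
  assumes A: "symm a A" and B: "symm b B"
  shows "mat_fun f (diag_pair A B) = diag_pair (mat_fun f A) (mat_fun f B)"
proof -
  obtain V d where V: "eigendecomp a A V d" using eigendecomp_exists[OF A] .
  obtain W e where W: "eigendecomp b B W e" using eigendecomp_exists[OF B] .
  note [simp] = eigendecompD(2-5)[OF V] eigendecompD(2-5)[OF W]
  have "mat_diag (a + b) (\<lambda>i. f (if i < a then d i else e (i - a)))
    = diag_pair (mat_diag a (\<lambda>i. f (d i))) (mat_diag b (\<lambda>i. f (e i)))"
    by (rule eq_matI) (auto simp: diag_pair_index mat_diag_def)
  then show ?thesis
    unfolding mat_fun_eigendecomp[OF diag_pair_eigendecomp[OF V W]]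
      mat_fun_eigendecomp[OF V] mat_fun_eigendecomp[OF W]
    by (simp add: diag_pair_transpose diag_pair_mult)
qed

lemma diag_pair_eigenvalue:
  assumes A: "A \<in> carrier_mat a a" and B: "B \<in> carrier_mat b b" and ev: "eigenvalue (diag_pair A B) x"
  shows "eigenvalue A x \<or> eigenvalue B x"
proof -
  obtain v where v: "v \<in> carrier_vec (a + b)" "v \<noteq> 0\<^sub>v (a + b)" and ev: "diag_pair A B *\<^sub>v v = x \<cdot>\<^sub>v v"
    using ev A B by (auto simp: eigenvalue_def eigenvector_def)
  define u where "u = vec_first v a"
  define w where "w = vec_last v b"
  have uw: "u \<in> carrier_vec a" "w \<in> carrier_vec b" by (auto simp: u_def w_def)
  have vuw: "v = u @\<^sub>v w" unfolding u_def w_def using v(1) by (simp add: vec_first_last_append)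
  have "diag_pair A B *\<^sub>v v = (A *\<^sub>v u) @\<^sub>v (B *\<^sub>v w)"
    unfolding diag_pair_def vuw using A B uw
    by (subst four_block_mat_mult_vec[of _ a a _ b _ b]) auto
  moreover have "x \<cdot>\<^sub>v v = (x \<cdot>\<^sub>v u) @\<^sub>v (x \<cdot>\<^sub>v w)"
    unfolding vuw using uw by (intro eq_vecI) auto
  ultimately have "(A *\<^sub>v u) @\<^sub>v (B *\<^sub>v w) = (x \<cdot>\<^sub>v u) @\<^sub>v (x \<cdot>\<^sub>v w)" using ev by simp
  then have e: "A *\<^sub>v u = x \<cdot>\<^sub>v u" "B *\<^sub>v w = x \<cdot>\<^sub>v w"
    using A uw by (auto simp: append_vec_eq[of _ a])
  have "u \<noteq> 0\<^sub>v a \<or> w \<noteq> 0\<^sub>v b"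
    using v(2) unfolding vuw by (auto intro!: eq_vecI)
  then show ?thesis using e uw A B unfolding eigenvalue_def eigenvector_def by auto
qed

lemma block_diag_mult:
  "(\<And>i. i < m \<Longrightarrow> dim_col (X i) = dim_row (Y i)) \<Longrightarrow>
    block_diag X m * block_diag Y m = block_diag (\<lambda>i. X i * Y i) m"
  by (induction m) (auto simp: block_diag_0 block_diag_Suc diag_pair_mult dim_block_diag)

lemma block_diag_transpose: "transpose_mat (block_diag X m) = block_diag (\<lambda>i. transpose_mat (X i)) m"
  by (induction m) (auto simp: block_diag_0 block_diag_Suc diag_pair_transpose)

lemma block_diag_add:
  "(\<And>i. i < m \<Longrightarrow> dim_row (X i) = dim_row (Y i)) \<Longrightarrow> (\<And>i. i < m \<Longrightarrow> dim_col (X i) = dim_col (Y i)) \<Longrightarrow>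
    block_diag X m + block_diag Y m = block_diag (\<lambda>i. X i + Y i) m"
  by (induction m) (auto simp: block_diag_0 block_diag_Suc diag_pair_add dim_block_diag)

lemma block_diag_minus:
  "(\<And>i. i < m \<Longrightarrow> dim_row (X i) = dim_row (Y i)) \<Longrightarrow> (\<And>i. i < m \<Longrightarrow> dim_col (X i) = dim_col (Y i)) \<Longrightarrow>
    block_diag X m - block_diag Y m = block_diag (\<lambda>i. X i - Y i) m"
  by (induction m) (auto simp: block_diag_0 block_diag_Suc diag_pair_minus dim_block_diag)

lemma block_diag_one: "block_diag (\<lambda>i. 1\<^sub>m (s i)) m = 1\<^sub>m (\<Sum>i<m. s i)"
  by (induction m) (auto simp: block_diag_0 block_diag_Suc diag_pair_one)

lemma block_diag_symm: "(\<And>i. i < m \<Longrightarrow> symm (s i) (X i)) \<Longrightarrow> symm (\<Sum>i<m. s i) (block_diag X m)"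
proof (induction m)
  case 0
  show ?case by (auto simp: symm_def block_diag_0)
qed (auto simp: block_diag_Suc intro!: diag_pair_symm)

lemma block_diag_mat_fun:
  "(\<And>i. i < m \<Longrightarrow> symm (s i) (X i)) \<Longrightarrow> mat_fun f (block_diag X m) = block_diag (\<lambda>i. mat_fun f (X i)) m"
proof (induction m)
  case 0
  have "symm 0 (0\<^sub>m 0 0)" by (auto simp: symm_def)
  from mat_fun_dim[OF this, of f] show ?case unfolding block_diag_0 by (intro eq_matI) auto
next
  case (Suc m)
  have "symm (\<Sum>i<m. s i) (block_diag X m)" by (rule block_diag_symm) (use Suc.prems in auto)
  then show ?case
    unfolding block_diag_Suc by (subst diag_pair_mat_fun) (use Suc in auto)
qed

lemma block_diag_eigenvalue:
  "(\<And>i. i < m \<Longrightarrow> symm (s i) (X i)) \<Longrightarrow> eigenvalue (block_diag X m) x \<Longrightarrow> \<exists>i<m. eigenvalue (X i) x"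
proof (induction m)
  case 0
  then show ?case using eigenvalue_imp_nonzero_dim[of "block_diag X 0" 0 x] by (auto simp: block_diag_0)
next
  case (Suc m)
  have "symm (\<Sum>i<m. s i) (block_diag X m)" by (rule block_diag_symm) (use Suc.prems in auto)
  then show ?case
    using diag_pair_eigenvalue[OF symmD(1) symmD(1), of "\<Sum>i<m. s i" "block_diag X m" "s m" "X m" x] Suc
    unfolding block_diag_Suc by (metis less_Suc_eq)
qed

text \<open>One level of the tree seen from the level above: siblings are neighbours.\<close>

lemma block_diag_double:
  "block_diag X (2 * m) = block_diag (\<lambda>i. blkdiag (X (2 * i)) (X (2 * i + 1))) m"
proof (induction m)
  case (Suc m)
  have "map X [0..<2 * Suc m] = map X [0..<2 * m] @ [X (2 * m), X (2 * m + 1)]" by simp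
  then have "block_diag X (2 * Suc m) = diag_pair (block_diag X (2 * m)) (blkdiag (X (2 * m)) (X (2 * m + 1)))"
    by (simp only: block_diag_def diag_block_mat_append Let_def diag_pair_def)
  then show ?case unfolding block_diag_Suc Suc .
qed (simp add: block_diag_0)

section \<open>Diagonal blocks\<close>

text \<open>The position at which block \<open>i\<close> starts when the blocks have sizes \<open>s 0, s 1, \<dots>\<close>.\<close>

definition off :: "(nat \<Rightarrow> nat) \<Rightarrow> nat \<Rightarrow> nat" where
  "off s i = (\<Sum>j<i. s j)"

lemma dim_block_diag_off:
  assumes "\<And>i. i < m \<Longrightarrow> X i \<in> carrier_mat (r i) (c i)"
  shows "dim_row (block_diag X m) = off r m" "dim_col (block_diag X m) = off c m"
  unfolding dim_block_diag off_def using carrier_matD[OF assms] by (auto intro!: sum.cong)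

text \<open>Multiplication by the columns of the identity that belong to block \<open>i\<close> selects the \<open>i\<close>-th
  diagonal block, so that statements about diagonal blocks become matrix identities.\<close>

definition selector :: "(nat \<Rightarrow> nat) \<Rightarrow> nat \<Rightarrow> nat \<Rightarrow> real mat" where
  "selector s m i = Matrix.mat (off s m) (s i) (\<lambda>(a, b). if a = off s i + b then 1 else 0)"

lemma off_less:
  assumes "i < m" "b < s i"
  shows "off s i + b < off s m"
proof -
  have "off s i + b < off s (Suc i)" using assms by (simp add: off_def)
  also have "\<dots> \<le> off s m" unfolding off_def by (rule sum_mono2) (use assms in auto)
  finally show ?thesis .
qed

lemma off_mono: "i \<le> m \<Longrightarrow> off s i \<le> off s m"
  unfolding off_def by (rule sum_mono2) auto

lemma dim_selector [simp]: "dim_row (selector s m i) = off s m" "dim_col (selector s m i) = s i"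
  by (auto simp: selector_def)

lemma mult_selector:
  assumes "dim_col M = off s m" "i < m" "a < dim_row M" "b < s i"
  shows "(M * selector s m i) $$ (a, b) = M $$ (a, off s i + b)"
proof -
  have "(M * selector s m i) $$ (a, b) = (\<Sum>k<off s m. M $$ (a, k) * (if k = off s i + b then 1 else 0))"
    using assms by (subst mult_index) (auto simp: selector_def)
  also have "\<dots> = M $$ (a, off s i + b)"
    using off_less[OF assms(2), of b s] assms(4) by (simp add: if_distrib[of "\<lambda>x. _ * x"] sum.delta cong: if_cong)
  finally show ?thesis .
qed

lemma selector_mult:
  assumes "dim_row M = off s m" "i < m" "a < s i" "b < dim_col M"
  shows "(transpose_mat (selector s m i) * M) $$ (a, b) = M $$ (off s i + a, b)"
proof -
  have "(transpose_mat (selector s m i) * M) $$ (a, b) = (\<Sum>k<off s m. (if k = off s i + a then 1 else 0) * M $$ (k, b))"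
    using assms by (subst mult_index) (auto simp: selector_def)
  also have "\<dots> = M $$ (off s i + a, b)"
    using off_less[OF assms(2), of a s] assms(3) by (simp add: if_distrib[of "\<lambda>x. x * _"] sum.delta cong: if_cong)
  finally show ?thesis .
qed

lemma selector_orthonormal:
  assumes "i < m"
  shows "transpose_mat (selector s m i) * selector s m i = 1\<^sub>m (s i)"
  by (rule eq_matI)
     (use assms in \<open>auto simp: selector_mult off_less simp del: index_mult_mat(1), auto simp: selector_def off_less\<close>)

lemma block_diag_column:
  assumes "\<And>i. i < m \<Longrightarrow> X i \<in> carrier_mat (r i) (c i)" and "i < m" "a < off r m" "b < c i"
  shows "block_diag X m $$ (a, off c i + b)
    = (if off r i \<le> a \<and> a < off r i + r i then X i $$ (a - off r i, b) else 0)"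
  using assms
proof (induction m)
  case (Suc m)
  have dims: "dim_row (block_diag X m) = off r m" "dim_col (block_diag X m) = off c m"
    using dim_block_diag_off[of m X r c] Suc.prems(1) by auto
  have Xm: "dim_row (X m) = r m" "dim_col (X m) = c m" using Suc.prems(1)[of m] by auto
  have a: "a < off r m + r m" using Suc.prems(3) by (simp add: off_def)
  have offi: "off c i + b < off c m + c m" using off_less[of i "Suc m" b c] Suc.prems by (simp add: off_def)
  show ?case
  proof (cases "i = m")
    case True
    then show ?thesis using a offi Xm dims Suc.prems(4) unfolding block_diag_Suc
      by (subst diag_pair_index) auto
  next
    case False
    then have i: "i < m" using Suc.prems(2) by simp
    have lt: "off c i + b < off c m" using off_less[of i m b c] i Suc.prems(4) by simp
    have up: "off r i + r i \<le> off r m" using off_mono[of "Suc i" m r] i by (simp add: off_def)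
    show ?thesis
    proof (cases "a < off r m")
      case True
      then show ?thesis using Suc.IH[OF _ i True Suc.prems(4)] Suc.prems(1) lt a offi Xm dims
        unfolding block_diag_Suc by (subst diag_pair_index) auto
    next
      case False
      then show ?thesis using lt a offi Xm dims up unfolding block_diag_Suc by (subst diag_pair_index) auto
    qed
  qed
qed simp

lemma block_diag_selector:
  assumes X: "\<And>i. i < m \<Longrightarrow> X i \<in> carrier_mat (r i) (c i)" and i: "i < m"
  shows "block_diag X m * selector c m i = selector r m i * X i"
proof (rule eq_matI)
  have dims: "dim_row (block_diag X m) = off r m" "dim_col (block_diag X m) = off c m"
    by (rule dim_block_diag_off[OF X]; assumption)+
  note [simp] = carrier_matD[OF X[OF i]]
  show "dim_row (block_diag X m * selector c m i) = dim_row (selector r m i * X i)"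
    "dim_col (block_diag X m * selector c m i) = dim_col (selector r m i * X i)"
    using dims by auto
  fix a b assume "a < dim_row (selector r m i * X i)" "b < dim_col (selector r m i * X i)"
  then have ab: "a < off r m" "b < c i" by auto
  have "(selector r m i * X i) $$ (a, b) = (\<Sum>k<r i. if a = off r i + k then X i $$ (k, b) else 0)"
    using ab by (subst mult_index) (auto simp: selector_def intro!: sum.cong)
  also have "\<dots> = (if off r i \<le> a \<and> a < off r i + r i then X i $$ (a - off r i, b) else 0)"
  proof (cases "off r i \<le> a \<and> a < off r i + r i")
    case True
    then have "(\<Sum>k<r i. if a = off r i + k then X i $$ (k, b) else 0) = (\<Sum>k<r i. if k = a - off r i then X i $$ (k, b) else 0)"
      by (intro sum.cong) auto
    also have "\<dots> = X i $$ (a - off r i, b)" using True by (simp add: sum.delta less_diff_conv2 add.commute)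
    finally show ?thesis using True by simp
  next
    case False
    then show ?thesis by (subst if_not_P, simp) (intro sum.neutral, auto)
  qed
  also have "\<dots> = (block_diag X m * selector c m i) $$ (a, b)"
    using ab dims i by (simp add: mult_selector block_diag_column[OF X i ab] del: index_mult_mat(1))
  finally show "(block_diag X m * selector c m i) $$ (a, b) = (selector r m i * X i) $$ (a, b)" by simp
qed

definition diag_block :: "(nat \<Rightarrow> nat) \<Rightarrow> nat \<Rightarrow> nat \<Rightarrow> real mat \<Rightarrow> real mat" where
  "diag_block s m i M = transpose_mat (selector s m i) * M * selector s m i"

lemma selector_transpose_block_diag:
  assumes X: "\<And>i. i < m \<Longrightarrow> X i \<in> carrier_mat (r i) (c i)" and i: "i < m"
  shows "transpose_mat (selector r m i) * block_diag X m = X i * transpose_mat (selector c m i)"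
proof -
  have "block_diag (\<lambda>i. transpose_mat (X i)) m * selector r m i = selector c m i * transpose_mat (X i)"
    by (rule block_diag_selector[OF _ i]) (use X in auto)
  then have "transpose_mat (transpose_mat (block_diag X m) * selector r m i)
      = transpose_mat (selector c m i * transpose_mat (X i))"
    by (simp only: block_diag_transpose)
  then show ?thesis
    using carrier_matD[OF X[OF i]] dim_block_diag_off[of m X r c, OF X] by (simp add: transpose_mult_dim)
qed

text \<open>A selector passes through a block diagonal matrix at the cost of the selected block, whose row and column
  sizes may differ.\<close>

lemma diag_block_congruence:
  assumes X: "\<And>i. i < m \<Longrightarrow> X i \<in> carrier_mat (r i) (c i)" and i: "i < m"
    and M: "M \<in> carrier_mat (off c m) (off c m)"
  shows "diag_block r m i (block_diag X m * M * transpose_mat (block_diag X m))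
    = X i * diag_block c m i M * transpose_mat (X i)"
proof -
  have dims: "dim_row (block_diag X m) = off r m" "dim_col (block_diag X m) = off c m"
    by (rule dim_block_diag_off[OF X]; assumption)+
  note [simp] = carrier_matD[OF X[OF i]] carrier_matD[OF M] dims
  have left: "transpose_mat (selector r m i) * block_diag X m = X i * transpose_mat (selector c m i)"
    by (rule selector_transpose_block_diag[of m X r c i]) (simp_all add: X i)
  have right: "transpose_mat (block_diag X m) * selector r m i = selector c m i * transpose_mat (X i)"
    using arg_cong[where f = transpose_mat, OF left] by (simp add: transpose_mult_dim)
  have "diag_block r m i (block_diag X m * M * transpose_mat (block_diag X m))
    = (transpose_mat (selector r m i) * block_diag X m) * M * (transpose_mat (block_diag X m) * selector r m i)"
    unfolding diag_block_def by (simp add: mult_assoc_dim)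
  also have "\<dots> = X i * diag_block c m i M * transpose_mat (X i)"
    unfolding left right diag_block_def by (simp add: mult_assoc_dim)
  finally show ?thesis .
qed

lemma diag_block_block_diag:
  assumes X: "\<And>i. i < m \<Longrightarrow> X i \<in> carrier_mat (r i) (r i)" and i: "i < m"
  shows "diag_block r m i (block_diag X m) = X i"
proof -
  have "transpose_mat (selector r m i) * block_diag X m = X i * transpose_mat (selector r m i)"
    by (rule selector_transpose_block_diag[of m X r r i]) (simp_all add: X i)
  then show ?thesis
    using carrier_matD[OF X[OF i]] by (simp add: diag_block_def mult_assoc_dim selector_orthonormal[OF i])
qed

lemma diag_block_add:
  assumes "M \<in> carrier_mat (off s m) (off s m)" "N \<in> carrier_mat (off s m) (off s m)"
  shows "diag_block s m i (M + N) = diag_block s m i M + diag_block s m i N"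
  using assms by (simp add: diag_block_def mat_dim_simps)

lemma pick_interval:
  assumes "a < s"
  shows "pick {o'..<o' + s} a = o' + a"
proof -
  have "{x \<in> {o'..<o' + s}. x < o' + a} = {o'..<o' + a}" using assms by auto
  then show ?thesis using pick_card_in_set[of "o' + a" "{o'..<o' + s}"] assms by simp
qed

lemma submatrix_eq_diag_block:
  assumes M: "M \<in> carrier_mat (off s m) (off s m)" and i: "i < m"
  shows "submatrix M {off s i..<off s i + s i} {off s i..<off s i + s i} = diag_block s m i M"
proof -
  have le: "off s i + s i \<le> off s m" using off_mono[of "Suc i" m s] i by (simp add: off_def)
  have set: "{k. k < off s m \<and> k \<in> {off s i..<off s i + s i}} = {off s i..<off s i + s i}" using le by auto
  note [simp] = carrier_matD[OF M]
  show ?thesis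
  proof (rule eq_matI)
    fix a b assume "a < dim_row (diag_block s m i M)" "b < dim_col (diag_block s m i M)"
    then have ab: "a < s i" "b < s i" by (auto simp: diag_block_def)
    have "diag_block s m i M $$ (a, b) = M $$ (off s i + a, off s i + b)"
      using ab i off_less[OF i, of a s] off_less[OF i, of b s]
      by (simp add: diag_block_def mult_selector selector_mult del: index_mult_mat(1))
    then show "submatrix M {off s i..<off s i + s i} {off s i..<off s i + s i} $$ (a, b) = diag_block s m i M $$ (a, b)"
      unfolding submatrix_def using ab by (simp add: set[simplified] pick_interval)
  qed (simp_all add: submatrix_def set[simplified] diag_block_def)
qed

section \<open>The error of one level\<close>

lemma opnorm_le_dim_0:
  assumes "dim_row M = 0" "c \<ge> 0"
  shows "opnorm_le M c"
proof -
  have "vnorm (M *\<^sub>v v) = 0" for v using assms(1) by (simp add: vnorm_def scalar_prod_def)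
  then show ?thesis using assms(2) by (simp add: opnorm_le_def)
qed

text \<open>The four-term expression is linear in the function and vanishes for \<open>\<rho>\<close>, so it equals the one for
  \<open>f - \<rho>\<close>, which is small on all four spectra.\<close>

lemma level_error:
  assumes D: "symm n D" and A: "symm n A" and W: "W \<in> carrier_mat n w" and o: "transpose_mat W * W = 1\<^sub>m w"
    and specD: "spec_in D a b" and specA: "spec_in A a b" and m: "m \<ge> 0"
    and close: "\<And>x. x \<in> {a..b} \<Longrightarrow> \<bar>f x - \<rho> x\<bar> \<le> m"
    and exact: "mat_fun \<rho> A - mat_fun \<rho> D
      = W * mat_fun \<rho> (transpose_mat W * A * W) * transpose_mat W
        - W * mat_fun \<rho> (transpose_mat W * D * W) * transpose_mat W"
  shows "opnorm_le (mat_fun f A - mat_fun f D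
      + W * mat_fun f (transpose_mat W * D * W) * transpose_mat W
      - W * mat_fun f (transpose_mat W * A * W) * transpose_mat W) (4 * m)"
proof -
  define N where "N = transpose_mat W * D * W"
  define K where "K = transpose_mat W * A * W"
  define e where "e x = f x - \<rho> x" for x
  have N: "symm w N" unfolding N_def by (rule compression_symm[OF D W])
  have K: "symm w K" unfolding K_def by (rule compression_symm[OF A W])
  have specN: "spec_in N a b" unfolding N_def by (rule compression_spec_in[OF D specD W o])
  have specK: "spec_in K a b" unfolding K_def by (rule compression_spec_in[OF A specA W o])
  note [simp] = mat_fun_dim[OF D] mat_fun_dim[OF A] mat_fun_dim[OF N] mat_fun_dim[OF K] carrier_matD[OF W]
  have split: "mat_fun f M = mat_fun e M + mat_fun \<rho> M" if "symm k M" for M k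
    using mat_fun_add[OF that, of e \<rho>] by (simp add: e_def)
  have le: "opnorm_le (mat_fun e M) m" if "symm k M" "spec_in M a b" for M k
    using that by (intro opnorm_le_mat_fun[OF that(1) _ m]) (auto simp: e_def spec_in_def close)
  define E where "E = mat_fun e A - mat_fun e D + W * mat_fun e N * transpose_mat W - W * mat_fun e K * transpose_mat W"
  have c: "mat_fun g A \<in> carrier_mat n n" "mat_fun g D \<in> carrier_mat n n"
    "W * mat_fun g N * transpose_mat W \<in> carrier_mat n n" "W * mat_fun g K * transpose_mat W \<in> carrier_mat n n"
    "mat_fun g N \<in> carrier_mat w w" "mat_fun g K \<in> carrier_mat w w" for g
    by (auto intro!: carrier_matI)
  have "opnorm_le E (((m + m) + m) + m)"
    unfolding E_def
    by (intro opnorm_le_minus[of _ n n] opnorm_le_add[of _ n n] opnorm_le_congruence[OF W o] le[OF D specD]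
        le[OF A specA] le[OF N specN] le[OF K specK] minus_carrier_mat add_carrier_mat c m)
  moreover have "mat_fun f A - mat_fun f D + W * mat_fun f N * transpose_mat W - W * mat_fun f K * transpose_mat W = E"
  proof (rule eq_matI)
    fix i j assume "i < dim_row E" "j < dim_col E"
    then have ij: "i < n" "j < n" by (auto simp: E_def)
    have "(mat_fun \<rho> A - mat_fun \<rho> D) $$ (i, j)
      = (W * mat_fun \<rho> K * transpose_mat W - W * mat_fun \<rho> N * transpose_mat W) $$ (i, j)"
      using exact by (simp only: N_def K_def)
    then have "mat_fun \<rho> A $$ (i, j) - mat_fun \<rho> D $$ (i, j)
      = (W * mat_fun \<rho> K * transpose_mat W) $$ (i, j) - (W * mat_fun \<rho> N * transpose_mat W) $$ (i, j)"
      using ij by (simp del: index_mult_mat(1))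
    then show "(mat_fun f A - mat_fun f D + W * mat_fun f N * transpose_mat W
        - W * mat_fun f K * transpose_mat W) $$ (i, j) = E $$ (i, j)"
      unfolding E_def split[OF A] split[OF D] split[OF N] split[OF K]
      using ij by (simp add: mult_add_dim add_mult_dim del: index_mult_mat(1))
  qed (simp_all add: E_def)
  ultimately show ?thesis by (simp add: N_def K_def)
qed

section \<open>Index bookkeeping for trees\<close>

text \<open>Consecutive pieces of an interval of indices are determined by their lengths.\<close>

lemma concat_upt_blocks:
  assumes "concat (map g [0..<m]) = [0..<n]" and "i < m"
  shows "g i = [off (\<lambda>j. length (g j)) i ..< off (\<lambda>j. length (g j)) i + length (g i)]"
  using assms
proof (induction m arbitrary: n)
  case (Suc m)
  let ?k = "off (\<lambda>j. length (g j)) m"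
  have len: "length (concat (map g [0..<k])) = off (\<lambda>j. length (g j)) k" for k
    unfolding off_def by (induction k) auto
  have split: "concat (map g [0..<m]) @ g m = [0..<n]" using Suc.prems(1) by simp
  from arg_cong[OF split, of length] have n: "n = ?k + length (g m)" using len[of m] by simp
  from arg_cong[OF split, of "take ?k"] have 1: "concat (map g [0..<m]) = [0..<?k]"
    using len[of m] n by (simp add: take_upt)
  from arg_cong[OF split, of "drop ?k"] have 2: "g m = [?k..<n]"
    using len[of m] n by simp
  show ?case
  proof (cases "i = m")
    case True
    then show ?thesis using 2 n by simp
  next
    case False
    then show ?thesis using Suc.IH[OF 1] Suc.prems(2) by simp
  qed
qed simp

lemma off_double: "off s (2 * m) = off (\<lambda>i. s (2 * i) + s (2 * i + 1)) m"
  by (induction m) (auto simp: off_def)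

lemma off_const: "off (\<lambda>_. c) m = m * c"
  by (simp add: off_def)

lemma concat_map_double:
  "concat (map g [0..<2 * m]) = concat (map (\<lambda>i. g (2 * i) @ g (2 * i + 1)) [0..<m])"
  by (induction m) auto

lemma cluster_tree_level:
  assumes "cluster_tree n L T" "l \<le> L"
  shows "concat (map (\<lambda>i. T (l, i)) [0..<2 ^ l]) = [0..<n]"
  using assms(2)
proof (induction l)
  case 0
  then show ?case using assms(1) by (simp add: cluster_tree_def)
next
  case (Suc l)
  have "T (l, i) = T (Suc l, 2 * i) @ T (Suc l, 2 * i + 1)" if "i < 2 ^ l" for i
    using assms(1) Suc.prems that by (auto simp: cluster_tree_def nodes_at_def lchild_def rchild_def)
  then have eq: "map (\<lambda>i. T (l, i)) [0..<2 ^ l] = map (\<lambda>i. T (Suc l, 2 * i) @ T (Suc l, 2 * i + 1)) [0..<2 ^ l]"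
    by (intro map_cong) auto
  have "concat (map (\<lambda>i. T (l, i)) [0..<2 ^ l]) = [0..<n]" using Suc by simp
  then show ?case unfolding eq power_Suc concat_map_double[of "\<lambda>i. T (Suc l, i)" "2 ^ l"] .
qed

lemma blkdiag_diag_pair: "blkdiag X Y = diag_pair X Y"
  by (simp only: diag_pair_def Let_def diag_block_mat.simps(2)[of X "[Y]"] diag_block_mat_singleton)

section \<open>A run of the algorithm\<close>

locale hss_run =
  fixes A :: "real mat" and n L r :: nat and T :: "node \<Rightarrow> nat list"
    and f :: "real \<Rightarrow> real" and lmin lmax :: real and \<xi>s :: "complex option list"
    and U D Z Dt W C :: "node \<Rightarrow> real mat"
  assumes tree: "cluster_tree n L T"
    and A_carrier: "A \<in> carrier_mat n n" and A_sym: "transpose_mat A = A"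
    and A_spec: "spec_in A lmin lmax"
    and cc: "conj_closed \<xi>s"
    and decomp: "sym_telescopic_decomp L T r A U D" and standard: "standard_decomp L T r U D"
    and no_pole: "\<And>l \<tau>. l \<in> {1..L} \<Longrightarrow> \<tau> \<in> nodes_at l \<Longrightarrow> no_pole_eigenvalue \<xi>s (Dt \<tau>)"
    and run: "alg_run L f \<xi>s U D Z Dt W C"
begin

text \<open>Row sizes of \<open>D \<tau>\<close>, which are prescribed, and the dimensions of the compressed matrices, which depend on
  the bases chosen by the run and may differ from node to node.\<close>

definition sz :: "nat \<Rightarrow> nat \<Rightarrow> nat" where "sz l i = (if l = L then length (T (l, i)) else 2 * r)"
definition dimD :: "nat \<Rightarrow> nat \<Rightarrow> nat" where "dimD l i = dim_row (Dt (l, i))"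
definition dimW :: "nat \<Rightarrow> nat \<Rightarrow> nat" where "dimW l i = dim_col (W (l, i))"

lemma node_at: "i < 2 ^ l \<Longrightarrow> (l, i) \<in> nodes_at l"
  by (simp add: nodes_at_def)

lemma children_less:
  fixes i :: nat
  shows "i < 2 ^ l \<Longrightarrow> 2 * i < 2 ^ Suc l" "i < 2 ^ l \<Longrightarrow> 2 * i + 1 < 2 ^ Suc l"
  by auto

lemma D_symm: "l \<le> L \<Longrightarrow> i < 2 ^ l \<Longrightarrow> symm (sz l i) (D (l, i))"
  using decomp node_at[of i l] by (auto simp: sym_telescopic_decomp_def Let_def symm_def sz_def)

lemma U_carrier:
  assumes "1 \<le> l" "l \<le> L" "i < 2 ^ l"
  shows "U (l, i) \<in> carrier_mat (sz l i) r" "transpose_mat (U (l, i)) * U (l, i) = 1\<^sub>m r"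
proof -
  have "U (l, i) \<in> carrier_mat (sz l i) r \<and> orthonormal_cols (U (l, i))"
    using decomp node_at[of i l] assms by (auto simp: sym_telescopic_decomp_def Let_def sz_def)
  then show "U (l, i) \<in> carrier_mat (sz l i) r" "transpose_mat (U (l, i)) * U (l, i) = 1\<^sub>m r"
    by (auto simp: orthonormal_cols_def)
qed

lemma W_krylov:
  assumes "1 \<le> l" "l \<le> L" "i < 2 ^ l"
  shows "krylov_basis (Dt (l, i)) (Z (l, i)) \<xi>s (W (l, i))"
  using run assms node_at[of i l] by (auto simp: alg_run_def)

lemma C_eq:
  assumes "1 \<le> l" "l \<le> L" "i < 2 ^ l"
  shows "C (l, i) = mat_fun f (Dt (l, i)) -
    W (l, i) * mat_fun f (transpose_mat (W (l, i)) * Dt (l, i) * W (l, i)) * transpose_mat (W (l, i))"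
  using run assms node_at[of i l] by (auto simp: alg_run_def)

lemma W_carrier:
  assumes "1 \<le> l" "l \<le> L" "i < 2 ^ l"
  shows "W (l, i) \<in> carrier_mat (dimD l i) (dimW l i)"
    "transpose_mat (W (l, i)) * W (l, i) = 1\<^sub>m (dimW l i)"
  using W_krylov[OF assms] by (auto simp: krylov_basis_def orthonormal_cols_def dimD_def dimW_def)

lemma leaf_eq:
  assumes "i < 2 ^ L"
  shows "Dt (L, i) = D (L, i)" "1 \<le> L \<Longrightarrow> Z (L, i) = U (L, i)"
  using run node_at[OF assms] by (auto simp: alg_run_def)

lemma inner_eq:
  assumes "l < L" "i < 2 ^ l"
  shows "1 \<le> l \<Longrightarrow> Z (l, i) = S_mat W Z (l, i) * U (l, i)"
    and "Dt (l, i) = diag_pair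
        (transpose_mat (W (Suc l, 2 * i)) * Dt (Suc l, 2 * i) * W (Suc l, 2 * i))
        (transpose_mat (W (Suc l, 2 * i + 1)) * Dt (Suc l, 2 * i + 1) * W (Suc l, 2 * i + 1))
      + S_mat W Z (l, i) * D (l, i) * transpose_mat (S_mat W Z (l, i))"
    and "S_mat W Z (l, i) = diag_pair (transpose_mat (W (Suc l, 2 * i)) * Z (Suc l, 2 * i))
        (transpose_mat (W (Suc l, 2 * i + 1)) * Z (Suc l, 2 * i + 1))"
  using run assms node_at[of i l]
  by (auto simp: alg_run_def blkdiag_diag_pair lchild_def rchild_def S_mat_def simp del: diag_block_mat.simps)

text \<open>The run proceeds from the leaves to the root, and so does the induction.\<close>

lemma Dt_symm_Z_carrier:
  assumes "l \<le> L" 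
  shows "\<forall>i<2 ^ l. symm (dimD l i) (Dt (l, i)) \<and> (1 \<le> l \<longrightarrow> Z (l, i) \<in> carrier_mat (dimD l i) r)"
  using assms
proof (induction l rule: inc_induct)
  case base
  show ?case
  proof (intro allI impI conjI)
    fix i assume i: "i < (2 :: nat) ^ L"
    have dim: "dimD L i = sz L i" using symmD(2)[OF D_symm[OF order.refl i]] by (simp add: dimD_def leaf_eq[OF i])
    show "symm (dimD L i) (Dt (L, i))" using D_symm[OF order.refl i] by (simp add: dim leaf_eq[OF i])
    show "Z (L, i) \<in> carrier_mat (dimD L i) r" if "1 \<le> L"
      using U_carrier(1)[OF that order.refl i] leaf_eq(2)[OF i that] by (simp add: dim)
  qed
next
  case (step l)
  show ?case
  proof (intro allI impI conjI)
    fix i assume i: "i < (2 :: nat) ^ l"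
    note ch = children_less[OF i]
    have l: "l < L" "1 \<le> Suc l" "Suc l \<le> L" using step by auto
    note W1 = W_carrier(1)[OF l(2,3) ch(1)] and W2 = W_carrier(1)[OF l(2,3) ch(2)]
    have Z1: "Z (Suc l, 2 * i) \<in> carrier_mat (dimD (Suc l) (2 * i)) r"
      and Z2: "Z (Suc l, 2 * i + 1) \<in> carrier_mat (dimD (Suc l) (2 * i + 1)) r"
      and D1: "symm (dimD (Suc l) (2 * i)) (Dt (Suc l, 2 * i))"
      and D2: "symm (dimD (Suc l) (2 * i + 1)) (Dt (Suc l, 2 * i + 1))"
      using step.IH ch by auto
    let ?w = "dimW (Suc l) (2 * i) + dimW (Suc l) (2 * i + 1)"
    have S: "S_mat W Z (l, i) \<in> carrier_mat ?w (2 * r)"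
      unfolding inner_eq(3)[OF l(1) i] using W1 W2 Z1 Z2 by (intro carrier_matI) auto
    have Dl: "symm (2 * r) (D (l, i))" using D_symm[of l i] l i by (simp add: sz_def)
    have 1: "symm ?w (diag_pair
        (transpose_mat (W (Suc l, 2 * i)) * Dt (Suc l, 2 * i) * W (Suc l, 2 * i))
        (transpose_mat (W (Suc l, 2 * i + 1)) * Dt (Suc l, 2 * i + 1) * W (Suc l, 2 * i + 1)))"
      by (intro diag_pair_symm compression_symm[OF D1 W1] compression_symm[OF D2 W2])
    have 2: "symm ?w (S_mat W Z (l, i) * D (l, i) * transpose_mat (S_mat W Z (l, i)))"
      using compression_symm[OF Dl, of "transpose_mat (S_mat W Z (l, i))" ?w] S by simp
    have sym: "symm ?w (Dt (l, i))"
      unfolding inner_eq(2)[OF l(1) i] by (rule symm_add[OF 1 2])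
    then have dim: "dimD l i = ?w" using symmD(2) by (simp add: dimD_def)
    show "symm (dimD l i) (Dt (l, i))" using sym dim by simp
    show "Z (l, i) \<in> carrier_mat (dimD l i) r" if "1 \<le> l"
      unfolding inner_eq(1)[OF l(1) i that] dim using S U_carrier(1)[OF that _ i] l by (auto simp: sz_def)
  qed
qed

lemma Dt_symm: "l \<le> L \<Longrightarrow> i < 2 ^ l \<Longrightarrow> symm (dimD l i) (Dt (l, i))"
  and Z_carrier: "1 \<le> l \<Longrightarrow> l \<le> L \<Longrightarrow> i < 2 ^ l \<Longrightarrow> Z (l, i) \<in> carrier_mat (dimD l i) r"
  using Dt_symm_Z_carrier by auto

lemma node_dims:
  "l \<le> L \<Longrightarrow> i < 2 ^ l \<Longrightarrow> dim_row (Dt (l, i)) = dimD l i"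
  "l \<le> L \<Longrightarrow> i < 2 ^ l \<Longrightarrow> dim_col (Dt (l, i)) = dimD l i"
  "1 \<le> l \<Longrightarrow> l \<le> L \<Longrightarrow> i < 2 ^ l \<Longrightarrow> dim_row (Z (l, i)) = dimD l i"
  "1 \<le> l \<Longrightarrow> l \<le> L \<Longrightarrow> i < 2 ^ l \<Longrightarrow> dim_col (Z (l, i)) = r"
  "1 \<le> l \<Longrightarrow> l \<le> L \<Longrightarrow> i < 2 ^ l \<Longrightarrow> dim_row (W (l, i)) = dimD l i"
  "dim_col (W (l, i)) = dimW l i"
  using symmD(2,3)[OF Dt_symm] carrier_matD[OF Z_carrier] carrier_matD[OF W_carrier(1)]
  by (auto simp: dimW_def)

lemma S_carrier:
  assumes "l < L" "i < 2 ^ l"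
  shows "S_mat W Z (l, i) \<in> carrier_mat (dimW (Suc l) (2 * i) + dimW (Suc l) (2 * i + 1)) (2 * r)"
  unfolding inner_eq(3)[OF assms] using assms by (intro carrier_matI) (simp_all add: node_dims)

lemma S_dims:
  "l < L \<Longrightarrow> i < 2 ^ l \<Longrightarrow> dim_row (S_mat W Z (l, i)) = dimW (Suc l) (2 * i) + dimW (Suc l) (2 * i + 1)"
  "l < L \<Longrightarrow> i < 2 ^ l \<Longrightarrow> dim_col (S_mat W Z (l, i)) = 2 * r"
  using carrier_matD[OF S_carrier] by auto

lemma dimD_inner:
  assumes "l < L" "i < 2 ^ l"
  shows "dimD l i = dimW (Suc l) (2 * i) + dimW (Suc l) (2 * i + 1)"
  unfolding dimD_def inner_eq(2)[OF assms] using S_carrier[OF assms] by simp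

definition DL :: "nat \<Rightarrow> real mat" where "DL l = level_mat Dt l"
definition ZL :: "nat \<Rightarrow> real mat" where "ZL l = level_mat Z l"
definition WL :: "nat \<Rightarrow> real mat" where "WL l = level_mat W l"
definition XL :: "nat \<Rightarrow> real mat" where "XL l = telescopic D U l"
definition dimL :: "nat \<Rightarrow> nat" where "dimL l = off (dimD l) (2 ^ l)"

text \<open>The compression of \<open>A\<close> to the level \<open>l\<close>, written as an update of the block diagonal matrix that the
  algorithm works with. At the root there is only one block and nothing is left to couple.\<close>

definition AL :: "nat \<Rightarrow> real mat" where
  "AL l = (if l = 0 then DL 0 else DL l + ZL l * XL (l - 1) * transpose_mat (ZL l))"

lemma XL_symm:
  assumes "l \<le> L"
  shows "symm (off (sz l) (2 ^ l)) (XL l)"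
  using assms
proof (induction l)
  case 0
  then show ?case using D_symm[of 0 0] by (simp add: XL_def off_def)
next
  case (Suc l)
  let ?U = "level_mat U (Suc l)"
  have U: "?U \<in> carrier_mat (off (sz (Suc l)) (2 ^ Suc l)) (off (\<lambda>_. r) (2 ^ Suc l))"
    unfolding level_mat_block_diag
    by (rule carrier_matI; rule dim_block_diag_off[of _ _ "sz (Suc l)" "\<lambda>_. r"])
       (use Suc.prems U_carrier in auto)
  have X: "symm (off (\<lambda>_. r) (2 ^ Suc l)) (XL l)"
    using Suc by (simp add: off_def sz_def mult_ac)
  have 1: "symm (off (sz (Suc l)) (2 ^ Suc l)) (level_mat D (Suc l))"
    unfolding level_mat_block_diag off_def by (rule block_diag_symm) (use D_symm Suc.prems in auto)
  have 2: "symm (off (sz (Suc l)) (2 ^ Suc l)) (?U * XL l * transpose_mat ?U)"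
    using compression_symm[OF X, of "transpose_mat ?U"] U by simp
  show ?case
    using 1 2 unfolding XL_def symm_def by (auto simp: transpose_add_dim XL_def)
qed

lemma DL_symm: "l \<le> L \<Longrightarrow> symm (dimL l) (DL l)"
  unfolding DL_def dimL_def level_mat_block_diag off_def by (rule block_diag_symm) (use Dt_symm in auto)

lemma ZL_carrier: "1 \<le> l \<Longrightarrow> l \<le> L \<Longrightarrow> ZL l \<in> carrier_mat (dimL l) (off (\<lambda>_. r) (2 ^ l))"
  unfolding ZL_def dimL_def level_mat_block_diag
  by (rule carrier_matI; rule dim_block_diag_off[of _ _ "dimD l" "\<lambda>_. r"]) (use Z_carrier in auto)

lemma WL_carrier: "1 \<le> l \<Longrightarrow> l \<le> L \<Longrightarrow> WL l \<in> carrier_mat (dimL l) (off (dimW l) (2 ^ l))"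
  unfolding WL_def dimL_def level_mat_block_diag
  by (rule carrier_matI; rule dim_block_diag_off[of _ _ "dimD l" "dimW l"]) (use W_carrier in auto)

lemma dimL_inner: "l < L \<Longrightarrow> off (dimW (Suc l)) (2 ^ Suc l) = dimL l"
  unfolding dimL_def power_Suc off_double by (auto simp: off_def dimD_inner intro!: sum.cong)

lemma WL_orthonormal:
  assumes "1 \<le> l" "l \<le> L"
  shows "transpose_mat (WL l) * WL l = 1\<^sub>m (off (dimW l) (2 ^ l))"
proof -
  have "transpose_mat (WL l) * WL l = block_diag (\<lambda>i. transpose_mat (W (l, i)) * W (l, i)) (2 ^ l)"
    unfolding WL_def level_mat_block_diag block_diag_transpose by (rule block_diag_mult) simp
  also have "\<dots> = block_diag (\<lambda>i. 1\<^sub>m (dimW l i)) (2 ^ l)"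
    by (rule block_diag_cong) (use W_carrier(2) assms in auto)
  finally show ?thesis by (simp add: block_diag_one off_def)
qed

lemma XL_symm_inner: "l < L \<Longrightarrow> symm (off (\<lambda>_. r) (2 ^ Suc l)) (XL l)"
  using XL_symm[of l] by (simp add: off_def sz_def mult_ac)

lemma AL_symm:
  assumes "l \<le> L"
  shows "symm (dimL l) (AL l)"
proof (cases l)
  case 0
  then show ?thesis using DL_symm[of 0] by (simp add: AL_def)
next
  case (Suc k)
  have Z: "ZL l \<in> carrier_mat (dimL l) (off (\<lambda>_. r) (2 ^ l))" using ZL_carrier[of l] assms Suc by simp
  have X: "symm (off (\<lambda>_. r) (2 ^ l)) (XL k)" using XL_symm_inner[of k] assms Suc by simp
  have "symm (dimL l) (ZL l * XL k * transpose_mat (ZL l))"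
    using compression_symm[OF X, of "transpose_mat (ZL l)"] Z by simp
  then show ?thesis
    using DL_symm[OF assms] Suc unfolding AL_def symm_def by (auto simp: transpose_add_dim)
qed

lemma AL_leaf: "AL L = A"
proof -
  have D: "DL L = level_mat D L"
    unfolding DL_def level_mat_block_diag by (rule block_diag_cong) (simp add: leaf_eq)
  have A: "A = telescopic D U L" using decomp by (simp add: sym_telescopic_decomp_def)
  show ?thesis
  proof (cases L)
    case 0
    then show ?thesis using A D by (simp add: AL_def level_mat_block_diag block_diag_1)
  next
    case (Suc k)
    have "ZL L = level_mat U L"
      unfolding ZL_def level_mat_block_diag by (rule block_diag_cong) (use leaf_eq(2) Suc in simp)
    then show ?thesis using A D Suc by (simp add: AL_def XL_def)
  qed
qed

text \<open>Compressing \<open>D\<^sub>l\<^sub>+\<^sub>1 + Z\<^sub>l\<^sub>+\<^sub>1 X\<^sub>l Z\<^sub>l\<^sub>+\<^sub>1\<^sup>T\<close> turns \<open>Z\<^sub>l\<^sub>+\<^sub>1\<close> into the block diagonal matrix \<open>S\<close> of the \<open>S_mat\<close>.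
  Expanding \<open>X\<^sub>l\<close> by its recursion, the part \<open>S D S\<^sup>T\<close> joins the compressed diagonal blocks to form
  the new \<open>Dt\<close>, and \<open>S U\<close> is the new \<open>Z\<close>: these are the recursions of the algorithm.\<close>

lemma AL_compress:
  assumes l: "l < L"
  shows "transpose_mat (WL (Suc l)) * AL (Suc l) * WL (Suc l) = AL l"
proof -
  let ?W = "WL (Suc l)"
  define S where "S = block_diag (\<lambda>i. S_mat W Z (l, i)) (2 ^ l)"
  have l': "1 \<le> Suc l" "Suc l \<le> L" using l by auto
  note Wc = WL_carrier[OF l'] and Zc = ZL_carrier[OF l'] and Dc = DL_symm[OF l'(2)] and Xc = XL_symm_inner[OF l]
  note [simp] = carrier_matD[OF Wc] carrier_matD[OF Zc] symmD(2,3)[OF Dc] symmD(2,3)[OF Xc]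
  have Sc: "S \<in> carrier_mat (dimL l) (off (\<lambda>_. 2 * r) (2 ^ l))"
    unfolding S_def dimL_def
    by (rule carrier_matI; rule dim_block_diag_off[of _ _ "dimD l" "\<lambda>_. 2 * r"])
       (use S_carrier l dimD_inner in auto)
  have WZ: "transpose_mat ?W * ZL (Suc l) = S"
  proof -
    have "transpose_mat ?W * ZL (Suc l) = block_diag (\<lambda>i. transpose_mat (W (Suc l, i)) * Z (Suc l, i)) (2 * 2 ^ l)"
      unfolding WL_def ZL_def level_mat_block_diag block_diag_transpose power_Suc
      by (rule block_diag_mult) (use l in \<open>simp add: node_dims\<close>)
    also have "\<dots> = S"
      unfolding block_diag_double S_def blkdiag_diag_pair by (rule block_diag_cong) (simp add: inner_eq(3)[OF l])
    finally show ?thesis .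
  qed
  define P where "P = transpose_mat ?W * DL (Suc l) * ?W"
  have Pc: "P \<in> carrier_mat (dimL l) (dimL l)"
    unfolding P_def by (rule carrier_matI) (simp_all add: dimL_inner[OF l, simplified])
  have "P = block_diag (\<lambda>i. transpose_mat (W (Suc l, i)) * Dt (Suc l, i)) (2 ^ Suc l) * ?W"
    unfolding P_def WL_def DL_def level_mat_block_diag block_diag_transpose
    by (subst block_diag_mult) (use l in \<open>simp_all add: node_dims\<close>)
  also have "\<dots> = block_diag (\<lambda>i. transpose_mat (W (Suc l, i)) * Dt (Suc l, i) * W (Suc l, i)) (2 * 2 ^ l)"
    unfolding WL_def level_mat_block_diag power_Suc
    by (subst block_diag_mult) (use l in \<open>simp_all add: node_dims\<close>)
  finally have P: "P = block_diag (\<lambda>i. diag_pair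
      (transpose_mat (W (Suc l, 2 * i)) * Dt (Suc l, 2 * i) * W (Suc l, 2 * i))
      (transpose_mat (W (Suc l, 2 * i + 1)) * Dt (Suc l, 2 * i + 1) * W (Suc l, 2 * i + 1))) (2 ^ l)"
    unfolding block_diag_double blkdiag_diag_pair .
  have Dl: "level_mat D l \<in> carrier_mat (off (\<lambda>_. 2 * r) (2 ^ l)) (off (\<lambda>_. 2 * r) (2 ^ l))"
    unfolding level_mat_block_diag
    by (rule carrier_matI; rule dim_block_diag_off[of _ _ "\<lambda>_. 2 * r" "\<lambda>_. 2 * r"])
       (use D_symm[of l] l in \<open>auto simp: symm_def sz_def\<close>)
  have SDS: "S * level_mat D l * transpose_mat S
    = block_diag (\<lambda>i. S_mat W Z (l, i) * D (l, i) * transpose_mat (S_mat W Z (l, i))) (2 ^ l)"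
  proof -
    have Di: "dim_row (D (l, i)) = 2 * r" "dim_col (D (l, i)) = 2 * r" if "i < 2 ^ l" for i
      using D_symm[of l i] l that by (auto simp: symm_def sz_def)
    have "S * level_mat D l = block_diag (\<lambda>i. S_mat W Z (l, i) * D (l, i)) (2 ^ l)"
      unfolding S_def level_mat_block_diag
      by (rule block_diag_mult) (use Di S_dims[OF l] in auto)
    then show ?thesis
      unfolding S_def block_diag_transpose
      by (simp only:, intro block_diag_mult) (use Di S_dims[OF l] in auto)
  qed
  have DL: "DL l = P + S * level_mat D l * transpose_mat S"
  proof -
    have Wd: "dim_col (W (Suc l, 2 * i)) = dimW (Suc l) (2 * i)"
      "dim_col (W (Suc l, Suc (2 * i))) = dimW (Suc l) (Suc (2 * i))" for i
      by (auto simp: dimW_def)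
    have "P + S * level_mat D l * transpose_mat S = block_diag (\<lambda>i. Dt (l, i)) (2 ^ l)"
      unfolding P SDS
      by (subst block_diag_add)
         (use S_dims[OF l] in \<open>auto simp: Wd inner_eq(2)[OF l] intro!: block_diag_cong\<close>)
    then show ?thesis by (simp add: DL_def level_mat_block_diag)
  qed
  have XS: "off (\<lambda>_. r) (2 ^ Suc l) = off (\<lambda>_. 2 * r) (2 ^ l)" by (simp add: off_const)
  note [simp] = carrier_matD[OF Sc] carrier_matD[OF Pc] carrier_matD[OF Dl]
  have SX: "transpose_mat ?W * AL (Suc l) * ?W = P + S * XL l * transpose_mat S"
  proof -
    have "transpose_mat ?W * AL (Suc l) * ?W
      = P + (transpose_mat ?W * ZL (Suc l)) * XL l * transpose_mat (transpose_mat ?W * ZL (Suc l))"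
      unfolding P_def AL_def by (simp add: mat_dim_simps)
    then show ?thesis unfolding WZ .
  qed
  show ?thesis
  proof (cases l)
    case 0
    have "XL l = level_mat D l" using 0 by (simp add: XL_def level_mat_block_diag block_diag_1)
    then show ?thesis unfolding SX using DL 0 by (simp add: AL_def)
  next
    case (Suc k)
    have l1: "1 \<le> l" using Suc by simp
    have Uc: "level_mat U l \<in> carrier_mat (off (\<lambda>_. 2 * r) (2 ^ l)) (off (\<lambda>_. r) (2 ^ l))"
      unfolding level_mat_block_diag
      by (rule carrier_matI; rule dim_block_diag_off[of _ _ "\<lambda>_. 2 * r" "\<lambda>_. r"])
         (use U_carrier(1)[OF l1] l in \<open>auto simp: sz_def\<close>)
    have Xk: "symm (off (\<lambda>_. r) (2 ^ l)) (XL k)" using XL_symm_inner[of k] l Suc by simp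
    note [simp] = carrier_matD[OF Uc] symmD(2,3)[OF Xk]
    have XL: "XL l = level_mat D l + level_mat U l * XL k * transpose_mat (level_mat U l)"
      using Suc by (simp add: XL_def)
    have Z: "ZL l = S * level_mat U l"
    proof -
      have "S * level_mat U l = block_diag (\<lambda>i. S_mat W Z (l, i) * U (l, i)) (2 ^ l)"
        unfolding S_def level_mat_block_diag
        by (rule block_diag_mult) (use S_dims[OF l] carrier_matD[OF U_carrier(1)[OF l1]] l in \<open>auto simp: sz_def\<close>)
      also have "\<dots> = ZL l"
        unfolding ZL_def level_mat_block_diag by (rule block_diag_cong) (simp add: inner_eq(1)[OF l _ l1])
      finally show ?thesis by simp
    qed
    have Y: "S * level_mat U l * XL k * transpose_mat (S * level_mat U l) \<in> carrier_mat (dimL l) (dimL l)"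
      "S * level_mat D l * transpose_mat S \<in> carrier_mat (dimL l) (dimL l)"
      by (auto intro!: carrier_matI)
    have "P + S * XL l * transpose_mat S
      = P + (S * level_mat D l * transpose_mat S + S * level_mat U l * XL k * transpose_mat (S * level_mat U l))"
      unfolding XL by (simp add: mat_dim_simps)
    also have "\<dots> = DL l + ZL l * XL k * transpose_mat (ZL l)"
      unfolding DL Z by (rule assoc_add_mat[symmetric, OF Pc Y(2,1)])
    finally show ?thesis unfolding SX using Suc by (simp add: AL_def)
  qed
qed

section \<open>Spectra of the compressed matrices and of their blocks\<close>

lemma AL_spec:
  assumes "l \<le> L"
  shows "spec_in (AL l) lmin lmax"
  using assms
proof (induction l rule: inc_induct)
  case base
  show ?case using A_spec by (simp add: AL_leaf)
next
  case (step l)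
  have l: "1 \<le> Suc l" "Suc l \<le> L" using step by auto
  show ?case
    using compression_spec_in[OF AL_symm[OF l(2)] step.IH WL_carrier[OF l] WL_orthonormal[OF l]]
    by (simp add: AL_compress[OF step.hyps(2)])
qed

lemma node_indices:
  assumes "l \<le> L" "i < 2 ^ l"
  shows "set (if l < L then balanced_tree (2 * r) l (l, i) else T (l, i))
    = {off (sz l) i..<off (sz l) i + sz l i}"
proof (cases "l < L")
  case True
  then show ?thesis by (auto simp: balanced_tree_def off_def sz_def)
next
  case False
  then have l: "l = L" using assms(1) by simp
  have sz: "sz L = (\<lambda>j. length (T (L, j)))" by (auto simp: sz_def)
  have "T (L, i) = [off (sz L) i..<off (sz L) i + sz L i]"
    unfolding sz using concat_upt_blocks[OF cluster_tree_level[OF tree order.refl], of i] assms(2) l by simp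
  then show ?thesis using l by simp
qed

text \<open>In a standard decomposition the diagonal blocks of \<open>X\<^sub>l\<close> are the \<open>D \<tau>\<close>, so the blocks
  \<open>U \<tau> Y (U \<tau>)\<^sup>T\<close> of the remaining part vanish, and then \<open>Y = 0\<close> because \<open>U \<tau>\<close> has orthonormal columns.
  Unlike \<open>U \<tau> Y (U \<tau>)\<^sup>T\<close>, the block \<open>Y\<close> reappears after compression, multiplied by \<open>Z \<tau>\<close>.\<close>

lemma coupling_block_zero:
  assumes l: "Suc k \<le> L" and i: "i < 2 ^ Suc k"
  shows "diag_block (\<lambda>_. r) (2 ^ Suc k) i (XL k) = 0\<^sub>m r r"
proof -
  let ?l = "Suc k"
  let ?J = "{off (sz ?l) i..<off (sz ?l) i + sz ?l i}"
  let ?m = "2 ^ ?l :: nat"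
  have "submatrix (telescopic D U ?l) ?J ?J = D (?l, i)"
    using standard node_indices[OF l i] node_at[OF i] l
    unfolding standard_decomp_def Let_def by (metis One_nat_def Suc_le_mono atLeastAtMost_iff le0)
  then have 1: "diag_block (sz ?l) ?m i (XL ?l) = D (?l, i)"
    using submatrix_eq_diag_block[OF symmD(1)[OF XL_symm[OF l]] i] by (simp add: XL_def)
  have Dc: "D (?l, j) \<in> carrier_mat (sz ?l j) (sz ?l j)" if "j < ?m" for j
    using symmD(1)[OF D_symm[OF l that]] .
  have Uc: "U (?l, j) \<in> carrier_mat (sz ?l j) r" if "j < ?m" for j
    using U_carrier(1)[OF _ l that] by simp
  have Xc: "XL k \<in> carrier_mat (off (\<lambda>_. r) ?m) (off (\<lambda>_. r) ?m)"
    using symmD(1)[OF XL_symm_inner[of k]] l by simp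
  let ?D = "block_diag (\<lambda>i. D (?l, i)) ?m" and ?U = "block_diag (\<lambda>i. U (?l, i)) ?m"
  have D: "?D \<in> carrier_mat (off (sz ?l) ?m) (off (sz ?l) ?m)"
    by (rule carrier_matI; rule dim_block_diag_off[of _ _ "sz ?l" "sz ?l"]) (use Dc in auto)
  have U: "?U \<in> carrier_mat (off (sz ?l) ?m) (off (\<lambda>_. r) ?m)"
    by (rule carrier_matI; rule dim_block_diag_off[of _ _ "sz ?l" "\<lambda>_. r"]) (use Uc in auto)
  have UXU: "?U * XL k * transpose_mat ?U \<in> carrier_mat (off (sz ?l) ?m) (off (sz ?l) ?m)"
    using U Xc by simp
  define Y where "Y = diag_block (\<lambda>_. r) ?m i (XL k)"
  have Yc: "Y \<in> carrier_mat r r" unfolding Y_def diag_block_def by (rule carrier_matI) auto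
  note [simp] = carrier_matD[OF Yc] carrier_matD[OF Uc[OF i]] carrier_matD[OF Dc[OF i]]
  have "XL ?l = ?D + ?U * XL k * transpose_mat ?U" by (simp add: XL_def level_mat_block_diag)
  then have "diag_block (sz ?l) ?m i (XL ?l)
      = diag_block (sz ?l) ?m i ?D + diag_block (sz ?l) ?m i (?U * XL k * transpose_mat ?U)"
    using diag_block_add[OF D UXU] by simp
  also have "diag_block (sz ?l) ?m i ?D = D (?l, i)"
    by (rule diag_block_block_diag[of ?m "\<lambda>i. D (?l, i)" "sz ?l" i]) (use Dc i in auto)
  also have "diag_block (sz ?l) ?m i (?U * XL k * transpose_mat ?U) = U (?l, i) * Y * transpose_mat (U (?l, i))"
    unfolding Y_def
    by (rule diag_block_congruence[of ?m "\<lambda>i. U (?l, i)" "sz ?l" "\<lambda>_. r" i]) (use Uc i Xc in auto)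
  finally have e: "D (?l, i) + U (?l, i) * Y * transpose_mat (U (?l, i)) = D (?l, i)" using 1 by simp
  have zero: "U (?l, i) * Y * transpose_mat (U (?l, i)) = 0\<^sub>m (sz ?l i) (sz ?l i)"
  proof (rule eq_matI)
    fix a b assume "a < dim_row (0\<^sub>m (sz ?l i) (sz ?l i) :: real mat)" "b < dim_col (0\<^sub>m (sz ?l i) (sz ?l i) :: real mat)"
    then show "(U (?l, i) * Y * transpose_mat (U (?l, i))) $$ (a, b) = 0\<^sub>m (sz ?l i) (sz ?l i) $$ (a, b)"
      using arg_cong[OF e, of "\<lambda>M. M $$ (a, b)"] by (simp del: index_mult_mat(1))
  qed auto
  have UU: "transpose_mat (U (?l, i)) * U (?l, i) = 1\<^sub>m r" using U_carrier(2)[OF _ l i] by simp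
  have UUM: "transpose_mat (U (?l, i)) * (U (?l, i) * M) = M" if "dim_row M = r" for M
    using that UU by (simp add: mult_assoc_dim[symmetric])
  have "Y = transpose_mat (U (?l, i)) * (U (?l, i) * Y * transpose_mat (U (?l, i))) * U (?l, i)"
    by (simp add: mult_assoc_dim UUM UU)
  also have "\<dots> = 0\<^sub>m r r"
    unfolding zero using Uc[OF i] by simp
  finally show ?thesis by (simp only: Y_def)
qed

lemma Dt_diag_block:
  assumes l: "1 \<le> l" "l \<le> L" and i: "i < 2 ^ l"
  shows "diag_block (dimD l) (2 ^ l) i (AL l) = Dt (l, i)"
proof -
  obtain k where k: "l = Suc k" using l by (cases l) auto
  have DLc: "DL l \<in> carrier_mat (off (dimD l) (2 ^ l)) (off (dimD l) (2 ^ l))"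
    using symmD(1)[OF DL_symm[OF l(2)]] by (simp add: dimL_def)
  have Xc: "XL k \<in> carrier_mat (off (\<lambda>_. r) (2 ^ l)) (off (\<lambda>_. r) (2 ^ l))"
    using symmD(1)[OF XL_symm_inner[of k]] l k by simp
  have Zc: "ZL l \<in> carrier_mat (off (dimD l) (2 ^ l)) (off (\<lambda>_. r) (2 ^ l))"
    using ZL_carrier[OF l] by (simp add: dimL_def)
  have "diag_block (dimD l) (2 ^ l) i (AL l) = diag_block (dimD l) (2 ^ l) i (DL l)
      + diag_block (dimD l) (2 ^ l) i (ZL l * XL k * transpose_mat (ZL l))"
    unfolding AL_def k using DLc Zc Xc k by (simp add: diag_block_add)
  also have "diag_block (dimD l) (2 ^ l) i (DL l) = Dt (l, i)"
    unfolding DL_def level_mat_block_diag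
    by (rule diag_block_block_diag[of "2 ^ l" "\<lambda>i. Dt (l, i)" "dimD l" i]) (use symmD(1)[OF Dt_symm[OF l(2)]] i in auto)
  also have "diag_block (dimD l) (2 ^ l) i (ZL l * XL k * transpose_mat (ZL l))
    = Z (l, i) * diag_block (\<lambda>_. r) (2 ^ l) i (XL k) * transpose_mat (Z (l, i))"
    unfolding ZL_def level_mat_block_diag
    by (rule diag_block_congruence[of "2 ^ l" "\<lambda>i. Z (l, i)" "dimD l" "\<lambda>_. r" i]) (use Z_carrier[OF l] i Xc in auto)
  also have "\<dots> = 0\<^sub>m (dimD l i) (dimD l i)"
    using coupling_block_zero[of k i] Z_carrier[OF l i] l i k by simp
  also have "Dt (l, i) + 0\<^sub>m (dimD l i) (dimD l i) = Dt (l, i)"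
    using symmD(1)[OF Dt_symm[OF l(2) i]] by simp
  finally show ?thesis .
qed

text \<open>Hence \<open>Dt \<tau>\<close> is a compression of \<open>A\<close>, by an orthonormal selection of rows and columns.\<close>

lemma Dt_spec:
  assumes l: "1 \<le> l" "l \<le> L" and i: "i < 2 ^ l"
  shows "spec_in (Dt (l, i)) lmin lmax"
proof -
  have J: "selector (dimD l) (2 ^ l) i \<in> carrier_mat (dimL l) (dimD l i)"
    by (rule carrier_matI) (auto simp: dimL_def)
  show ?thesis
    using compression_spec_in[OF AL_symm[OF l(2)] AL_spec[OF l(2)] J selector_orthonormal[OF i]]
    unfolding diag_block_def[symmetric] Dt_diag_block[OF l i] .
qed

lemma DL_eigenvalue:
  assumes l: "1 \<le> l" "l \<le> L" and ev: "eigenvalue (DL l) x"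
  shows "x \<in> {lmin..lmax}" "poly (pole_poly \<xi>s) x \<noteq> 0"
proof -
  obtain i where i: "i < 2 ^ l" "eigenvalue (Dt (l, i)) x"
    using block_diag_eigenvalue[of "2 ^ l" "dimD l" "\<lambda>i. Dt (l, i)" x] Dt_symm[OF l(2)] ev
    by (auto simp: DL_def level_mat_block_diag)
  show "x \<in> {lmin..lmax}" using Dt_spec[OF l i(1)] i(2) by (simp add: spec_in_def)
  have "no_pole_eigenvalue \<xi>s (Dt (l, i))" using no_pole[of l] l node_at[OF i(1)] by simp
  then show "poly (pole_poly \<xi>s) x \<noteq> 0"
    by (rule pole_poly_nonzero_at_eigenvalue[OF cc _ symmD(1)[OF Dt_symm[OF l(2) i(1)]] i(2)])
qed

section \<open>Accumulation of the level errors\<close>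

text \<open>Cancelling a factor \<open>h\<close> of the pole polynomial lowers the admissible degree by \<open>degree h\<close>, and the smaller
  Krylov space is contained in the original one because \<open>x\<^sup>a/q = h x\<^sup>a/(h q)\<close>. The space splits along the
  blocks of the level.\<close>

lemma level_krylov:
  assumes l: "1 \<le> l" "l \<le> L" and hq: "pole_poly \<xi>s = h * q" and a: "degree h + a < length \<xi>s"
  shows "WL l * (transpose_mat (WL l) * (rat_fun (monom 1 a) q (DL l) * ZL l)) = rat_fun (monom 1 a) q (DL l) * ZL l"
proof -
  let ?R = "\<lambda>i. rat_fun (monom 1 a) q (Dt (l, i))"
  have R: "rat_fun (monom 1 a) q (DL l) = block_diag ?R (2 ^ l)"
    unfolding rat_fun_def DL_def level_mat_block_diag by (rule block_diag_mat_fun) (rule Dt_symm[OF l(2)])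
  have Rd: "dim_row (?R i) = dimD l i" "dim_col (?R i) = dimD l i" if "i < 2 ^ l" for i
    using Dt_symm[OF l(2) that] by auto
  have RZ: "rat_fun (monom 1 a) q (DL l) * ZL l = block_diag (\<lambda>i. ?R i * Z (l, i)) (2 ^ l)"
    unfolding R ZL_def level_mat_block_diag by (rule block_diag_mult) (simp add: Rd node_dims(1,2)[OF l(2)] node_dims(3-5)[OF l] node_dims(6))
  have WRZ: "transpose_mat (WL l) * (rat_fun (monom 1 a) q (DL l) * ZL l)
      = block_diag (\<lambda>i. transpose_mat (W (l, i)) * (?R i * Z (l, i))) (2 ^ l)"
    unfolding RZ WL_def level_mat_block_diag block_diag_transpose
    by (rule block_diag_mult) (simp add: Rd node_dims(1,2)[OF l(2)] node_dims(3-5)[OF l] node_dims(6))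
  have "WL l * (transpose_mat (WL l) * (rat_fun (monom 1 a) q (DL l) * ZL l))
      = block_diag (\<lambda>i. W (l, i) * (transpose_mat (W (l, i)) * (?R i * Z (l, i)))) (2 ^ l)"
    unfolding WRZ unfolding WL_def level_mat_block_diag by (rule block_diag_mult) simp
  also have "\<dots> = block_diag (\<lambda>i. ?R i * Z (l, i)) (2 ^ l)"
  proof (rule block_diag_cong)
    fix i :: nat assume i: "i < 2 ^ l"
    note Di = Dt_symm[OF l(2) i]
    have np: "no_pole_eigenvalue \<xi>s (Dt (l, i))" using no_pole[of l] l node_at[OF i] by simp
    have deg: "degree (h * monom 1 a) < length \<xi>s"
      using degree_mult_le[of h "monom 1 a"] a by (simp add: degree_monom_eq)
    have "?R i = rat_fun (h * monom 1 a) (pole_poly \<xi>s) (Dt (l, i))"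
      unfolding rat_fun_def
    proof (rule mat_fun_cong[OF Di])
      fix x assume "eigenvalue (Dt (l, i)) x"
      then have "poly (pole_poly \<xi>s) x \<noteq> 0"
        by (rule pole_poly_nonzero_at_eigenvalue[OF cc np symmD(1)[OF Di]])
      then show "poly (monom 1 a) x / poly q x = poly (h * monom 1 a) x / poly (pole_poly \<xi>s) x"
        by (simp add: hq)
    qed
    then show "W (l, i) * (transpose_mat (W (l, i)) * (?R i * Z (l, i))) = ?R i * Z (l, i)"
      using krylov_basis_contains[OF Di Z_carrier[OF l i] cc np W_krylov[OF l i] deg] by simp
  qed
  finally show ?thesis unfolding RZ .
qed

lemma level_update_exact:
  assumes l: "1 \<le> l" "l \<le> L"
    and hq: "pole_poly \<xi>s = h * q" and hp: "p = h * p'" and p: "p = 0 \<or> degree p < length \<xi>s"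
    and q: "\<And>x. x \<in> {lmin..lmax} \<Longrightarrow> poly q x \<noteq> 0"
  shows "rat_fun p' q (AL l) - rat_fun p' q (DL l)
    = WL l * rat_fun p' q (transpose_mat (WL l) * AL l * WL l) * transpose_mat (WL l)
      - WL l * rat_fun p' q (transpose_mat (WL l) * DL l * WL l) * transpose_mat (WL l)"
proof -
  obtain k where k: "l = Suc k" using l by (cases l) auto
  note D = DL_symm[OF l(2)] and A = AL_symm[OF l(2)] and W = WL_carrier[OF l] and o = WL_orthonormal[OF l]
  have specD: "spec_in (DL l) lmin lmax" using DL_eigenvalue(1)[OF l] by (simp add: spec_in_def)
  have specA: "spec_in (AL l) lmin lmax" by (rule AL_spec[OF l(2)])
  have h: "h \<noteq> 0" "q \<noteq> 0" using hq pole_poly_nonzero[of \<xi>s] by auto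
  show ?thesis
  proof (cases "p' = 0")
    case True
    have z: "WL l * 0\<^sub>m (off (dimW l) (2 ^ l)) (off (dimW l) (2 ^ l)) * transpose_mat (WL l) = 0\<^sub>m (dimL l) (dimL l)"
      using W by simp
    show ?thesis
      unfolding True rat_fun_zero[OF D] rat_fun_zero[OF A] rat_fun_zero[OF compression_symm[OF A W]]
        rat_fun_zero[OF compression_symm[OF D W]] z ..
  next
    case False
    then have "p \<noteq> 0" using h hp by simp
    then have degp: "degree h + degree p' < length \<xi>s"
      using p h False by (simp add: hp degree_mult_eq)
    have degq: "degree h + degree q \<le> length \<xi>s"
      using degree_pole_poly[of \<xi>s] h by (simp add: hq degree_mult_eq)
    interpret krylov_update "dimL l" "off (dimW l) (2 ^ l)" "off (\<lambda>_. r) (2 ^ l)" "length \<xi>s - degree h"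
      "DL l" "AL l" "WL l" "ZL l" "XL k" q
    proof
      show "symm (dimL l) (DL l)" by (rule D)
      show "symm (off (\<lambda>_. r) (2 ^ l)) (XL k)" using XL_symm_inner[of k] l k by simp
      show "ZL l \<in> carrier_mat (dimL l) (off (\<lambda>_. r) (2 ^ l))" by (rule ZL_carrier[OF l])
      show "WL l \<in> carrier_mat (dimL l) (off (dimW l) (2 ^ l))" by (rule W)
      show "transpose_mat (WL l) * WL l = 1\<^sub>m (off (dimW l) (2 ^ l))" by (rule o)
      show "AL l = DL l + ZL l * XL k * transpose_mat (ZL l)" by (simp add: AL_def k)
      show "degree q \<le> length \<xi>s - degree h" using degq by simp
      show "poly q x \<noteq> 0" if "eigenvalue (DL l) x" for x using that specD q by (auto simp: spec_in_def)
      show "poly q x \<noteq> 0" if "eigenvalue (AL l) x" for x using that specA q by (auto simp: spec_in_def)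
      show "poly q x \<noteq> 0" if "eigenvalue (transpose_mat (WL l) * DL l * WL l) x" for x
        using that compression_spec_in[OF D specD W o] q by (auto simp: spec_in_def)
      show "poly q x \<noteq> 0" if "eigenvalue (transpose_mat (WL l) * AL l * WL l) x" for x
        using that compression_spec_in[OF A specA W o] q by (auto simp: spec_in_def)
      show "WL l * (transpose_mat (WL l) * (rat_fun (monom 1 a) q (DL l) * ZL l)) = rat_fun (monom 1 a) q (DL l) * ZL l"
        if "a < length \<xi>s - degree h" for a
        by (rule level_krylov[OF l hq]) (use that in simp)
    qed
    show ?thesis by (rule rational_update_exact) (use degp in simp)
  qed
qed

text \<open>The poles are cancelled here. This requires a point of the interval that is not a pole; any eigenvalue of
  \<open>D\<^sub>l\<close> is one, and if there is none all matrices of the level are empty.\<close>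

lemma level_bound:
  assumes l: "1 \<le> l" "l \<le> L" and cont: "continuous_on {lmin..lmax} f" and m: "m \<ge> 0"
    and p: "p = 0 \<or> degree p < length \<xi>s"
    and le: "\<And>x. x \<in> {lmin..lmax} \<Longrightarrow> poly (pole_poly \<xi>s) x \<noteq> 0 \<Longrightarrow>
      \<bar>f x - poly p x / poly (pole_poly \<xi>s) x\<bar> \<le> m"
  shows "opnorm_le (mat_fun f (AL l) - mat_fun f (DL l)
      + WL l * mat_fun f (transpose_mat (WL l) * DL l * WL l) * transpose_mat (WL l)
      - WL l * mat_fun f (transpose_mat (WL l) * AL l * WL l) * transpose_mat (WL l)) (4 * m)"
proof (cases "dimL l = 0")
  case True
  then show ?thesis using WL_carrier[OF l] m by (intro opnorm_le_dim_0) auto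
next
  case False
  note D = DL_symm[OF l(2)] and A = AL_symm[OF l(2)] and W = WL_carrier[OF l] and o = WL_orthonormal[OF l]
  obtain x where "eigenvalue (DL l) x"
    using real_eigenvalue_of_symmetric[OF symmD(1,4)[OF D]] False by auto
  then have "\<exists>x\<in>{lmin..lmax}. poly (pole_poly \<xi>s) x \<noteq> 0" using DL_eigenvalue[OF l] by blast
  from finite_error_cancels_poles[OF cont pole_poly_nonzero this le]
  obtain h p' q where hp: "p = h * p'" and hq: "pole_poly \<xi>s = h * q"
    and q: "\<And>x. x \<in> {lmin..lmax} \<Longrightarrow> poly q x \<noteq> 0"
    and close: "\<And>x. x \<in> {lmin..lmax} \<Longrightarrow> \<bar>f x - poly p' x / poly q x\<bar> \<le> m"
    by blast
  have specD: "spec_in (DL l) lmin lmax" using DL_eigenvalue(1)[OF l] by (simp add: spec_in_def)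
  show ?thesis
    by (rule level_error[OF D A W o specD AL_spec[OF l(2)] m close
        level_update_exact[OF l hq hp p q, unfolded rat_fun_def]])
qed

lemma level_C:
  assumes l: "1 \<le> l" "l \<le> L"
  shows "level_mat C l = mat_fun f (DL l)
    - WL l * mat_fun f (transpose_mat (WL l) * DL l * WL l) * transpose_mat (WL l)"
proof -
  let ?K = "\<lambda>i. transpose_mat (W (l, i)) * Dt (l, i) * W (l, i)"
  have Ks: "symm (dimW l i) (?K i)" if "i < 2 ^ l" for i
    by (rule compression_symm[OF Dt_symm[OF l(2) that] W_carrier(1)[OF l that]])
  have Kd: "dim_row (mat_fun f (?K i)) = dimW l i" "dim_col (mat_fun f (?K i)) = dimW l i" if "i < 2 ^ l" for i
    using mat_fun_dim[OF Ks[OF that]] by auto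
  have Dd: "dim_row (mat_fun f (Dt (l, i))) = dimD l i" "dim_col (mat_fun f (Dt (l, i))) = dimD l i" if "i < 2 ^ l" for i
    using mat_fun_dim[OF Dt_symm[OF l(2) that]] by auto
  have "transpose_mat (WL l) * DL l = block_diag (\<lambda>i. transpose_mat (W (l, i)) * Dt (l, i)) (2 ^ l)"
    unfolding WL_def DL_def level_mat_block_diag block_diag_transpose
    by (rule block_diag_mult) (simp add: node_dims(1,2)[OF l(2)] node_dims(3-5)[OF l] node_dims(6))
  then have "transpose_mat (WL l) * DL l * WL l = block_diag ?K (2 ^ l)"
    unfolding WL_def level_mat_block_diag by (simp only:, intro block_diag_mult) (simp add: node_dims(1,2)[OF l(2)] node_dims(3-5)[OF l] node_dims(6))
  then have K: "mat_fun f (transpose_mat (WL l) * DL l * WL l) = block_diag (\<lambda>i. mat_fun f (?K i)) (2 ^ l)"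
    using block_diag_mat_fun[of "2 ^ l" "dimW l" ?K f] Ks by simp
  have D: "mat_fun f (DL l) = block_diag (\<lambda>i. mat_fun f (Dt (l, i))) (2 ^ l)"
    unfolding DL_def level_mat_block_diag by (rule block_diag_mat_fun) (rule Dt_symm[OF l(2)])
  have WK: "WL l * mat_fun f (transpose_mat (WL l) * DL l * WL l) = block_diag (\<lambda>i. W (l, i) * mat_fun f (?K i)) (2 ^ l)"
    unfolding K unfolding WL_def level_mat_block_diag by (rule block_diag_mult) (simp add: Kd node_dims(1,2)[OF l(2)] node_dims(3-5)[OF l] node_dims(6))
  have "WL l * mat_fun f (transpose_mat (WL l) * DL l * WL l) * transpose_mat (WL l)
    = block_diag (\<lambda>i. W (l, i) * mat_fun f (?K i) * transpose_mat (W (l, i))) (2 ^ l)"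
    unfolding WK unfolding WL_def level_mat_block_diag block_diag_transpose
    by (rule block_diag_mult) (simp add: Kd node_dims(1,2)[OF l(2)] node_dims(3-5)[OF l] node_dims(6))
  then have "mat_fun f (DL l) - WL l * mat_fun f (transpose_mat (WL l) * DL l * WL l) * transpose_mat (WL l)
    = block_diag (\<lambda>i. mat_fun f (Dt (l, i)) - W (l, i) * mat_fun f (?K i) * transpose_mat (W (l, i))) (2 ^ l)"
    unfolding D by (simp only:, intro block_diag_minus) (simp_all add: Dd node_dims(1,2)[OF l(2)] node_dims(3-5)[OF l] node_dims(6))
  also have "\<dots> = level_mat C l"
    unfolding level_mat_block_diag by (rule block_diag_cong) (rule C_eq[OF l, symmetric])
  finally show ?thesis by simp
qed

lemma output_carrier: "l \<le> L \<Longrightarrow> telescopic C W l \<in> carrier_mat (dimL l) (dimL l)"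
proof (induction l)
  case 0
  have "C (0, 0) = mat_fun f (Dt (0, 0))" using run by (simp add: alg_run_def)
  then show ?case using symmD(1)[OF mat_fun_symm[OF Dt_symm[of 0 0]]] by (simp add: dimL_def off_def)
next
  case (Suc l)
  have l: "1 \<le> Suc l" using Suc by simp
  show ?case
    using WL_carrier[OF l Suc.prems] by (auto simp: WL_def[symmetric] intro!: carrier_matI)
qed

text \<open>The error at level \<open>l + 1\<close> is the level error plus the error at level \<open>l\<close> carried by the isometry.\<close>

lemma output_error:
  assumes "l \<le> L" and cont: "continuous_on {lmin..lmax} f" and m: "m \<ge> 0"
    and p: "p = 0 \<or> degree p < length \<xi>s"
    and le: "\<And>x. x \<in> {lmin..lmax} \<Longrightarrow> poly (pole_poly \<xi>s) x \<noteq> 0 \<Longrightarrow>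
      \<bar>f x - poly p x / poly (pole_poly \<xi>s) x\<bar> \<le> m"
  shows "opnorm_le (mat_fun f (AL l) - telescopic C W l) (4 * real l * m)"
  using assms(1)
proof (induction l)
  case 0
  have "C (0, 0) = mat_fun f (Dt (0, 0))" using run by (simp add: alg_run_def)
  then have C: "C (0, 0) = mat_fun f (AL 0)" by (simp add: AL_def DL_def level_mat_block_diag block_diag_1)
  have c: "mat_fun f (AL 0) \<in> carrier_mat (dimL 0) (dimL 0)" by (rule symmD(1)[OF mat_fun_symm[OF AL_symm]]) simp
  have "mat_fun f (AL 0) - C (0, 0) = 0\<^sub>m (dimL 0) (dimL 0)" unfolding C by (rule minus_r_inv_mat[OF c])
  moreover have "vnorm (0\<^sub>m (dimL 0) (dimL 0) *\<^sub>v v) = 0" if "v \<in> carrier_vec (dimL 0)" for v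
  proof -
    have "0\<^sub>m (dimL 0) (dimL 0) *\<^sub>v v = 0\<^sub>v (dimL 0)" using that by (intro eq_vecI) auto
    then show ?thesis by (simp add: vnorm_def)
  qed
  ultimately show ?case by (simp add: opnorm_le_def)
next
  case (Suc l)
  let ?W = "WL (Suc l)"
  have l: "1 \<le> Suc l" "Suc l \<le> L" using Suc by auto
  have w: "off (dimW (Suc l)) (2 ^ Suc l) = dimL l" using dimL_inner l by simp
  note W = WL_carrier[OF l, unfolded w] and o = WL_orthonormal[OF l, unfolded w]
  let ?d = "dimL (Suc l)"
  define G where "G = ?W * mat_fun f (transpose_mat ?W * DL (Suc l) * ?W) * transpose_mat ?W"
  define H where "H = ?W * mat_fun f (AL l) * transpose_mat ?W"
  define E where "E = mat_fun f (AL l) - telescopic C W l"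
  have Al: "mat_fun f (AL l) \<in> carrier_mat (dimL l) (dimL l)" by (rule symmD(1)[OF mat_fun_symm[OF AL_symm]]) (use l in simp)
  have Fl: "telescopic C W l \<in> carrier_mat (dimL l) (dimL l)" using output_carrier l by simp
  have As: "mat_fun f (AL (Suc l)) \<in> carrier_mat ?d ?d" by (rule symmD(1)[OF mat_fun_symm[OF AL_symm[OF l(2)]]])
  have Ds: "mat_fun f (DL (Suc l)) \<in> carrier_mat ?d ?d" by (rule symmD(1)[OF mat_fun_symm[OF DL_symm[OF l(2)]]])
  have Ec: "E \<in> carrier_mat (dimL l) (dimL l)" using Fl by (simp add: E_def minus_carrier_mat)
  have Gc: "G \<in> carrier_mat ?d ?d" and Hc: "H \<in> carrier_mat ?d ?d"
    unfolding G_def H_def using W by (auto intro!: carrier_matI)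
  have WEW: "?W * E * transpose_mat ?W \<in> carrier_mat ?d ?d" using W Ec by simp
  define B where "B = mat_fun f (AL (Suc l)) - mat_fun f (DL (Suc l)) + G - H"
  have Bc: "B \<in> carrier_mat ?d ?d" using Hc by (simp add: B_def minus_carrier_mat)
  have 1: "opnorm_le B (4 * m)"
    using level_bound[OF l cont m p le] AL_compress[of l] l by (simp add: B_def G_def H_def)
  have 2: "opnorm_le (?W * E * transpose_mat ?W) (4 * real l * m)"
    by (rule opnorm_le_congruence[OF W o Ec]) (use Suc m in \<open>auto simp: E_def\<close>)
  have F: "telescopic C W (Suc l) = mat_fun f (DL (Suc l)) - G + ?W * telescopic C W l * transpose_mat ?W"
    using level_C[OF l] by (simp add: G_def WL_def)
  have WE: "?W * E * transpose_mat ?W = H - ?W * telescopic C W l * transpose_mat ?W"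
    unfolding E_def H_def using carrier_matD[OF W] carrier_matD[OF Al] carrier_matD[OF Fl]
    by (simp add: mat_dim_simps)
  have "mat_fun f (AL (Suc l)) - telescopic C W (Suc l) = B + ?W * E * transpose_mat ?W"
    unfolding F WE B_def using carrier_matD[OF As] carrier_matD[OF Ds] carrier_matD[OF Gc] carrier_matD[OF Hc] carrier_matD[OF W]
    by (intro eq_matI) (simp_all del: index_mult_mat(1))
  then have "opnorm_le (mat_fun f (AL (Suc l)) - telescopic C W (Suc l)) (4 * m + 4 * real l * m)"
    using opnorm_le_add[OF Bc WEW 1 2] by simp
  then show ?case by (simp add: algebra_simps)
qed

end

section \<open>The error bound\<close>

theorem theorem5p3:
  fixes A :: "real mat" and n L r :: nat and T :: "node \<Rightarrow> nat list"
    and f :: "real \<Rightarrow> real" and lmin lmax :: real and \<xi>s :: "complex option list"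
    and U D Z Dt W C :: "node \<Rightarrow> real mat"
  assumes "cluster_tree n L T"
    and "A \<in> carrier_mat n n" and "transpose_mat A = A"
    and "hss_matrix n L T r A"
    and "lmin \<le> lmax" and "\<And>x. eigenvalue A x \<Longrightarrow> x \<in> {lmin..lmax}"
    and "analytic_on_interval f lmin lmax"
    and "conj_closed \<xi>s"
    and "sym_telescopic_decomp L T r A U D" and "standard_decomp L T r U D"
    and "\<And>l \<tau>. l \<in> {1..L} \<Longrightarrow> \<tau> \<in> nodes_at l \<Longrightarrow> no_pole_eigenvalue \<xi>s (Dt \<tau>)"
    and "alg_run L f \<xi>s U D Z Dt W C"
  shows "\<exists>\<rho>. is_arg_min
                (\<lambda>\<rho>. sup_norm_on (interval_off_poles \<xi>s lmin lmax) (\<lambda>x. f x - \<rho> x))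
                (\<lambda>\<rho>. \<rho> \<in> rational_space \<xi>s) \<rho> \<and>
             ennreal (spectral_norm (mat_fun f A - telescopic C W L))
               \<le> of_nat (4 * L) *
                 sup_norm_on (interval_off_poles \<xi>s lmin lmax) (\<lambda>x. f x - \<rho> x)"
proof -
  interpret hss_run A n L r T f lmin lmax \<xi>s U D Z Dt W C
    by unfold_locales (use assms in \<open>auto simp: spec_in_def\<close>)
  let ?S = "interval_off_poles \<xi>s lmin lmax"
  let ?N = "\<lambda>\<rho>. sup_norm_on ?S (\<lambda>x. f x - \<rho> x)"
  have cont: "continuous_on {lmin..lmax} f" by (rule analytic_on_interval_continuous[OF assms(7)])
  then have "bounded (f ` {lmin..lmax})" by (intro compact_imp_bounded compact_continuous_image) auto
  then obtain B where B: "\<And>x. x \<in> {lmin..lmax} \<Longrightarrow> \<bar>f x\<bar> \<le> B"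
    unfolding bounded_iff by (metis image_eqI real_norm_def)
  have S: "x \<in> ?S \<longleftrightarrow> x \<in> {lmin..lmax} \<and> poly (pole_poly \<xi>s) x \<noteq> 0" for x
    by (auto simp: interval_off_poles_def)
  obtain \<rho> where \<rho>: "is_arg_min ?N (\<lambda>\<rho>. \<rho> \<in> rational_space \<xi>s) \<rho>"
    using best_rational_exists[of ?S \<xi>s f B] S B by blast
  then have "\<rho> \<in> rational_space \<xi>s" by (simp add: is_arg_min_def)
  then obtain p where p: "p = 0 \<or> degree p < length \<xi>s" "\<rho> = (\<lambda>x. poly p x / poly (pole_poly \<xi>s) x)"
    by (auto simp: rational_space_def)
  have "(\<lambda>x. 0) \<in> rational_space \<xi>s" unfolding rational_space_def by (intro CollectI exI[of _ 0]) auto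
  then have "?N \<rho> \<le> ?N (\<lambda>x. 0)" using \<rho> by (auto simp: is_arg_min_def not_less)
  also have "\<dots> \<le> ennreal (max B 0)"
    by (subst sup_norm_on_le_iff) (use S B in \<open>auto simp: le_max_iff_disj\<close>)
  finally obtain m where m: "m \<ge> 0" "?N \<rho> = ennreal m"
    by (metis ennreal_cases ennreal_neq_top neq_top_trans)
  have le: "\<bar>f x - poly p x / poly (pole_poly \<xi>s) x\<bar> \<le> m"
    if "x \<in> {lmin..lmax}" "poly (pole_poly \<xi>s) x \<noteq> 0" for x
    using sup_norm_on_le_iff[OF m(1), of ?S "\<lambda>x. f x - \<rho> x"] m(2) S[of x] that p(2) by auto
  have "spectral_norm (mat_fun f A - telescopic C W L) \<le> 4 * real L * m"
    using output_error[OF order.refl cont m(1) p(1) le] m(1) by (intro spectral_norm_le) (auto simp: AL_leaf)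
  then have "ennreal (spectral_norm (mat_fun f A - telescopic C W L)) \<le> ennreal (real (4 * L) * m)"
    by (intro ennreal_leI) simp
  also have "\<dots> = of_nat (4 * L) * ?N \<rho>"
    unfolding m(2) using m(1) by (simp only: ennreal_mult of_nat_0_le_iff ennreal_of_nat_eq_real_of_nat)
  finally show ?thesis using \<rho> by blast
qed

end
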